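(* (1) Let $A$ be an integral domain with quotient field $K$, and let $R:=A\propto K$ be the trivial ring extension of $A$ by the $A$-module $K$. Then $R$ is a pseudo-arithmetical ring. (2) Let $A\subseteq B$ be an extension of rings and let $R:=A\propto B$ be the trivial ring extension of $A$ by the $A$-module $B$. If $R$ is a pseudo-arithmetical ring, then so is $A$.
   Context: All rings are commutative with identity and all modules are unital. For a ring $A$ and an $A$-module $E$, the trivial ring extension (idealization) $A\propto E$ is the ring with underlying additive group $A\times E$ and multiplication $(a,e)(a',e')=(aa',ae'+a'e)$. When $A\subseteq B$ is an extension of rings, $B$ is regarded as an $A$-module via the inclusion. For a polynomial $f$ over a ring $R$, the content $c(f)$ is the ideal of $R$ generated by the coefficients of $f$. A polynomial $f\in R[x]$ is Gaussian if $c(fg)=c(f)c(g)$ for every $g\in R[x]$. An ideal is locally principal if its localization at every maximal ideal of the ring is principal. A ring $R$ is pseudo-arithmetical if every Gaussian polynomial over $R$ has locally principal content ideal. *)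

theory Defs
  imports "HOL-Algebra.UnivPoly" "HOL-Algebra.Subrings" "HOL-Algebra.Ideal_Product"
begin

section \<open>Trivial ring extensions\<close>

definition triv_ext :: "('a, 'm) ring_scheme \<Rightarrow> ('a, 'b, 'n) module_scheme \<Rightarrow> ('a \<times> 'b) ring"
  where "triv_ext A E =
    \<lparr>carrier = carrier A \<times> carrier E,
     monoid.mult = (\<lambda>(a, e) (a', e'). (a \<otimes>\<^bsub>A\<^esub> a', a \<odot>\<^bsub>E\<^esub> e' \<oplus>\<^bsub>E\<^esub> a' \<odot>\<^bsub>E\<^esub> e)),
     one = (\<one>\<^bsub>A\<^esub>, \<zero>\<^bsub>E\<^esub>),
     zero = (\<zero>\<^bsub>A\<^esub>, \<zero>\<^bsub>E\<^esub>),
     add = (\<lambda>(a, e) (a', e'). (a \<oplus>\<^bsub>A\<^esub> a', e \<oplus>\<^bsub>E\<^esub> e'))\<rparr>"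

text \<open>A ring \<open>B\<close> with its own multiplication as scalar multiplication. It is a module over every
  subring of \<open>B\<close>; the scalars are not recorded in the module record.\<close>

definition self_module :: "('a, 'm) ring_scheme \<Rightarrow> ('a, 'a) module"
  where "self_module B =
    \<lparr>carrier = carrier B, monoid.mult = (\<otimes>\<^bsub>B\<^esub>), one = \<one>\<^bsub>B\<^esub>, zero = \<zero>\<^bsub>B\<^esub>, add = (\<oplus>\<^bsub>B\<^esub>),
     smult = (\<otimes>\<^bsub>B\<^esub>)\<rparr>"

definition is_quotient_field :: "'a set \<Rightarrow> ('a, 'm) ring_scheme \<Rightarrow> bool"
  where "is_quotient_field A K \<longleftrightarrow>
    field K \<and> subdomain A K \<and>
    (\<forall>x \<in> carrier K. \<exists>a \<in> A. \<exists>b \<in> A - {\<zero>\<^bsub>K\<^esub>}. x = a \<otimes>\<^bsub>K\<^esub> inv\<^bsub>K\<^esub> b)"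


section \<open>Localization\<close>

definition frac_rel :: "('a, 'm) ring_scheme \<Rightarrow> 'a set \<Rightarrow> (('a \<times> 'a) \<times> ('a \<times> 'a)) set"
  where "frac_rel R S =
    {((r, s), (r', s')). r \<in> carrier R \<and> s \<in> S \<and> r' \<in> carrier R \<and> s' \<in> S \<and>
       (\<exists>t \<in> S. t \<otimes>\<^bsub>R\<^esub> (s' \<otimes>\<^bsub>R\<^esub> r) = t \<otimes>\<^bsub>R\<^esub> (s \<otimes>\<^bsub>R\<^esub> r'))}"

definition loc_frac :: "('a, 'm) ring_scheme \<Rightarrow> 'a set \<Rightarrow> 'a \<Rightarrow> 'a \<Rightarrow> ('a \<times> 'a) set"
  where "loc_frac R S r s = frac_rel R S `` {(r, s)}"

text \<open>The unions below range over all representatives of the two fractions; they collapse to a single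
  class because the operations are well defined (lemmas \<open>localization_mult\<close> and
  \<open>localization_add\<close>).\<close>

definition localization :: "('a, 'm) ring_scheme \<Rightarrow> 'a set \<Rightarrow> ('a \<times> 'a) set ring"
  where "localization R S =
    \<lparr>carrier = (carrier R \<times> S) // frac_rel R S,
     monoid.mult = (\<lambda>X Y. \<Union>(r, s) \<in> X. \<Union>(r', s') \<in> Y. loc_frac R S (r \<otimes>\<^bsub>R\<^esub> r') (s \<otimes>\<^bsub>R\<^esub> s')),
     one = loc_frac R S \<one>\<^bsub>R\<^esub> \<one>\<^bsub>R\<^esub>,
     zero = loc_frac R S \<zero>\<^bsub>R\<^esub> \<one>\<^bsub>R\<^esub>,
     add = (\<lambda>X Y. \<Union>(r, s) \<in> X. \<Union>(r', s') \<in> Y.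
              loc_frac R S ((s' \<otimes>\<^bsub>R\<^esub> r) \<oplus>\<^bsub>R\<^esub> (s \<otimes>\<^bsub>R\<^esub> r')) (s \<otimes>\<^bsub>R\<^esub> s'))\<rparr>"

definition localized_ideal :: "('a, 'm) ring_scheme \<Rightarrow> 'a set \<Rightarrow> 'a set \<Rightarrow> ('a \<times> 'a) set set"
  where "localized_ideal R S I = {loc_frac R S a s | a s. a \<in> I \<and> s \<in> S}"

definition locally_principal :: "('a, 'm) ring_scheme \<Rightarrow> 'a set \<Rightarrow> bool"
  where "locally_principal R I \<longleftrightarrow>
    (\<forall>M. maximalideal M R \<longrightarrow>
       principalideal (localized_ideal R (carrier R - M) I) (localization R (carrier R - M)))"


section \<open>Gaussian polynomials\<close>

definition content :: "('a, 'm) ring_scheme \<Rightarrow> (nat \<Rightarrow> 'a) \<Rightarrow> 'a set"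
  where "content R f = genideal R (range (coeff (UP R) f))"

definition gaussian :: "('a, 'm) ring_scheme \<Rightarrow> (nat \<Rightarrow> 'a) \<Rightarrow> bool"
  where "gaussian R f \<longleftrightarrow>
    f \<in> carrier (UP R) \<and>
    (\<forall>g \<in> carrier (UP R). content R (f \<otimes>\<^bsub>UP R\<^esub> g) = ideal_prod R (content R f) (content R g))"

definition pseudo_arithmetical :: "('a, 'm) ring_scheme \<Rightarrow> bool"
  where "pseudo_arithmetical R \<longleftrightarrow>
    cring R \<and> (\<forall>f. gaussian R f \<longrightarrow> locally_principal R (content R f))"


section \<open>The constructions are well defined\<close>

lemma triv_ext_cring:
  assumes "module A E"
  shows "cring (triv_ext A E)"
proof -
  interpret module A E by fact
  show ?thesis
  proof (rule cringI)
    show "abelian_group (triv_ext A E)"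
    proof (rule abelian_groupI)
      fix x assume "x \<in> carrier (triv_ext A E)"
      then obtain a e where x: "x = (a, e)" "a \<in> carrier A" "e \<in> carrier E"
        by (auto simp: triv_ext_def)
      have "(\<ominus>\<^bsub>A\<^esub> a, \<ominus>\<^bsub>E\<^esub> e) \<in> carrier (triv_ext A E)
          \<and> (\<ominus>\<^bsub>A\<^esub> a, \<ominus>\<^bsub>E\<^esub> e) \<oplus>\<^bsub>triv_ext A E\<^esub> x = \<zero>\<^bsub>triv_ext A E\<^esub>"
        using x by (auto simp: triv_ext_def R.l_neg M.l_neg)
      thus "\<exists>y\<in>carrier (triv_ext A E). y \<oplus>\<^bsub>triv_ext A E\<^esub> x = \<zero>\<^bsub>triv_ext A E\<^esub>" by blast
    qed (auto simp: triv_ext_def R.a_ac M.a_ac)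
    show "comm_monoid (triv_ext A E)"
      by (rule comm_monoidI)
         (auto simp: triv_ext_def R.m_ac M.a_ac smult_r_distr smult_assoc1[symmetric])
  qed (auto simp: triv_ext_def R.l_distr smult_l_distr smult_r_distr M.a_ac)
qed

lemma self_module_module:
  assumes "cring B" "subring A B"
  shows "module (B\<lparr>carrier := A\<rparr>) (self_module B)"
proof -
  interpret B: cring B by fact
  have sub: "A \<subseteq> carrier B" using assms(2) by (rule subringE(1))
  have "cring (B\<lparr>carrier := A\<rparr>)"
    using B.subcringI'[OF assms(2)] B.subcring_iff[OF sub] by blast
  moreover have "abelian_group (self_module B)"
    by (rule abelian_groupI)
       (auto simp: self_module_def B.a_ac intro: B.l_neg B.a_inv_closed bexI[of _ "\<ominus>\<^bsub>B\<^esub> _"])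
  ultimately show ?thesis
    by (rule moduleI) (use sub in \<open>auto simp: self_module_def subset_iff B.l_distr B.r_distr B.m_assoc\<close>)
qed

locale mult_set = cring R for R (structure) and S +
  assumes S_sub: "S \<subseteq> carrier R" and S_one: "\<one> \<in> S"
    and S_mult: "\<And>s t. s \<in> S \<Longrightarrow> t \<in> S \<Longrightarrow> s \<otimes> t \<in> S"
begin

lemma S_carr [simp, intro]: "s \<in> S \<Longrightarrow> s \<in> carrier R"
  using S_sub by blast

lemma frac_rel_equiv: "equiv (carrier R \<times> S) (frac_rel R S)"
proof (rule equivI)
  show "frac_rel R S \<subseteq> (carrier R \<times> S) \<times> (carrier R \<times> S)" by (auto simp: frac_rel_def)
  show "refl_on (carrier R \<times> S) (frac_rel R S)"
    using S_one by (auto simp: refl_on_def frac_rel_def)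
  show "sym (frac_rel R S)" by (force simp: sym_def frac_rel_def)
  show "trans (frac_rel R S)"
  proof (rule transI, clarsimp simp: frac_rel_def)
    fix a s b u c v t t'
    assume c: "a \<in> carrier R" "s \<in> S" "b \<in> carrier R" "u \<in> S" "c \<in> carrier R" "v \<in> S" "t \<in> S" "t' \<in> S"
      and 1: "t \<otimes> (u \<otimes> a) = t \<otimes> (s \<otimes> b)" and 2: "t' \<otimes> (v \<otimes> b) = t' \<otimes> (u \<otimes> c)"
    have "(t \<otimes> t' \<otimes> u) \<otimes> (v \<otimes> a) = t' \<otimes> v \<otimes> (t \<otimes> (u \<otimes> a))" using c by (simp add: m_ac)
    also have "\<dots> = t \<otimes> s \<otimes> (t' \<otimes> (v \<otimes> b))" unfolding 1 using c by (simp add: m_ac)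
    also have "\<dots> = (t \<otimes> t' \<otimes> u) \<otimes> (s \<otimes> c)" unfolding 2 using c by (simp add: m_ac)
    finally show "\<exists>t\<in>S. t \<otimes> (v \<otimes> a) = t \<otimes> (s \<otimes> c)" using c S_mult by blast
  qed
qed

lemma frac_eq_iff:
  assumes "a \<in> carrier R" "s \<in> S" "b \<in> carrier R" "u \<in> S"
  shows "loc_frac R S a s = loc_frac R S b u \<longleftrightarrow> (\<exists>t\<in>S. t \<otimes> (u \<otimes> a) = t \<otimes> (s \<otimes> b))"
  unfolding loc_frac_def using assms
  by (subst eq_equiv_class_iff[OF frac_rel_equiv]) (auto simp: frac_rel_def)

lemma mem_frac:
  "(b, u) \<in> loc_frac R S a s \<longleftrightarrow>
    a \<in> carrier R \<and> s \<in> S \<and> b \<in> carrier R \<and> u \<in> S \<and> loc_frac R S b u = loc_frac R S a s"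
proof (cases "a \<in> carrier R \<and> s \<in> S \<and> b \<in> carrier R \<and> u \<in> S")
  case True
  thus ?thesis
    by (subst eq_commute, subst frac_eq_iff) (auto simp: loc_frac_def frac_rel_def)
qed (auto simp: loc_frac_def frac_rel_def)

lemma frac_self: "a \<in> carrier R \<Longrightarrow> s \<in> S \<Longrightarrow> (a, s) \<in> loc_frac R S a s"
  by (simp add: mem_frac)

lemma localization_carrier:
  "carrier (localization R S) = {loc_frac R S a s | a s. a \<in> carrier R \<and> s \<in> S}"
  by (auto simp: localization_def quotient_def loc_frac_def)

lemma frac_closed [simp, intro]:
  "a \<in> carrier R \<Longrightarrow> s \<in> S \<Longrightarrow> loc_frac R S a s \<in> carrier (localization R S)"
  by (auto simp: localization_carrier)

lemma localization_mult:
  assumes "a \<in> carrier R" "s \<in> S" "b \<in> carrier R" "u \<in> S"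
  shows "loc_frac R S a s \<otimes>\<^bsub>localization R S\<^esub> loc_frac R S b u = loc_frac R S (a \<otimes> b) (s \<otimes> u)"
proof -
  have "loc_frac R S (a' \<otimes> b') (s' \<otimes> u') = loc_frac R S (a \<otimes> b) (s \<otimes> u)"
    if m: "(a', s') \<in> loc_frac R S a s" "(b', u') \<in> loc_frac R S b u" for a' s' b' u'
  proof -
    have c: "a' \<in> carrier R" "s' \<in> S" "b' \<in> carrier R" "u' \<in> S" using m by (auto simp: mem_frac)
    obtain t where t: "t \<in> S" "t \<otimes> (s \<otimes> a') = t \<otimes> (s' \<otimes> a)"
      using m(1) frac_eq_iff[OF c(1,2) assms(1,2)] unfolding mem_frac by blast
    obtain t' where t': "t' \<in> S" "t' \<otimes> (u \<otimes> b') = t' \<otimes> (u' \<otimes> b)"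
      using m(2) frac_eq_iff[OF c(3,4) assms(3,4)] unfolding mem_frac by blast
    have "(t \<otimes> t') \<otimes> (s \<otimes> u \<otimes> (a' \<otimes> b')) = (t \<otimes> (s \<otimes> a')) \<otimes> (t' \<otimes> (u \<otimes> b'))"
      using c t(1) t'(1) assms by (simp add: m_ac)
    also have "\<dots> = (t \<otimes> t') \<otimes> (s' \<otimes> u' \<otimes> (a \<otimes> b))"
      unfolding t(2) t'(2) using c t(1) t'(1) assms by (simp add: m_ac)
    finally have eq: "(t \<otimes> t') \<otimes> (s \<otimes> u \<otimes> (a' \<otimes> b')) = (t \<otimes> t') \<otimes> (s' \<otimes> u' \<otimes> (a \<otimes> b))" .
    have "t \<otimes> t' \<in> S" using t(1) t'(1) by (rule S_mult)
    thus ?thesis using c assms S_mult eq by (subst frac_eq_iff) (simp, blast, simp, blast, blast)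
  qed
  hence "(\<Union>(r, s) \<in> loc_frac R S a s. \<Union>(r', s') \<in> loc_frac R S b u. loc_frac R S (r \<otimes> r') (s \<otimes> s'))
      = loc_frac R S (a \<otimes> b) (s \<otimes> u)"
    using frac_self[OF assms(1,2)] frac_self[OF assms(3,4)] by fast
  thus ?thesis by (simp add: localization_def)
qed

lemma localization_add:
  assumes "a \<in> carrier R" "s \<in> S" "b \<in> carrier R" "u \<in> S"
  shows "loc_frac R S a s \<oplus>\<^bsub>localization R S\<^esub> loc_frac R S b u = loc_frac R S ((u \<otimes> a) \<oplus> (s \<otimes> b)) (s \<otimes> u)"
proof -
  have "loc_frac R S ((u' \<otimes> a') \<oplus> (s' \<otimes> b')) (s' \<otimes> u') = loc_frac R S ((u \<otimes> a) \<oplus> (s \<otimes> b)) (s \<otimes> u)"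
    if m: "(a', s') \<in> loc_frac R S a s" "(b', u') \<in> loc_frac R S b u" for a' s' b' u'
  proof -
    have c: "a' \<in> carrier R" "s' \<in> S" "b' \<in> carrier R" "u' \<in> S" using m by (auto simp: mem_frac)
    obtain t where t: "t \<in> S" "t \<otimes> (s \<otimes> a') = t \<otimes> (s' \<otimes> a)"
      using m(1) frac_eq_iff[OF c(1,2) assms(1,2)] unfolding mem_frac by blast
    obtain t' where t': "t' \<in> S" "t' \<otimes> (u \<otimes> b') = t' \<otimes> (u' \<otimes> b)"
      using m(2) frac_eq_iff[OF c(3,4) assms(3,4)] unfolding mem_frac by blast
    have "(t \<otimes> t') \<otimes> (s \<otimes> u \<otimes> ((u' \<otimes> a') \<oplus> (s' \<otimes> b')))
        = (t' \<otimes> u \<otimes> u') \<otimes> (t \<otimes> (s \<otimes> a')) \<oplus> (t \<otimes> s \<otimes> s') \<otimes> (t' \<otimes> (u \<otimes> b'))"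
      using c t(1) t'(1) assms by (simp add: m_ac r_distr)
    also have "\<dots> = (t \<otimes> t') \<otimes> (s' \<otimes> u' \<otimes> ((u \<otimes> a) \<oplus> (s \<otimes> b)))"
      unfolding t(2) t'(2) using c t(1) t'(1) assms by (simp add: m_ac r_distr)
    finally have eq: "(t \<otimes> t') \<otimes> (s \<otimes> u \<otimes> ((u' \<otimes> a') \<oplus> (s' \<otimes> b')))
        = (t \<otimes> t') \<otimes> (s' \<otimes> u' \<otimes> ((u \<otimes> a) \<oplus> (s \<otimes> b)))" .
    have "t \<otimes> t' \<in> S" using t(1) t'(1) by (rule S_mult)
    thus ?thesis using c assms S_mult eq by (subst frac_eq_iff) (simp, blast, simp, blast, blast)
  qed
  hence "(\<Union>(r, s) \<in> loc_frac R S a s. \<Union>(r', s') \<in> loc_frac R S b u.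
            loc_frac R S ((s' \<otimes> r) \<oplus> (s \<otimes> r')) (s \<otimes> s'))
      = loc_frac R S ((u \<otimes> a) \<oplus> (s \<otimes> b)) (s \<otimes> u)"
    using frac_self[OF assms(1,2)] frac_self[OF assms(3,4)] by fast
  thus ?thesis by (simp add: localization_def)
qed

lemma localization_one: "\<one>\<^bsub>localization R S\<^esub> = loc_frac R S \<one> \<one>"
  by (simp add: localization_def)

lemma localization_zero: "\<zero>\<^bsub>localization R S\<^esub> = loc_frac R S \<zero> \<one>"
  by (simp add: localization_def)

lemma frac_eqI:
  assumes "a \<in> carrier R" "s \<in> S" "b \<in> carrier R" "u \<in> S" "u \<otimes> a = s \<otimes> b"
  shows "loc_frac R S a s = loc_frac R S b u"
  using assms S_one by (auto simp: frac_eq_iff)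

lemma localization_cring: "cring (localization R S)"
proof (rule cringI)
  let ?L = "localization R S"
  note ops = localization_mult localization_add localization_one localization_zero S_one S_mult
  note carr = localization_carrier
  show "abelian_group ?L"
  proof (rule abelian_groupI)
    fix x assume "x \<in> carrier ?L"
    then obtain a s where x: "x = loc_frac R S a s" "a \<in> carrier R" "s \<in> S" by (auto simp: carr)
    have "loc_frac R S (\<ominus> a) s \<oplus>\<^bsub>?L\<^esub> x = \<zero>\<^bsub>?L\<^esub>"
      unfolding x localization_zero using x
      by (subst localization_add) (simp_all, rule frac_eqI, simp_all add: S_one S_mult r_minus l_neg)
    thus "\<exists>y\<in>carrier ?L. y \<oplus>\<^bsub>?L\<^esub> x = \<zero>\<^bsub>?L\<^esub>" using x by blast
    show "\<zero>\<^bsub>?L\<^esub> \<oplus>\<^bsub>?L\<^esub> x = x" using x by (simp add: ops)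
  next
    fix x y assume "x \<in> carrier ?L" "y \<in> carrier ?L"
    then obtain a s b u where c: "x = loc_frac R S a s" "a \<in> carrier R" "s \<in> S"
        "y = loc_frac R S b u" "b \<in> carrier R" "u \<in> S" by (auto simp: carr)
    show "x \<oplus>\<^bsub>?L\<^esub> y \<in> carrier ?L" using c by (simp add: ops)
    show "x \<oplus>\<^bsub>?L\<^esub> y = y \<oplus>\<^bsub>?L\<^esub> x" using c by (simp add: ops a_comm m_comm)
    fix z assume "z \<in> carrier ?L"
    then obtain d v where d: "z = loc_frac R S d v" "d \<in> carrier R" "v \<in> S" by (auto simp: carr)
    show "x \<oplus>\<^bsub>?L\<^esub> y \<oplus>\<^bsub>?L\<^esub> z = x \<oplus>\<^bsub>?L\<^esub> (y \<oplus>\<^bsub>?L\<^esub> z)"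
      using c d by (simp add: ops r_distr m_ac a_ac)
  qed (simp add: ops)
  show "comm_monoid ?L"
  proof (rule comm_monoidI)
    fix x y assume "x \<in> carrier ?L" "y \<in> carrier ?L"
    then obtain a s b u where c: "x = loc_frac R S a s" "a \<in> carrier R" "s \<in> S"
        "y = loc_frac R S b u" "b \<in> carrier R" "u \<in> S" by (auto simp: carr)
    show "x \<otimes>\<^bsub>?L\<^esub> y \<in> carrier ?L" using c by (simp add: ops)
    show "x \<otimes>\<^bsub>?L\<^esub> y = y \<otimes>\<^bsub>?L\<^esub> x" using c by (simp add: ops m_comm)
    show "\<one>\<^bsub>?L\<^esub> \<otimes>\<^bsub>?L\<^esub> x = x" using c by (simp add: ops)
    fix z assume "z \<in> carrier ?L"
    then obtain d v where d: "z = loc_frac R S d v" "d \<in> carrier R" "v \<in> S" by (auto simp: carr)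
    show "x \<otimes>\<^bsub>?L\<^esub> y \<otimes>\<^bsub>?L\<^esub> z = x \<otimes>\<^bsub>?L\<^esub> (y \<otimes>\<^bsub>?L\<^esub> z)"
      using c d by (simp add: ops m_assoc)
  qed (simp add: ops)
next
  let ?L = "localization R S"
  note ops = localization_mult localization_add S_one S_mult
  fix x y z assume "x \<in> carrier ?L" "y \<in> carrier ?L" "z \<in> carrier ?L"
  then obtain a s b u d v where c: "x = loc_frac R S a s" "a \<in> carrier R" "s \<in> S"
      "y = loc_frac R S b u" "b \<in> carrier R" "u \<in> S" "z = loc_frac R S d v" "d \<in> carrier R" "v \<in> S"
    by (auto simp: localization_carrier)
  show "(x \<oplus>\<^bsub>?L\<^esub> y) \<otimes>\<^bsub>?L\<^esub> z = x \<otimes>\<^bsub>?L\<^esub> z \<oplus>\<^bsub>?L\<^esub> y \<otimes>\<^bsub>?L\<^esub> z"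
    using c by (simp add: ops, intro frac_eqI) (simp_all add: S_mult l_distr r_distr m_ac)
qed

lemma localized_ideal_ideal:
  assumes "ideal I R"
  shows "ideal (localized_ideal R S I) (localization R S)"
proof -
  interpret I: ideal I R by fact
  interpret L: cring "localization R S" by (rule localization_cring)
  let ?L = "localization R S" and ?J = "localized_ideal R S I"
  have minus: "\<ominus>\<^bsub>?L\<^esub> loc_frac R S a s = loc_frac R S (\<ominus> a) s" if "a \<in> carrier R" "s \<in> S" for a s
  proof (rule L.minus_equality)
    show "loc_frac R S (\<ominus> a) s \<oplus>\<^bsub>?L\<^esub> loc_frac R S a s = \<zero>\<^bsub>?L\<^esub>"
      unfolding localization_zero using that
      by (subst localization_add) (simp_all, rule frac_eqI, simp_all add: S_one S_mult r_minus l_neg)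
  qed (use that in auto)
  show ?thesis
  proof (rule idealI[OF L.ring_axioms])
    show "subgroup ?J (add_monoid ?L)"
    proof (rule L.add.subgroupI)
      show "?J \<subseteq> carrier ?L" by (auto simp: localized_ideal_def)
      show "?J \<noteq> {}" using S_one additive_subgroup.zero_closed[OF I.additive_subgroup_axioms]
        unfolding localized_ideal_def by blast
    next
      fix x assume "x \<in> ?J"
      then obtain a s where "x = loc_frac R S a s" "a \<in> I" "s \<in> S" by (auto simp: localized_ideal_def)
      thus "\<ominus>\<^bsub>?L\<^esub> x \<in> ?J" using minus I.a_inv_closed by (auto simp: localized_ideal_def)
    next
      fix x y assume "x \<in> ?J" "y \<in> ?J"
      then obtain a s b u where "x = loc_frac R S a s" "a \<in> I" "s \<in> S"
          "y = loc_frac R S b u" "b \<in> I" "u \<in> S" by (auto simp: localized_ideal_def)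
      moreover from this have "u \<otimes> a \<oplus> s \<otimes> b \<in> I" by (simp add: I.I_l_closed)
      ultimately show "x \<oplus>\<^bsub>?L\<^esub> y \<in> ?J"
        using S_mult by (auto simp: localized_ideal_def localization_add)
    qed
  next
    fix x y assume "x \<in> ?J" "y \<in> carrier ?L"
    then obtain a s b u where c: "x = loc_frac R S a s" "a \<in> I" "s \<in> S"
        "y = loc_frac R S b u" "b \<in> carrier R" "u \<in> S"
      by (auto simp: localized_ideal_def localization_carrier)
    show "y \<otimes>\<^bsub>?L\<^esub> x \<in> ?J" "x \<otimes>\<^bsub>?L\<^esub> y \<in> ?J"
      unfolding localized_ideal_def c using c(2,3,5,6) S_mult I.I_l_closed I.I_r_closed I.Icarr
      by (simp_all add: localization_mult) blast+
  qed
qed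

end

lemma (in cring) maximalideal_mult_set:
  assumes "maximalideal M R"
  shows "mult_set R (carrier R - M)"
proof -
  interpret primeideal M R by (rule maximalideal_prime[OF assms])
  show ?thesis
    by unfold_locales (use I_prime I_notcarr one_imp_carrier in auto)
qed

end

theory Submission
  imports Defs
begin

text \<open>
  The heart of the matter is the theorem of Loper and Roitman that a Gaussian polynomial \<open>f\<close> over a
  domain \<open>A\<close> has locally principal content \<open>I\<close>. For a prime \<open>M\<close> it suffices to find a polynomial \<open>u\<close>
  with a coefficient outside \<open>M\<close> and a nonzero constant \<open>b\<close> with \<open>b u = f h\<close>: then
  \<open>I c(h) = b c(u)\<close> makes \<open>I\<close> invertible at \<open>M\<close>. Let \<open>D\<close> be \<open>A[X]\<close> localized at \<open>M[X]\<close> and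
  divided by the polynomials that \<open>f\<close> divides over the quotient field; we must show \<open>D = 0\<close>. By
  Nakayama's lemma it is enough that the fiber cone of \<open>I D\<close> vanishes in large degrees, i.e. that
  every coefficient of \<open>f\<close> is nilpotent in it, and this is shown from the top coefficient downwards.
  Once the coefficients above \<open>f\<^sub>e\<close> are nilpotent, the relation \<open>f = 0\<close> reduces each
  \<open>f\<^sub>e\<^sup>T X\<^sup>e\<^sup>+\<^sup>l\<close> with \<open>l < T\<close> to a polynomial of degree less than \<open>e\<close> over \<open>I\<^sup>T\<close>. Since \<open>f\<close> is
  Gaussian, Graeffe's transformation shows that \<open>I\<^sup>T\<close> has at most \<open>deg f + 1\<close> generators for \<open>T\<close> a
  power of two, so for large \<open>T\<close> these reductions are linearly dependent over \<open>A/M\<close>, and a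
  unit of \<open>D\<close> times \<open>f\<^sub>e\<^sup>T\<close> is nilpotent.

  Over \<open>A \<propto> K\<close>, a Gaussian polynomial with nonzero first component \<open>f\<^sub>1\<close> has content
  \<open>c(f\<^sub>1) \<times> K\<close>; one with zero first component is a scalar multiple of \<open>(0, f)\<close> with \<open>f\<close> Gaussian over
  \<open>A\<close>. The latter correspondence also descends the property from \<open>A \<propto> B\<close> to \<open>A\<close>.
\<close>

section \<open>Ideals, elimination and Nakayama's lemma\<close>

no_notation Sum_Type.Plus (infixr \<open><+>\<close> 65)

text \<open>Powers are taken in the monoid of ideals under \<open>ideal_prod\<close>, so the laws of
  exponents come from \<open>comm_monoid\<close>. The exponent 0 gives the whole ring.\<close>

definition ideal_power :: "('a, 'm) ring_scheme \<Rightarrow> 'a set \<Rightarrow> nat \<Rightarrow> 'a set"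
  where "ideal_power R I n = I [^]\<^bsub>ideals_set R\<^esub> n"

section \<open>Arithmetic of ideals: powers, products, sums and colon ideals\<close>

context cring
begin

lemma ideal_power_0: "ideal_power R I 0 = carrier R"
  by (simp add: ideal_power_def ideals_set_def)

lemma ideal_power_Suc: "ideal_power R I (Suc n) = ideal_power R I n \<cdot> I"
  by (simp add: ideal_power_def ideals_set_def)

lemma ideal_power_ideal: "ideal I R \<Longrightarrow> ideal (ideal_power R I n) R"
  using monoid.nat_pow_closed[of "ideals_set R" I n] ideals_set_is_comm_monoid
  by (simp add: ideal_power_def ideals_set_def comm_monoid_def)

lemma ideal_power_1: "ideal I R \<Longrightarrow> ideal_power R I (Suc 0) = I"
  by (simp add: ideal_power_Suc ideal_power_0 ideal_prod_commute[OF oneideal] ideal_prod_one)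

lemma ideal_power_add:
  "ideal I R \<Longrightarrow> ideal_power R I (m + n) = ideal_power R I m \<cdot> ideal_power R I n"
  using monoid.nat_pow_mult[of "ideals_set R" I m n] ideals_set_is_comm_monoid
  by (simp add: ideal_power_def ideals_set_def comm_monoid_def)

lemma ideal_power_mult:
  "ideal I R \<Longrightarrow> ideal_power R I (m * n) = ideal_power R (ideal_power R I m) n"
  using monoid.nat_pow_pow[of "ideals_set R" I m n] ideals_set_is_comm_monoid
  by (simp add: ideal_power_def ideals_set_def comm_monoid_def)

lemma ideal_power_prod:
  "ideal I R \<Longrightarrow> ideal J R \<Longrightarrow> ideal_power R (I \<cdot> J) n = ideal_power R I n \<cdot> ideal_power R J n"
  using comm_monoid.nat_pow_distrib[of "ideals_set R" I J n] ideals_set_is_comm_monoid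
  by (simp add: ideal_power_def ideals_set_def)

lemma ideal_add_mem: "ideal I R \<Longrightarrow> x \<in> I \<Longrightarrow> y \<in> I \<Longrightarrow> x \<oplus> y \<in> I"
  by (simp add: ideal_def additive_subgroup.a_closed)

lemma ideal_minus_mem: "ideal I R \<Longrightarrow> x \<in> I \<Longrightarrow> y \<in> I \<Longrightarrow> x \<ominus> y \<in> I"
  by (simp add: ideal_def a_minus_def additive_subgroup.a_closed additive_subgroup.a_inv_closed)

text \<open>Negatives are multiples by \<open>\<ominus> \<one>\<close> and multiplication is
  commutative, so neither negatives nor right multiples need a separate check.\<close>

lemma ideal_if_closed:
  assumes "I \<subseteq> carrier R" "\<zero> \<in> I" "\<And>x y. x \<in> I \<Longrightarrow> y \<in> I \<Longrightarrow> x \<oplus> y \<in> I"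
    and "\<And>r x. r \<in> carrier R \<Longrightarrow> x \<in> I \<Longrightarrow> r \<otimes> x \<in> I"
  shows "ideal I R"
proof (rule idealI[OF ring_axioms])
  show "subgroup I (add_monoid R)"
  proof (rule add.subgroupI)
    fix x assume x: "x \<in> I"
    hence "\<ominus> x = \<ominus> \<one> \<otimes> x" using assms(1) by (simp add: subset_iff l_minus)
    thus "\<ominus> x \<in> I" using assms(4)[of "\<ominus> \<one>" x] x by simp
  qed (use assms in auto)
  fix x r assume x: "x \<in> I" "r \<in> carrier R"
  thus "r \<otimes> x \<in> I" using assms(4) by simp
  moreover have "x \<otimes> r = r \<otimes> x" using x assms(1) by (simp add: subset_iff m_comm)
  ultimately show "x \<otimes> r \<in> I" by simp
qed

lemma ideal_finsum_mem:
  assumes "ideal I R" "\<And>i. i \<in> S \<Longrightarrow> g i \<in> I"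
  shows "finsum R g S \<in> I"
  using assms(2)
proof (induction S rule: infinite_finite_induct)
  case (insert x F)
  have "g \<in> insert x F \<rightarrow> carrier R" using insert.prems ideal.Icarr[OF assms(1)] by blast
  with insert show ?case by (simp add: ideal_add_mem[OF assms(1)])
qed (simp_all add: additive_subgroup.zero_closed[OF ideal.axioms(1)[OF assms(1)]])

lemma finsum_swap:
  assumes "finite A" "finite B" "\<And>i j. i \<in> A \<Longrightarrow> j \<in> B \<Longrightarrow> g i j \<in> carrier R"
  shows "(\<Oplus>i\<in>A. \<Oplus>j\<in>B. g i j) = (\<Oplus>j\<in>B. \<Oplus>i\<in>A. g i j)"
  using assms(1,3)
proof (induction A rule: finite_induct)
  case (insert x A)
  have c: "g x \<in> B \<rightarrow> carrier R" "(\<lambda>j. \<Oplus>i\<in>A. g i j) \<in> B \<rightarrow> carrier R"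
      "(\<lambda>i. \<Oplus>j\<in>B. g i j) \<in> A \<rightarrow> carrier R"
    using insert.prems by (auto intro!: finsum_closed)
  have "(\<Oplus>i\<in>insert x A. \<Oplus>j\<in>B. g i j) = (\<Oplus>j\<in>B. g x j) \<oplus> (\<Oplus>j\<in>B. \<Oplus>i\<in>A. g i j)"
    using insert c by (subst finsum_insert) (auto intro!: finsum_closed)
  also have "\<dots> = (\<Oplus>j\<in>B. g x j \<oplus> (\<Oplus>i\<in>A. g i j))" using c by (intro finsum_addf[symmetric])
  also have "\<dots> = (\<Oplus>j\<in>B. \<Oplus>i\<in>insert x A. g i j)"
    using insert c by (intro finsum_cong') (auto simp: finsum_insert Pi_iff intro!: finsum_closed)
  finally show ?case .
qed simp

lemma ideal_prod_least:
  assumes "ideal K R" "\<And>i j. i \<in> I \<Longrightarrow> j \<in> J \<Longrightarrow> i \<otimes> j \<in> K"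
  shows "I \<cdot> J \<subseteq> K"
proof
  fix x assume "x \<in> I \<cdot> J"
  thus "x \<in> K" by induction (use assms ideal_add_mem in auto)
qed

lemma ideal_prod_mono: "I \<subseteq> I' \<Longrightarrow> J \<subseteq> J' \<Longrightarrow> I \<cdot> J \<subseteq> I' \<cdot> J'"
proof
  fix x assume "I \<subseteq> I'" "J \<subseteq> J'" "x \<in> I \<cdot> J"
  thus "x \<in> I' \<cdot> J'" by (induction rule: ideal_prod.induct[OF \<open>x \<in> I \<cdot> J\<close>]) (auto intro: ideal_prod.intros)
qed

lemma ideal_power_mono: "I \<subseteq> J \<Longrightarrow> ideal_power R I n \<subseteq> ideal_power R J n"
  by (induction n) (simp_all add: ideal_power_0 ideal_power_Suc ideal_prod_mono)

lemma power_mem_ideal_power: "x \<in> I \<Longrightarrow> x \<in> carrier R \<Longrightarrow> x [^] n \<in> ideal_power R I n"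
  by (induction n) (simp_all add: ideal_power_0 ideal_power_Suc ideal_prod.prod)

lemma ideal_sum_iff: "x \<in> I <+> J \<longleftrightarrow> (\<exists>i\<in>I. \<exists>j\<in>J. x = i \<oplus> j)"
  by (auto simp: set_add_def')

lemma ideal_sum_least: "ideal K R \<Longrightarrow> I \<subseteq> K \<Longrightarrow> J \<subseteq> K \<Longrightarrow> I <+> J \<subseteq> K"
  by (auto simp: ideal_sum_iff ideal_add_mem subset_iff)

lemma ideal_sum_upper:
  assumes "ideal I R" "ideal J R"
  shows "I \<subseteq> I <+> J" "J \<subseteq> I <+> J"
proof -
  have "\<zero> \<in> I" "\<zero> \<in> J" using assms by (simp_all add: ideal_def additive_subgroup.zero_closed)
  moreover have "i = i \<oplus> \<zero>" if "i \<in> I" for i using that ideal.Icarr[OF assms(1)] by simp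
  moreover have "j = \<zero> \<oplus> j" if "j \<in> J" for j using that ideal.Icarr[OF assms(2)] by simp
  ultimately show "I \<subseteq> I <+> J" "J \<subseteq> I <+> J" unfolding subset_iff ideal_sum_iff by blast+
qed

text \<open>Expand the power: the only products without a factor from \<open>J\<close> lie in the
  pure power of \<open>I\<close>, and in all others the remaining \<open>n\<close> factors are
  bounded by \<open>L\<close>. The common bound \<open>L\<close> keeps track of the degree.\<close>

lemma ideal_power_sum_subset:
  assumes "ideal I R" "ideal J R" "ideal L R" "I \<subseteq> L" "J \<subseteq> L"
  shows "ideal_power R (I <+> J) (Suc n) \<subseteq> ideal_power R I (Suc n) <+> J \<cdot> ideal_power R L n"
proof (induction n)
  case 0
  show ?case using assms by (simp add: ideal_power_1 ideal_power_0 ideal_prod_one add_ideals)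
next
  case (Suc n)
  let ?p = "ideal_power R"
  have id: "ideal (?p K m) R" if "ideal K R" for K m using that by (rule ideal_power_ideal)
  have E: "ideal (?p I (Suc (Suc n)) <+> J \<cdot> ?p L (Suc n)) R"
    by (intro add_ideals id ideal_prod_is_ideal assms)
  have "?p (I <+> J) (Suc n) \<cdot> (I <+> J) \<subseteq> ?p I (Suc (Suc n)) <+> J \<cdot> ?p L (Suc n)"
  proof (rule ideal_prod_least[OF E])
    fix x y assume "x \<in> ?p (I <+> J) (Suc n)" "y \<in> I <+> J"
    then obtain p q a b where x: "x = p \<oplus> q" "p \<in> ?p I (Suc n)" "q \<in> J \<cdot> ?p L n"
      and y: "y = a \<oplus> b" "a \<in> I" "b \<in> J"
      using Suc by (meson ideal_sum_iff subsetD)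
    have c: "p \<in> carrier R" "q \<in> carrier R" "a \<in> carrier R" "b \<in> carrier R"
      using x y assms id ideal_prod_is_ideal ideal.Icarr by metis+
    have "y \<in> L" using y assms ideal_add_mem by blast
    hence 1: "q \<otimes> y \<in> J \<cdot> ?p L (Suc n)"
      using x ideal_prod.prod[of q "J \<cdot> ?p L n" y L R] assms id
      by (simp add: ideal_power_Suc ideal_prod_assoc)
    have "p \<in> ?p L (Suc n)" using x ideal_power_mono[OF assms(4)] by blast
    hence 2: "b \<otimes> p \<in> J \<cdot> ?p L (Suc n)" using y by (simp add: ideal_prod.prod)
    have "p \<otimes> a \<in> ?p I (Suc (Suc n))" using x y unfolding ideal_power_Suc[of I "Suc n"] by (simp add: ideal_prod.prod)
    moreover have "b \<otimes> p \<oplus> q \<otimes> y \<in> J \<cdot> ?p L (Suc n)"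
      using 1 2 by (simp add: ideal_prod.sum)
    moreover have "x \<otimes> y = p \<otimes> a \<oplus> (b \<otimes> p \<oplus> q \<otimes> y)"
      unfolding x y using c by algebra
    ultimately show "x \<otimes> y \<in> ?p I (Suc (Suc n)) <+> J \<cdot> ?p L (Suc n)"
      unfolding ideal_sum_iff by blast
  qed
  thus ?case by (simp only: ideal_power_Suc[of "I <+> J" "Suc n"])
qed

text \<open>Multiplication by elements of degree \<open>n\<close> raises the degree of the graded
  part and is absorbed by \<open>F\<close>. It serves both with \<open>C\<close> the prime
  \<open>Q\<close> and with \<open>C\<close> an ideal of elements already known to be
  nilpotent.\<close>

lemma ideal_prod_power_sum_mult:
  assumes C: "ideal C R" and L: "ideal L R" and F: "ideal F R"
    and x: "x \<in> C \<cdot> ideal_power R L m <+> F" and y: "y \<in> ideal_power R L n"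
  shows "x \<otimes> y \<in> C \<cdot> ideal_power R L (m + n) <+> F"
proof -
  have Lp: "ideal (ideal_power R L k) R" for k using L by (rule ideal_power_ideal)
  have yc: "y \<in> carrier R" using y ideal.Icarr[OF Lp] by blast
  obtain a b where ab: "x = a \<oplus> b" "a \<in> C \<cdot> ideal_power R L m" "b \<in> F"
    using x unfolding ideal_sum_iff by blast
  have c: "a \<in> carrier R" "b \<in> carrier R"
    using ab ideal.Icarr[OF F] ideal_prod_in_carrier[OF C Lp] by blast+
  have "a \<otimes> y \<in> C \<cdot> ideal_power R L m \<cdot> ideal_power R L n"
    using ab y by (simp add: ideal_prod.prod)
  hence "a \<otimes> y \<in> C \<cdot> ideal_power R L (m + n)"
    by (simp add: ideal_prod_assoc[OF C Lp Lp] ideal_power_add[OF L])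
  moreover have "b \<otimes> y \<in> F" using ideal.I_r_closed[OF F] ab yc by blast
  moreover have "x \<otimes> y = a \<otimes> y \<oplus> b \<otimes> y" using c yc ab by (simp add: l_distr)
  ultimately show ?thesis unfolding ideal_sum_iff by blast
qed

lemma ideal_power_principal_subset:
  assumes "a \<in> carrier R"
  shows "ideal_power R (PIdl a) n \<subseteq> PIdl (a [^] n)"
proof (induction n)
  case (Suc n)
  have "(PIdl (a [^] n)) \<cdot> (PIdl a) \<subseteq> PIdl (a [^] Suc n)"
  proof (rule ideal_prod_least)
    fix i j assume "i \<in> PIdl (a [^] n)" "j \<in> PIdl a"
    then obtain r s where "i = r \<otimes> a [^] n" "j = s \<otimes> a" "r \<in> carrier R" "s \<in> carrier R"
      by (auto simp: cgenideal_def)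
    moreover from this have "i \<otimes> j = (r \<otimes> s) \<otimes> a [^] Suc n" using assms by (simp add: m_ac)
    ultimately show "i \<otimes> j \<in> PIdl (a [^] Suc n)" by (auto simp: cgenideal_def)
  qed (simp add: assms cgenideal_ideal)
  thus ?case using ideal_prod_mono[OF Suc subset_refl] by (simp only: ideal_power_Suc) blast
next
  case 0
  have "x = x \<otimes> a [^] (0::nat)" if "x \<in> carrier R" for x using that by simp
  thus ?case unfolding ideal_power_0 cgenideal_def by blast
qed

text \<open>Statements of the form \<open>w \<otimes> x \<in> I\<close> for all \<open>x\<close> in
  an ideal are reduced to its generators in this way.\<close>

lemma colon_ideal:
  assumes "ideal I R" "w \<in> carrier R"
  shows "ideal {x \<in> carrier R. w \<otimes> x \<in> I} R"
proof (rule ideal_if_closed)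
  interpret I: ideal I R by fact
  show "\<zero> \<in> {x \<in> carrier R. w \<otimes> x \<in> I}" using assms(2) I.zero_closed by simp
  fix x y assume "x \<in> {x \<in> carrier R. w \<otimes> x \<in> I}" "y \<in> {x \<in> carrier R. w \<otimes> x \<in> I}"
  thus "x \<oplus> y \<in> {x \<in> carrier R. w \<otimes> x \<in> I}" using assms(2) by (simp add: r_distr)
next
  interpret I: ideal I R by fact
  fix r x assume "r \<in> carrier R" "x \<in> {x \<in> carrier R. w \<otimes> x \<in> I}"
  thus "r \<otimes> x \<in> {x \<in> carrier R. w \<otimes> x \<in> I}"
    using assms(2) I.I_l_closed[of "w \<otimes> x" r] by (simp add: m_lcomm)
qed auto

text \<open>Gaussian elimination over the domain \<open>R / M\<close>, by cross multiplication
  instead of division: with more vectors \<open>v l\<close> than coordinates there is a relation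
  whose coefficients, lifted to \<open>R\<close>, do not all lie in \<open>M\<close>. The induction
  removes one coordinate \<open>k0\<close> at a time.\<close>

lemma linear_dependence_mod_prime:
  assumes "primeideal M R" "finite K" "finite S" "card K < card S"
    and "\<And>l k. l \<in> S \<Longrightarrow> k \<in> K \<Longrightarrow> v l k \<in> carrier R"
  shows "\<exists>c. (\<forall>l\<in>S. c l \<in> carrier R) \<and> (\<exists>l\<in>S. c l \<notin> M) \<and> (\<forall>k\<in>K. (\<Oplus>l\<in>S. c l \<otimes> v l k) \<in> M)"
  using assms(2-)
proof (induction K arbitrary: S v rule: finite_induct)
  case empty
  interpret M: primeideal M R by fact
  have "\<one> \<notin> M" using M.I_notcarr M.one_imp_carrier by blast
  moreover have "S \<noteq> {}" using empty by auto
  ultimately show ?case by (intro exI[of _ "\<lambda>_. \<one>"]) auto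
next
  case (insert k0 K)
  interpret M: primeideal M R by fact
  note idM = M.is_ideal
  show ?case
  proof (cases "\<forall>l\<in>S. v l k0 \<in> M")
    case True
    obtain c where c: "\<forall>l\<in>S. c l \<in> carrier R" "\<exists>l\<in>S. c l \<notin> M" "\<forall>k\<in>K. (\<Oplus>l\<in>S. c l \<otimes> v l k) \<in> M"
      using insert.IH[of S v] insert.prems insert.hyps by auto
    have "(\<Oplus>l\<in>S. c l \<otimes> v l k0) \<in> M"
      using True c by (intro ideal_finsum_mem[OF idM]) (simp add: M.I_l_closed)
    thus ?thesis using c by blast
  next
    case False
    then obtain p where p: "p \<in> S" "v p k0 \<notin> M" by blast
    let ?S = "S - {p}"
    let ?d = "v p k0"
    have vc: "v l k \<in> carrier R" if "l \<in> S" "k \<in> insert k0 K" for l k using insert.prems that by blast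
    \<comment> \<open>The pivot vector \<open>v p\<close> clears coordinate \<open>k0\<close> from
      the others, after scaling by the pivot entry so that no division occurs.\<close>
    define v' where "v' l k = ?d \<otimes> v l k \<ominus> v l k0 \<otimes> v p k" for l k
    have v'c: "v' l k \<in> carrier R" if "l \<in> S" "k \<in> insert k0 K" for l k
      using vc that p by (simp add: v'_def)
    have "card K < card ?S" using insert p by simp
    from insert.IH[of ?S v', OF _ this] insert.prems(1) v'c
    have "\<exists>c. (\<forall>l\<in>?S. c l \<in> carrier R) \<and> (\<exists>l\<in>?S. c l \<notin> M) \<and>
        (\<forall>k\<in>K. (\<Oplus>l\<in>?S. c l \<otimes> v' l k) \<in> M)" by simp
    then obtain c where "(\<forall>l\<in>?S. c l \<in> carrier R) \<and> (\<exists>l\<in>?S. c l \<notin> M) \<and>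
        (\<forall>k\<in>K. (\<Oplus>l\<in>?S. c l \<otimes> v' l k) \<in> M)" ..
    hence c: "\<forall>l\<in>?S. c l \<in> carrier R" "\<exists>l\<in>?S. c l \<notin> M"
        "\<forall>k\<in>K. (\<Oplus>l\<in>?S. c l \<otimes> v' l k) \<in> M" by auto
    \<comment> \<open>A relation of the \<open>v'\<close> is rewritten in terms of the
      \<open>v\<close>: the old coefficients are scaled by the pivot entry, and \<open>v p\<close>
      collects all subtracted multiples.\<close>
    define c' where "c' l = (if l = p then \<ominus> (\<Oplus>l\<in>?S. c l \<otimes> v l k0) else c l \<otimes> ?d)" for l
    have dc: "?d \<in> carrier R" using vc p by blast
    have sc: "(\<Oplus>l\<in>?S. c l \<otimes> v l k0) \<in> carrier R" using c vc by (intro finsum_closed) auto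
    have c'c: "\<forall>l\<in>S. c' l \<in> carrier R" using c dc sc by (auto simp: c'_def)
    have sum: "(\<Oplus>l\<in>S. c' l \<otimes> v l k) = (\<Oplus>l\<in>?S. c l \<otimes> v' l k)" if k: "k \<in> insert k0 K" for k
    proof -
      have f: "(\<lambda>l. c l \<otimes> v l k0) \<in> ?S \<rightarrow> carrier R" "(\<lambda>l. c l \<otimes> v l k) \<in> ?S \<rightarrow> carrier R"
        using c vc k by auto
      have vk: "v p k \<in> carrier R" using vc p k by blast
      have "(\<Oplus>l\<in>?S. c l \<otimes> v' l k)
          = (\<Oplus>l\<in>?S. c' l \<otimes> v l k \<oplus> (c l \<otimes> v l k0) \<otimes> (\<ominus> v p k))"
      proof (rule finsum_cong')
        fix l assume l: "l \<in> ?S"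
        hence "c l \<in> carrier R" "v l k \<in> carrier R" "v l k0 \<in> carrier R" using c vc k by auto
        thus "c l \<otimes> v' l k = c' l \<otimes> v l k \<oplus> (c l \<otimes> v l k0) \<otimes> (\<ominus> v p k)"
          using l dc vk unfolding c'_def v'_def by (simp, algebra)
      qed (use c'c c vc vk k in auto)
      also have "\<dots> = (\<Oplus>l\<in>?S. c' l \<otimes> v l k) \<oplus> (\<Oplus>l\<in>?S. c l \<otimes> v l k0) \<otimes> (\<ominus> v p k)"
        using c'c c vc vk k by (subst finsum_addf) (auto simp: finsum_ldistr insert.prems(1))
      also have "(\<Oplus>l\<in>?S. c l \<otimes> v l k0) \<otimes> (\<ominus> v p k) = c' p \<otimes> v p k"
        using sc vk by (simp add: c'_def l_minus r_minus)
      also have "(\<Oplus>l\<in>?S. c' l \<otimes> v l k) \<oplus> c' p \<otimes> v p k = (\<Oplus>l\<in>insert p ?S. c' l \<otimes> v l k)"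
        using c'c vc p k insert.prems(1) by (subst finsum_insert) (auto intro!: a_comm finsum_closed)
      also have "insert p ?S = S" using p by blast
      finally show ?thesis by simp
    qed
    have "(\<Oplus>l\<in>?S. c l \<otimes> v' l k0) = \<zero>"
    proof -
      have "(\<Oplus>l\<in>?S. c l \<otimes> v' l k0) = (\<Oplus>l\<in>?S. \<zero>)"
      proof (rule finsum_cong')
        fix l assume l: "l \<in> ?S"
        hence "c l \<in> carrier R" "v l k0 \<in> carrier R" using c vc by auto
        thus "c l \<otimes> v' l k0 = \<zero>" using dc unfolding v'_def by algebra
      qed auto
      thus ?thesis by simp
    qed
    hence "\<forall>k\<in>insert k0 K. (\<Oplus>l\<in>S. c' l \<otimes> v l k) \<in> M" using c(3) sum by auto
    moreover have "\<exists>l\<in>S. c' l \<notin> M"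
    proof -
      obtain l where l: "l \<in> ?S" "c l \<notin> M" using c by blast
      hence "c l \<otimes> ?d \<notin> M" using M.I_prime c(1) dc p(2) by blast
      thus ?thesis using l by (auto simp: c'_def)
    qed
    ultimately show ?thesis using c'c by blast
  qed
qed

text \<open>Nakayama's lemma for the module generated by \<open>H\<close> modulo \<open>F\<close>,
  localized at \<open>Q\<close>, with the denominators \<open>u\<close> written out. Instead of a
  determinant, one generator at a time is solved for and eliminated.\<close>

lemma Nakayama:
  assumes "primeideal Q R" "ideal F R" "finite H" "H \<subseteq> carrier R"
    and "\<And>h. h \<in> H \<Longrightarrow> \<exists>u\<in>carrier R - Q. u \<otimes> h \<in> Q \<cdot> (Idl H) <+> F"
  shows "\<exists>u\<in>carrier R - Q. \<forall>h\<in>H. u \<otimes> h \<in> F"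
  using assms(3-)
proof (induction H rule: finite_induct)
  case empty
  interpret Q: primeideal Q R by fact
  show ?case using Q.I_notcarr Q.one_imp_carrier by auto
next
  case (insert g H)
  interpret Q: primeideal Q R by fact
  interpret F: ideal F R by fact
  have g: "g \<in> carrier R" and H: "H \<subseteq> carrier R" using insert.prems by auto
  have idH: "ideal (Idl H) R" and idg: "ideal (PIdl g) R"
    using g H by (simp_all add: genideal_ideal cgenideal_ideal)
  have idE: "ideal (Q \<cdot> (Idl H) <+> F) R"
    by (intro add_ideals ideal_prod_is_ideal Q.is_ideal idH F.is_ideal)
  have "insert g H \<subseteq> (PIdl g) <+> (Idl H)"
    using ideal_sum_upper[OF idg idH] cgenideal_self[OF g] genideal_self[OF H] by blast
  hence "Idl (insert g H) \<subseteq> (PIdl g) <+> (Idl H)"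
    by (intro genideal_minimal add_ideals idg idH)
  hence sub: "Q \<cdot> (Idl (insert g H)) \<subseteq> Q \<cdot> (PIdl g) <+> Q \<cdot> (Idl H)"
    using ideal_prod_mono[of Q Q] ideal_prod_distr(1)[OF Q.is_ideal idg idH] by blast
  have Qg: "\<exists>q\<in>Q. x = q \<otimes> g" if "x \<in> Q \<cdot> (PIdl g)" for x
    using that
  proof induction
    case (prod i j)
    then obtain r where "j = r \<otimes> g" "r \<in> carrier R" by (auto simp: cgenideal_def)
    hence "i \<otimes> j = (i \<otimes> r) \<otimes> g" "i \<otimes> r \<in> Q"
      using prod g Q.Icarr by (simp_all add: m_assoc Q.I_r_closed)
    thus ?case by blast
  next
    case (sum s t)
    then obtain q r where "s = q \<otimes> g" "t = r \<otimes> g" "q \<in> Q" "r \<in> Q" by blast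
    thus ?case using g Q.Icarr by (intro bexI[of _ "q \<oplus> r"]) (auto simp: l_distr)
  qed
  \<comment> \<open>Up to a factor outside \<open>Q\<close>, every generator is a multiple of
    \<open>g\<close> by an element of \<open>Q\<close> plus a part that no longer involves
    \<open>g\<close>.\<close>
  have rep: "\<exists>u\<in>carrier R - Q. \<exists>q\<in>Q. \<exists>y\<in>Q \<cdot> (Idl H) <+> F. u \<otimes> h = q \<otimes> g \<oplus> y"
    if h: "h \<in> insert g H" for h
  proof -
    obtain u z y where u: "u \<in> carrier R - Q" "u \<otimes> h = z \<oplus> y" "z \<in> Q \<cdot> (Idl (insert g H))" "y \<in> F"
      using insert.prems(2)[OF h] unfolding ideal_sum_iff by blast
    obtain a b where ab: "z = a \<oplus> b" "a \<in> Q \<cdot> (PIdl g)" "b \<in> Q \<cdot> (Idl H)"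
      using subsetD[OF sub u(3)] unfolding ideal_sum_iff by blast
    obtain q where q: "q \<in> Q" "a = q \<otimes> g" using Qg ab by blast
    have bc: "b \<in> carrier R" using ab ideal_prod_in_carrier[OF Q.is_ideal idH] by blast
    have "u \<otimes> h = q \<otimes> g \<oplus> (b \<oplus> y)"
      using u ab q bc g Q.Icarr F.Icarr by (simp add: a_assoc)
    moreover have "b \<oplus> y \<in> Q \<cdot> (Idl H) <+> F" using ab u ideal_sum_iff by blast
    ultimately show ?thesis using u q by blast
  qed
  obtain u q y where u: "u \<in> carrier R - Q" "q \<in> Q" "y \<in> Q \<cdot> (Idl H) <+> F" "u \<otimes> g = q \<otimes> g \<oplus> y"
    using rep[of g] by blast
  \<comment> \<open>The equation \<open>u \<otimes> g = q \<otimes> g \<oplus> y\<close> is solved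
    for \<open>g\<close>: the factor \<open>u \<ominus> q\<close> is outside \<open>Q\<close>
    because \<open>q\<close> is inside.\<close>
  let ?v = "u \<ominus> q"
  have qc: "q \<in> carrier R" "y \<in> carrier R" using u Q.Icarr ideal.Icarr[OF idE] by auto
  have v: "?v \<in> carrier R - Q"
  proof
    show "?v \<in> carrier R" using u qc by simp
    have "u = ?v \<oplus> q" using u qc by (simp add: a_minus_def a_assoc l_neg)
    thus "?v \<notin> Q" using u Q.a_closed by (metis DiffD2)
  qed
  have uc: "u \<in> carrier R" using u by blast
  have "?v \<otimes> g = u \<otimes> g \<ominus> q \<otimes> g" using uc qc g by (simp add: a_minus_def l_distr l_minus)
  also have "\<dots> = y" unfolding u(4) using qc g by (simp add: a_minus_def a_ac r_neg1 r_neg)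
  finally have vg: "?v \<otimes> g \<in> Q \<cdot> (Idl H) <+> F" using u by simp
  have "\<exists>w\<in>carrier R - Q. w \<otimes> h \<in> Q \<cdot> (Idl H) <+> F" if h: "h \<in> H" for h
  proof -
    obtain u' q' y' where u': "u' \<in> carrier R - Q" "q' \<in> Q" "y' \<in> Q \<cdot> (Idl H) <+> F" "u' \<otimes> h = q' \<otimes> g \<oplus> y'"
      using rep[of h] h by blast
    have c: "h \<in> carrier R" "q' \<in> carrier R" "y' \<in> carrier R"
      using h H u' Q.Icarr ideal.Icarr[OF idE] by auto
    have "(?v \<otimes> u') \<otimes> h = ?v \<otimes> (u' \<otimes> h)" using c u' v by (simp add: m_assoc)
    also have "\<dots> = q' \<otimes> (?v \<otimes> g) \<oplus> ?v \<otimes> y'"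
      unfolding u'(4) using c v g by (simp add: r_distr m_ac)
    also have "\<dots> \<in> Q \<cdot> (Idl H) <+> F"
      using vg u' c v ideal_add_mem[OF idE] ideal.I_l_closed[OF idE] by auto
    finally show ?thesis using v u' Q.I_prime by (intro bexI[of _ "?v \<otimes> u'"]) auto
  qed
  then obtain w where w: "w \<in> carrier R - Q" "\<forall>h\<in>H. w \<otimes> h \<in> F" using insert.IH H by auto
  \<comment> \<open>\<open>w\<close> multiplies \<open>H\<close> into \<open>F\<close>, hence all of
    \<open>Q \<cdot> (Idl H) <+> F\<close>, and therefore also
    \<open>?v \<otimes> g\<close>.\<close>
  have colon: "ideal {x \<in> carrier R. w \<otimes> x \<in> F} R" using w by (intro colon_ideal F.is_ideal) auto
  have "Idl H \<subseteq> {x \<in> carrier R. w \<otimes> x \<in> F}" using w H by (intro genideal_minimal colon) auto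
  moreover have "Q \<cdot> (Idl H) \<subseteq> Idl H" using ideal_prod_inter[OF Q.is_ideal idH] by blast
  moreover have "F \<subseteq> {x \<in> carrier R. w \<otimes> x \<in> F}" using w by (auto simp: F.I_l_closed F.Icarr)
  ultimately have "Q \<cdot> (Idl H) <+> F \<subseteq> {x \<in> carrier R. w \<otimes> x \<in> F}"
    by (intro ideal_sum_least colon) auto
  hence "w \<otimes> (?v \<otimes> g) \<in> F" using vg by blast
  hence "(w \<otimes> ?v) \<otimes> g \<in> F" using w v g by (simp add: m_assoc)
  moreover have "(w \<otimes> ?v) \<otimes> h \<in> F" if "h \<in> H" for h
  proof -
    have "h \<in> carrier R" using that H by blast
    hence "(w \<otimes> ?v) \<otimes> h = ?v \<otimes> (w \<otimes> h)" using w v by (simp add: m_ac)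
    thus ?thesis using w v that F.I_l_closed by simp
  qed
  moreover have "w \<otimes> ?v \<in> carrier R - Q" using w v Q.I_prime by blast
  ultimately show ?case by blast
qed

end

section \<open>Nilpotent ideals in a fiber cone\<close>

text \<open>With \<open>R\<^sub>Q\<close> the localization at \<open>Q\<close> and \<open>D\<close> the quotient of \<open>R\<^sub>Q\<close> by \<open>F\<close>, the ideal
  \<open>fiber_kernel n\<close> consists of the elements that vanish in \<open>D / Q L\<^sup>n D\<close>. Thus
  \<open>ideal_power R C n \<subseteq> fiber_kernel n\<close> says that the degree one part \<open>C \<subseteq> L\<close> is nilpotent
  in the fiber cone of \<open>L D\<close>.\<close>

locale fiber_cone = cring R for R (structure) +
  fixes Q F L :: "'a set"
  assumes Q_prime: "primeideal Q R" and F_ideal: "ideal F R" and L_ideal: "ideal L R"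
begin

interpretation Q: primeideal Q R by (rule Q_prime)

text \<open>The part of \<open>fiber_kernel\<close> that is visible before the elements outside
  \<open>Q\<close> are inverted.\<close>

definition null_part :: "nat \<Rightarrow> 'a set"
  where "null_part n = Q \<cdot> ideal_power R L n <+> F"

definition fiber_kernel :: "nat \<Rightarrow> 'a set"
  where "fiber_kernel n = {x \<in> carrier R. \<exists>u\<in>carrier R - Q. u \<otimes> x \<in> null_part n}"

section \<open>Graded structure of the kernels\<close>

lemma L_power_ideal: "ideal (ideal_power R L n) R"
  by (rule ideal_power_ideal[OF L_ideal])

lemma null_part_ideal: "ideal (null_part n) R"
  unfolding null_part_def
  by (intro add_ideals ideal_prod_is_ideal Q.is_ideal L_power_ideal F_ideal)

lemma F_subset_null_part: "F \<subseteq> null_part n"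
  unfolding null_part_def
  by (intro ideal_sum_upper(2) ideal_prod_is_ideal Q.is_ideal L_power_ideal F_ideal)

lemma Q_power_subset_null_part: "Q \<cdot> ideal_power R L n \<subseteq> null_part n"
  unfolding null_part_def
  by (intro ideal_sum_upper(1) ideal_prod_is_ideal Q.is_ideal L_power_ideal F_ideal)

lemma null_part_mult:
  assumes "x \<in> null_part m" "y \<in> ideal_power R L n"
  shows "x \<otimes> y \<in> null_part (m + n)"
  using assms unfolding null_part_def by (intro ideal_prod_power_sum_mult Q.is_ideal L_ideal F_ideal)

lemma null_part_subset_fiber_kernel: "null_part n \<subseteq> fiber_kernel n"
proof
  fix x assume x: "x \<in> null_part n"
  hence "x \<in> carrier R" using ideal.Icarr[OF null_part_ideal] by blast
  moreover have "\<one> \<notin> Q" using Q.I_notcarr Q.one_imp_carrier by blast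
  ultimately show "x \<in> fiber_kernel n"
    unfolding fiber_kernel_def using x by (auto intro!: bexI[of _ \<one>])
qed

lemma fiber_kernel_ideal: "ideal (fiber_kernel n) R"
proof (rule ideal_if_closed)
  interpret Y: ideal "null_part n" R by (rule null_part_ideal)
  show "fiber_kernel n \<subseteq> carrier R" unfolding fiber_kernel_def by blast
  show "\<zero> \<in> fiber_kernel n" using null_part_subset_fiber_kernel Y.zero_closed by blast
  fix x y assume x: "x \<in> fiber_kernel n" and y: "y \<in> fiber_kernel n"
  obtain u v where u: "u \<in> carrier R - Q" "u \<otimes> x \<in> null_part n" "x \<in> carrier R"
    and v: "v \<in> carrier R - Q" "v \<otimes> y \<in> null_part n" "y \<in> carrier R"
    using x y unfolding fiber_kernel_def by blast
  have "(u \<otimes> v) \<otimes> (x \<oplus> y) = v \<otimes> (u \<otimes> x) \<oplus> u \<otimes> (v \<otimes> y)"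
    using u v by (simp add: r_distr m_ac)
  also have "\<dots> \<in> null_part n" using u v by (simp add: Y.I_l_closed)
  finally show "x \<oplus> y \<in> fiber_kernel n"
    unfolding fiber_kernel_def using u v Q.I_prime by (auto intro!: bexI[of _ "u \<otimes> v"])
next
  interpret Y: ideal "null_part n" R by (rule null_part_ideal)
  fix r x assume r: "r \<in> carrier R" and x: "x \<in> fiber_kernel n"
  obtain u where u: "u \<in> carrier R - Q" "u \<otimes> x \<in> null_part n" "x \<in> carrier R"
    using x unfolding fiber_kernel_def by blast
  have "u \<otimes> (r \<otimes> x) = r \<otimes> (u \<otimes> x)" using u r by (simp add: m_lcomm)
  hence "u \<otimes> (r \<otimes> x) \<in> null_part n" using u r Y.I_l_closed by simp
  thus "r \<otimes> x \<in> fiber_kernel n" unfolding fiber_kernel_def using u r by blast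
qed

lemma fiber_kernel_mult:
  assumes "x \<in> fiber_kernel m" "y \<in> ideal_power R L n"
  shows "x \<otimes> y \<in> fiber_kernel (m + n)"
proof -
  obtain u where u: "u \<in> carrier R - Q" "u \<otimes> x \<in> null_part m" "x \<in> carrier R"
    using assms(1) unfolding fiber_kernel_def by blast
  have y: "y \<in> carrier R" using assms(2) ideal.Icarr[OF L_power_ideal] by blast
  have "u \<otimes> (x \<otimes> y) = (u \<otimes> x) \<otimes> y" using u y by (simp add: m_assoc)
  also have "\<dots> \<in> null_part (m + n)" using null_part_mult u assms(2) by blast
  finally show ?thesis unfolding fiber_kernel_def using u y by auto
qed

lemma fiber_kernel_prod_subset:
  assumes "I \<subseteq> fiber_kernel m" "J \<subseteq> ideal_power R L n"
  shows "I \<cdot> J \<subseteq> fiber_kernel (m + n)"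
  using assms by (intro ideal_prod_least[OF fiber_kernel_ideal] fiber_kernel_mult) auto

text \<open>Elements outside \<open>Q\<close> are units after localization; the two denominators
  multiply to one outside \<open>Q\<close> because \<open>Q\<close> is prime.\<close>

lemma fiber_kernel_cancel:
  assumes "u \<in> carrier R - Q" "x \<in> carrier R" "u \<otimes> x \<in> fiber_kernel n"
  shows "x \<in> fiber_kernel n"
proof -
  obtain v where v: "v \<in> carrier R - Q" "v \<otimes> (u \<otimes> x) \<in> null_part n"
    using assms unfolding fiber_kernel_def by blast
  have "v \<otimes> (u \<otimes> x) = (v \<otimes> u) \<otimes> x" using v assms by (simp add: m_assoc)
  thus ?thesis unfolding fiber_kernel_def
    using v assms Q.I_prime by (auto intro!: bexI[of _ "v \<otimes> u"])
qed

text \<open>Once the \<open>n\<close>-th power vanishes in degree \<open>n\<close>, the remaining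
  \<open>m - n\<close> factors lie in \<open>L\<close> and only shift the degree.\<close>

lemma nilpotent_mono:
  assumes "C \<subseteq> L" "ideal C R" "ideal_power R C n \<subseteq> fiber_kernel n" "n \<le> m"
  shows "ideal_power R C m \<subseteq> fiber_kernel m"
proof -
  have "ideal_power R C m = ideal_power R C n \<cdot> ideal_power R C (m - n)"
    using ideal_power_add[OF assms(2), of n "m - n"] assms(4) by simp
  also have "\<dots> \<subseteq> fiber_kernel (n + (m - n))"
    by (intro fiber_kernel_prod_subset assms ideal_power_mono)
  finally show ?thesis using assms(4) by simp
qed

text \<open>Modulo \<open>null_part (Suc t)\<close>, the power \<open>a [^] Suc t\<close> times the
  local unit \<open>u\<close> lies in an ideal made nilpotent by \<open>C\<close>, so
  \<open>a\<close> is nilpotent as well; and a sum of two nilpotent ideals is nilpotent. The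
  exponents are kept explicit because membership in \<open>fiber_kernel\<close> depends on the
  degree.\<close>

lemma nilpotent_extend:
  assumes C: "ideal C R" "C \<subseteq> L" and nil: "ideal_power R C N \<subseteq> fiber_kernel N"
    and a: "a \<in> L" and u: "u \<in> carrier R - Q"
    and x: "x \<in> C \<cdot> ideal_power R L t" and y: "y \<in> null_part (Suc t)"
    and eq: "a [^] Suc t \<otimes> u = x \<oplus> y"
  shows "\<exists>n. ideal_power R (C <+> (PIdl a)) n \<subseteq> fiber_kernel n"
proof -
  let ?p = "ideal_power R"
  \<comment> \<open>\<open>T\<close> is the degree of the relation for \<open>a\<close>, and
    \<open>S\<close> is the degree in which \<open>a [^] S\<close> will vanish. Taking
    \<open>n\<close> one above \<open>N\<close> makes it positive, as the expansion of a power of a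
    sum requires.\<close>
  define n T S where "n = Suc N" and "T = Suc t" and "S = T * n"
  have ac: "a \<in> carrier R" using a ideal.Icarr[OF L_ideal] by blast
  have uc: "u \<in> carrier R" using u by blast
  have Ca: "ideal (PIdl a) R" "PIdl a \<subseteq> L"
    using ac a by (simp_all add: cgenideal_ideal cgenideal_minimal L_ideal)
  have Cn: "?p C n \<subseteq> fiber_kernel n" using nilpotent_mono[OF C(2,1) nil] by (simp add: n_def)
  have CL: "C \<cdot> ?p L m \<subseteq> ?p L (Suc m)" for m
    using ideal_prod_mono[OF C(2) subset_refl] ideal_prod_commute[OF L_ideal L_power_ideal, of m]
    unfolding ideal_power_Suc by metis
  have CLn: "?p (C \<cdot> ?p L m) n \<subseteq> fiber_kernel (Suc m * n)" for m
  proof -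
    have "?p (C \<cdot> ?p L m) n = ?p C n \<cdot> ?p L (m * n)"
      by (simp add: ideal_power_prod C L_power_ideal ideal_power_mult L_ideal)
    also have "\<dots> \<subseteq> fiber_kernel (n + m * n)" by (rule fiber_kernel_prod_subset[OF Cn subset_refl])
    finally show ?thesis by simp
  qed
  have xL: "x \<in> ?p L T" using x CL unfolding T_def by blast
  have xc: "x \<in> carrier R" using xL ideal.Icarr[OF L_power_ideal] by blast
  have yc: "y \<in> carrier R" using y ideal.Icarr[OF null_part_ideal] by blast
  let ?b = "a [^] T \<otimes> u"
  have bL: "?b \<in> ?p L T"
    using power_mem_ideal_power[OF a ac] ideal.I_r_closed[OF L_power_ideal] uc by blast
  have bc: "?b \<in> carrier R" using ac uc by simp
  \<comment> \<open>\<open>?b\<close> and \<open>x\<close> differ by \<open>y\<close>, and the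
    difference of their powers is controlled by
    \<open>b^(j+1) - x^(j+1) = (b^j - x^j) b + y x^j\<close>, where both summands have the right
    degree.\<close>
  have "?b [^] j \<ominus> x [^] j \<in> null_part (T * j)" for j :: nat
  proof (induction j)
    case 0
    show ?case using null_part_ideal[of 0] by (simp add: a_minus_def r_neg ideal_def additive_subgroup.zero_closed)
  next
    case (Suc j)
    have "(?b [^] j \<ominus> x [^] j) \<otimes> ?b \<in> null_part (T * j + T)" by (rule null_part_mult[OF Suc bL])
    moreover have "x [^] j \<in> ?p L (T * j)"
      using power_mem_ideal_power[OF xL xc] by (simp add: ideal_power_mult L_ideal)
    hence "y \<otimes> x [^] j \<in> null_part (T + T * j)"
      using y null_part_mult unfolding T_def by blast
    ultimately have "(?b [^] j \<ominus> x [^] j) \<otimes> ?b \<oplus> y \<otimes> x [^] j \<in> null_part (T * Suc j)"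
      using ideal_add_mem[OF null_part_ideal] by (simp add: add.commute)
    moreover have "y = (x \<oplus> y) \<ominus> x" using xc yc by algebra
    hence "y = ?b \<ominus> x" using eq unfolding T_def by metis
    hence "(?b [^] j \<ominus> x [^] j) \<otimes> ?b \<oplus> y \<otimes> x [^] j = ?b [^] j \<otimes> ?b \<ominus> x [^] j \<otimes> x"
    proof -
      have "(p \<ominus> q) \<otimes> r \<oplus> (r \<ominus> s) \<otimes> q = p \<otimes> r \<ominus> q \<otimes> s"
        if "p \<in> carrier R" "q \<in> carrier R" "r \<in> carrier R" "s \<in> carrier R" for p q r s
        using that by algebra
      thus ?thesis using \<open>y = ?b \<ominus> x\<close> bc xc by simp
    qed
    ultimately show ?case by simp
  qed
  hence diff: "?b [^] n \<ominus> x [^] n \<in> fiber_kernel S"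
    using null_part_subset_fiber_kernel unfolding S_def by blast
  have "x [^] n \<in> fiber_kernel S"
    using power_mem_ideal_power[OF x xc, of n] CLn[of t] unfolding S_def T_def by blast
  with diff have "(?b [^] n \<ominus> x [^] n) \<oplus> x [^] n \<in> fiber_kernel S"
    by (rule ideal_add_mem[OF fiber_kernel_ideal])
  hence "?b [^] n \<in> fiber_kernel S" using bc xc by (simp add: a_minus_def a_assoc l_neg)
  moreover have "?b [^] n = u [^] n \<otimes> a [^] S"
    using ac uc by (simp add: nat_pow_distrib nat_pow_pow S_def m_comm)
  \<comment> \<open>Being outside \<open>Q\<close>, the factor \<open>u [^] n\<close> can be
    cancelled, which leaves the power of \<open>a\<close>.\<close>
  moreover have "u [^] n \<in> carrier R - Q"
  proof (induction n)
    case 0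
    show ?case using Q.I_notcarr Q.one_imp_carrier by auto
  next
    case (Suc k)
    thus ?case using u Q.I_prime[of "u [^] k" u] by auto
  qed
  ultimately have aS: "a [^] S \<in> fiber_kernel S"
    using fiber_kernel_cancel ac by simp
  obtain s where s: "S = Suc s" unfolding S_def T_def n_def by simp
  have PS: "ideal (PIdl (a [^] S)) R" using ac by (simp add: cgenideal_ideal)
  have CLs: "ideal (C \<cdot> ?p L s) R" by (intro ideal_prod_is_ideal C L_power_ideal)
  have comm: "C <+> (PIdl a) = (PIdl a) <+> C"
    using ideal.Icarr[OF C(1)] ideal.Icarr[OF Ca(1)] by (intro set_add_comm) auto
  \<comment> \<open>First expansion: a product of \<open>S\<close> factors either has a factor from
    \<open>C\<close> or is a multiple of \<open>a [^] S\<close>.\<close>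
  have "?p (C <+> (PIdl a)) S \<subseteq> ?p (PIdl a) S <+> C \<cdot> ?p L s"
    using ideal_power_sum_subset[OF Ca(1) C(1) L_ideal Ca(2) C(2), of s] comm unfolding s by simp
  also have "\<dots> \<subseteq> C \<cdot> ?p L s <+> (PIdl (a [^] S))"
    using ideal_power_principal_subset[OF ac, of S] ideal_sum_upper[OF CLs PS]
    by (intro ideal_sum_least add_ideals CLs PS) auto
  finally have 1: "?p (C <+> (PIdl a)) S \<subseteq> C \<cdot> ?p L s <+> (PIdl (a [^] S))" .
  have aSL: "PIdl (a [^] S) \<subseteq> ?p L S"
    using power_mem_ideal_power[OF a ac] by (intro cgenideal_minimal L_power_ideal)
  \<comment> \<open>Second expansion, in steps of degree \<open>S\<close>: the power of the part
    with factors from \<open>C\<close> vanishes by \<open>CLn\<close>, and a single factor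
    \<open>a [^] S\<close> vanishes by \<open>aS\<close>.\<close>
  have "?p (C <+> (PIdl a)) (S * n) = ?p (?p (C <+> (PIdl a)) S) n"
    by (intro ideal_power_mult add_ideals C Ca)
  also have "\<dots> \<subseteq> ?p (C \<cdot> ?p L s <+> (PIdl (a [^] S))) n" by (rule ideal_power_mono[OF 1])
  also have "\<dots> \<subseteq> ?p (C \<cdot> ?p L s) n <+> (PIdl (a [^] S)) \<cdot> ?p (?p L S) N"
    unfolding n_def using CL[of s]
    by (intro ideal_power_sum_subset CLs PS L_power_ideal aSL) (simp add: s)
  also have "\<dots> \<subseteq> fiber_kernel (S * n)"
  proof (rule ideal_sum_least[OF fiber_kernel_ideal])
    show "?p (C \<cdot> ?p L s) n \<subseteq> fiber_kernel (S * n)" using CLn[of s] by (simp add: s)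
    have "PIdl (a [^] S) \<subseteq> fiber_kernel S" using aS by (intro cgenideal_minimal fiber_kernel_ideal)
    hence "(PIdl (a [^] S)) \<cdot> ?p (?p L S) N \<subseteq> fiber_kernel (S + S * N)"
      by (rule fiber_kernel_prod_subset) (simp add: ideal_power_mult L_ideal)
    thus "(PIdl (a [^] S)) \<cdot> ?p (?p L S) N \<subseteq> fiber_kernel (S * n)" by (simp add: n_def)
  qed
  finally show ?thesis by blast
qed

end

section \<open>Content ideals\<close>

definition coeff_ideal :: "('a, 'm) ring_scheme \<Rightarrow> 'a set \<Rightarrow> (nat \<Rightarrow> 'a) set"
  where "coeff_ideal R I = {g \<in> carrier (UP R). \<forall>n. coeff (UP R) g n \<in> I}"

context UP_cring
begin

lemma mem_coeff_ideal_iff: "g \<in> coeff_ideal R I \<longleftrightarrow> g \<in> carrier P \<and> (\<forall>n. coeff P g n \<in> I)"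
  by (simp add: coeff_ideal_def P_def)

text \<open>In \<open>UP R\<close> a polynomial is its coefficient function, so a function that
  vanishes above some bound is a polynomial. All polynomials given by explicit coefficients are
  built this way.\<close>

lemma polynomial_from_coeffs:
  assumes "\<And>n. h n \<in> carrier R" "\<And>n. N < n \<Longrightarrow> h n = \<zero>"
  shows "h \<in> carrier P" "coeff P h n = h n"
proof -
  have "h \<in> up R" using assms by (intro mem_upI exI[of _ N]) auto
  thus "h \<in> carrier P" "coeff P h n = h n" by (simp_all add: P_def UP_def)
qed

lemma content_eq: "content R f = Idl (range (coeff P f))"
  by (simp add: content_def P_def)

lemma content_ideal: "f \<in> carrier P \<Longrightarrow> ideal (content R f) R"
  unfolding content_eq by (rule R.genideal_ideal) auto

lemma coeff_mem_content: "f \<in> carrier P \<Longrightarrow> coeff P f n \<in> content R f"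
  unfolding content_eq by (rule subsetD[OF R.genideal_self]) auto

lemma content_least: "ideal J R \<Longrightarrow> (\<And>n. coeff P f n \<in> J) \<Longrightarrow> content R f \<subseteq> J"
  unfolding content_eq by (rule R.genideal_minimal) auto

lemma gaussian_iff:
  "gaussian R f \<longleftrightarrow> f \<in> carrier P \<and>
    (\<forall>g \<in> carrier P. content R (f \<otimes>\<^bsub>P\<^esub> g) = content R f \<cdot> content R g)"
  by (simp add: gaussian_def P_def)

text \<open>Made for the passage from \<open>f(X)\<close> to \<open>f(-X)\<close>, where the
  coefficients change only by signs.\<close>

lemma content_eq_up_to_sign:
  assumes "f \<in> carrier P" "g \<in> carrier P"
    and "\<And>n. coeff P f n = coeff P g n \<or> coeff P f n = \<ominus> coeff P g n"
  shows "content R f = content R g"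
proof -
  have sub: "content R f \<subseteq> content R g"
    if "f \<in> carrier P" "g \<in> carrier P"
      "\<And>n. coeff P f n = coeff P g n \<or> coeff P f n = \<ominus> coeff P g n" for f g
  proof (rule content_least[OF content_ideal[OF that(2)]])
    interpret c: ideal "content R g" R using that(2) by (rule content_ideal)
    fix n
    show "coeff P f n \<in> content R g"
      using that(3)[of n] coeff_mem_content[OF that(2), of n] by auto
  qed
  have "coeff P g n = coeff P f n \<or> coeff P g n = \<ominus> coeff P f n" for n
    using assms(3)[of n] assms(1,2) by auto
  thus ?thesis using sub[of f g] sub[of g f] assms by blast
qed

lemma coeff_monom_mult:
  assumes "a \<in> carrier R" "g \<in> carrier P"
  shows "coeff P (monom P a k \<otimes>\<^bsub>P\<^esub> g) n = (if k \<le> n then a \<otimes> coeff P g (n - k) else \<zero>)"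
proof -
  have "coeff P (monom P a k \<otimes>\<^bsub>P\<^esub> g) n = (\<Oplus>i\<in>{..n}. (if k = i then a else \<zero>) \<otimes> coeff P g (n - i))"
    using assms by simp
  also have "\<dots> = (\<Oplus>i\<in>{..n}. if k = i then a \<otimes> coeff P g (n - i) else \<zero>)"
    using assms by (intro R.finsum_cong') auto
  also have "\<dots> = (if k \<le> n then a \<otimes> coeff P g (n - k) else \<zero>)"
  proof (cases "k \<le> n")
    case True
    thus ?thesis using assms R.finsum_singleton[of k "{..n}" "\<lambda>i. a \<otimes> coeff P g (n - i)"] by auto
  next
    case False
    hence "(\<Oplus>i\<in>{..n}. if k = i then a \<otimes> coeff P g (n - i) else \<zero>) = (\<Oplus>i\<in>{..n}. \<zero>)"
      by (intro R.finsum_cong') auto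
    thus ?thesis using False by simp
  qed
  finally show ?thesis .
qed

lemma coeff_minus: "p \<in> carrier P \<Longrightarrow> q \<in> carrier P \<Longrightarrow>
    coeff P (p \<ominus>\<^bsub>P\<^esub> q) n = coeff P p n \<ominus> coeff P q n"
  by (simp add: a_minus_def)

section \<open>Extended ideals \<open>I[X]\<close> in the polynomial ring\<close>

lemma coeff_ideal_ideal:
  assumes "ideal I R"
  shows "ideal (coeff_ideal R I) P"
proof (rule P.ideal_if_closed)
  interpret I: ideal I R by fact
  show "coeff_ideal R I \<subseteq> carrier P" "\<zero>\<^bsub>P\<^esub> \<in> coeff_ideal R I"
    by (auto simp: mem_coeff_ideal_iff)
  fix g h assume "g \<in> coeff_ideal R I" "h \<in> coeff_ideal R I"
  thus "g \<oplus>\<^bsub>P\<^esub> h \<in> coeff_ideal R I" by (simp add: mem_coeff_ideal_iff)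
next
  interpret I: ideal I R by fact
  fix r g assume "r \<in> carrier P" "g \<in> coeff_ideal R I"
  hence g: "g \<in> carrier P" "r \<in> carrier P" "\<And>n. coeff P g n \<in> I" by (auto simp: mem_coeff_ideal_iff)
  have "coeff P (r \<otimes>\<^bsub>P\<^esub> g) n \<in> I" for n
    using g by (auto intro!: R.ideal_finsum_mem[OF assms] I.I_l_closed)
  thus "r \<otimes>\<^bsub>P\<^esub> g \<in> coeff_ideal R I" using g by (simp add: mem_coeff_ideal_iff)
qed

lemma monom_mem_coeff_ideal:
  assumes "ideal I R" "a \<in> I"
  shows "monom P a n \<in> coeff_ideal R I"
  using assms ideal.Icarr[OF assms] additive_subgroup.zero_closed[OF ideal.axioms(1)[OF assms(1)]]
  by (simp add: mem_coeff_ideal_iff)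

text \<open>Gauss' lemma: compare the lowest coefficients outside \<open>M\<close>.\<close>

lemma coeff_ideal_prime:
  assumes "primeideal M R"
  shows "primeideal (coeff_ideal R M) P"
proof (rule primeidealI[OF coeff_ideal_ideal P.cring_axioms])
  interpret M: primeideal M R by fact
  show "ideal M R" by (rule M.is_ideal)
  have "\<one> \<notin> M" using M.I_notcarr M.one_imp_carrier by blast
  hence "\<one>\<^bsub>P\<^esub> \<notin> coeff_ideal R M" by (auto simp: mem_coeff_ideal_iff)
  thus "carrier P \<noteq> coeff_ideal R M" by auto
  fix g h assume g: "g \<in> carrier P" and h: "h \<in> carrier P" and gh: "g \<otimes>\<^bsub>P\<^esub> h \<in> coeff_ideal R M"
  show "g \<in> coeff_ideal R M \<or> h \<in> coeff_ideal R M"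
  proof (rule ccontr)
    assume "\<not> ?thesis"
    hence ex: "\<exists>n. coeff P g n \<notin> M" "\<exists>n. coeff P h n \<notin> M" using g h by (auto simp: mem_coeff_ideal_iff)
    define i where "i = (LEAST n. coeff P g n \<notin> M)"
    define j where "j = (LEAST n. coeff P h n \<notin> M)"
    have i: "coeff P g i \<notin> M" "\<And>n. n < i \<Longrightarrow> coeff P g n \<in> M"
      unfolding i_def using LeastI_ex[OF ex(1)] not_less_Least by blast+
    have j: "coeff P h j \<notin> M" "\<And>n. n < j \<Longrightarrow> coeff P h n \<in> M"
      unfolding j_def using LeastI_ex[OF ex(2)] not_less_Least by blast+
    let ?t = "\<lambda>k. coeff P g k \<otimes> coeff P h (i + j - k)"
    have "(\<Oplus>k\<in>{..i+j}. ?t k) \<in> M" using gh g h by (auto simp: mem_coeff_ideal_iff)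
    also have "{..i+j} = insert i ({..i+j} - {i})" by auto
    also have "(\<Oplus>k\<in>insert i ({..i+j} - {i}). ?t k) = ?t i \<oplus> (\<Oplus>k\<in>{..i+j} - {i}. ?t k)"
      using g h by (intro R.finsum_insert) auto
    finally have sum: "?t i \<oplus> (\<Oplus>k\<in>{..i+j} - {i}. ?t k) \<in> M" .
    have rest: "(\<Oplus>k\<in>{..i+j} - {i}. ?t k) \<in> M"
    proof (rule R.ideal_finsum_mem[OF M.is_ideal])
      fix k assume k: "k \<in> {..i+j} - {i}"
      show "?t k \<in> M"
      proof (cases "k < i")
        case True
        thus ?thesis using i(2) h by (auto intro: M.I_r_closed)
      next
        case False
        hence "i + j - k < j" using k by auto
        thus ?thesis using j(2) g by (auto intro: M.I_l_closed)
      qed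
    qed
    have tc: "?t i \<in> carrier R" "(\<Oplus>k\<in>{..i+j} - {i}. ?t k) \<in> carrier R"
      using g h rest M.Icarr by auto
    have "?t i \<oplus> (\<Oplus>k\<in>{..i+j} - {i}. ?t k) \<ominus> (\<Oplus>k\<in>{..i+j} - {i}. ?t k) \<in> M"
      using R.ideal_minus_mem[OF M.is_ideal sum rest] .
    hence "?t i \<in> M" using tc by (simp add: R.minus_eq R.a_assoc R.r_neg)
    thus False using M.I_prime[of "coeff P g i" "coeff P h j"] i j g h by auto
  qed
qed

text \<open>Products of polynomials over \<open>I\<close> and over \<open>J\<close> have
  coefficients in \<open>I \<cdot> J\<close>. Conversely, a monomial with coefficient
  \<open>i \<otimes> j\<close> is the constant \<open>i\<close> times a monomial over
  \<open>J\<close>, and every polynomial is a sum of monomials.\<close>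

lemma coeff_ideal_prod:
  assumes "ideal I R" "ideal J R"
  shows "coeff_ideal R (I \<cdot> J) = coeff_ideal R I \<cdot>\<^bsub>P\<^esub> coeff_ideal R J"
proof
  have idIJ: "ideal (I \<cdot> J) R" using assms by (rule R.ideal_prod_is_ideal)
  show "coeff_ideal R I \<cdot>\<^bsub>P\<^esub> coeff_ideal R J \<subseteq> coeff_ideal R (I \<cdot> J)"
  proof (rule P.ideal_prod_least[OF coeff_ideal_ideal[OF idIJ]])
    fix g h assume "g \<in> coeff_ideal R I" "h \<in> coeff_ideal R J"
    thus "g \<otimes>\<^bsub>P\<^esub> h \<in> coeff_ideal R (I \<cdot> J)"
      by (auto simp: mem_coeff_ideal_iff intro!: R.ideal_finsum_mem[OF idIJ] ideal_prod.prod)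
  qed
  have idP: "ideal (coeff_ideal R I \<cdot>\<^bsub>P\<^esub> coeff_ideal R J) P"
    by (intro P.ideal_prod_is_ideal coeff_ideal_ideal assms)
  have mon: "monom P c n \<in> coeff_ideal R I \<cdot>\<^bsub>P\<^esub> coeff_ideal R J" if "c \<in> I \<cdot> J" for c n
    using that
  proof induction
    case (prod i j)
    have "monom P (i \<otimes> j) n = monom P i 0 \<otimes>\<^bsub>P\<^esub> monom P j n"
      using monom_mult[of i j 0 n] prod assms ideal.Icarr by (metis add_0)
    thus ?case using prod assms monom_mem_coeff_ideal ideal_prod.prod by metis
  next
    case (sum s t)
    have "s \<in> carrier R" "t \<in> carrier R" using sum ideal.Icarr[OF idIJ] by auto
    thus ?case using sum by (simp add: ideal_prod.sum)
  qed
  show "coeff_ideal R (I \<cdot> J) \<subseteq> coeff_ideal R I \<cdot>\<^bsub>P\<^esub> coeff_ideal R J"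
  proof
    fix g assume g: "g \<in> coeff_ideal R (I \<cdot> J)"
    hence "(\<Oplus>\<^bsub>P\<^esub> i \<in> {..deg R g}. monom P (coeff P g i) i) \<in> coeff_ideal R I \<cdot>\<^bsub>P\<^esub> coeff_ideal R J"
      by (intro P.ideal_finsum_mem[OF idP] mon) (simp add: mem_coeff_ideal_iff)
    thus "g \<in> coeff_ideal R I \<cdot>\<^bsub>P\<^esub> coeff_ideal R J" using g up_repr by (simp add: mem_coeff_ideal_iff)
  qed
qed

lemma coeff_ideal_power:
  assumes "ideal I R"
  shows "coeff_ideal R (ideal_power R I n) = ideal_power P (coeff_ideal R I) n"
proof (induction n)
  case 0
  show ?case by (auto simp: R.ideal_power_0 P.ideal_power_0 mem_coeff_ideal_iff)
next
  case (Suc n)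
  thus ?case using assms by (simp add: R.ideal_power_Suc P.ideal_power_Suc coeff_ideal_prod R.ideal_power_ideal)
qed

lemma polynomial_mem_ideal:
  assumes "ideal J P" "g \<in> carrier P" "\<And>i. monom P (coeff P g i) 0 \<in> J"
  shows "g \<in> J"
proof -
  have "monom P (coeff P g i) i \<in> J" for i
  proof -
    have "monom P (coeff P g i) i = monom P (coeff P g i) 0 \<otimes>\<^bsub>P\<^esub> monom P \<one> i"
      using monom_mult[of "coeff P g i" \<one> 0 i] assms(2) by simp
    thus ?thesis using assms(3) ideal.I_r_closed[OF assms(1)] by simp
  qed
  hence "(\<Oplus>\<^bsub>P\<^esub> i \<in> {..deg R g}. monom P (coeff P g i) i) \<in> J"
    by (intro P.ideal_finsum_mem[OF assms(1)])
  thus "g \<in> J" using assms(2) up_repr by simp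
qed

lemma monom_0_vimage_ideal:
  assumes "ideal J P"
  shows "ideal {a \<in> carrier R. monom P a 0 \<in> J} R"
proof (rule R.ideal_if_closed)
  interpret J: ideal J P by fact
  show "\<zero> \<in> {a \<in> carrier R. monom P a 0 \<in> J}" by simp
  fix x y assume "x \<in> {a \<in> carrier R. monom P a 0 \<in> J}" "y \<in> {a \<in> carrier R. monom P a 0 \<in> J}"
  thus "x \<oplus> y \<in> {a \<in> carrier R. monom P a 0 \<in> J}" by simp
next
  interpret J: ideal J P by fact
  fix r x assume "r \<in> carrier R" "x \<in> {a \<in> carrier R. monom P a 0 \<in> J}"
  thus "r \<otimes> x \<in> {a \<in> carrier R. monom P a 0 \<in> J}"
    using monom_mult[of r x 0 0] by (simp add: J.I_l_closed)
qed auto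

text \<open>The constants in \<open>J\<close> form an ideal of \<open>R\<close>, which contains the
  content of \<open>f\<close> as soon as it contains the coefficients; and the constants of
  \<open>I[X]\<close> generate it.\<close>

lemma coeff_ideal_content_subset:
  assumes "f \<in> carrier P" "ideal J P" "\<And>n. monom P (coeff P f n) 0 \<in> J"
  shows "coeff_ideal R (content R f) \<subseteq> J"
proof -
  have "content R f \<subseteq> {a \<in> carrier R. monom P a 0 \<in> J}"
    using assms by (intro content_least monom_0_vimage_ideal) auto
  hence "monom P (coeff P g i) 0 \<in> J" if "g \<in> coeff_ideal R (content R f)" for g i
    using that unfolding mem_coeff_ideal_iff by blast
  thus ?thesis using polynomial_mem_ideal[OF assms(2)] unfolding mem_coeff_ideal_iff subset_iff by blast
qed

text \<open>The content has \<open>d + 1\<close> generators; this bound is what the dimension count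
  in \<open>leading_coeff_nilpotent\<close> rests on.\<close>

lemma content_combination:
  assumes f: "f \<in> carrier P" "deg R f \<le> d" and x: "x \<in> content R f"
  shows "\<exists>v. (\<forall>j. v j \<in> carrier R) \<and> x = (\<Oplus>j\<in>{..d}. v j \<otimes> coeff P f j)"
proof -
  let ?C = "{x. \<exists>v. (\<forall>j. v j \<in> carrier R) \<and> x = (\<Oplus>j\<in>{..d}. v j \<otimes> coeff P f j)}"
  have zero: "\<zero> \<in> ?C"
  proof -
    have "\<zero> = (\<Oplus>j\<in>{..d}. \<zero> \<otimes> coeff P f j)" using f by simp
    thus ?thesis by (intro CollectI exI[of _ "\<lambda>_. \<zero>"]) simp
  qed
  have add: "x \<oplus> y \<in> ?C" if xy: "x \<in> ?C" "y \<in> ?C" for x y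
  proof -
    obtain v w where v: "\<forall>j. v j \<in> carrier R" "x = (\<Oplus>j\<in>{..d}. v j \<otimes> coeff P f j)"
      and w: "\<forall>j. w j \<in> carrier R" "y = (\<Oplus>j\<in>{..d}. w j \<otimes> coeff P f j)" using xy by blast
    have "(\<Oplus>j\<in>{..d}. (v j \<oplus> w j) \<otimes> coeff P f j) = (\<Oplus>j\<in>{..d}. v j \<otimes> coeff P f j \<oplus> w j \<otimes> coeff P f j)"
      using f v w by (intro R.finsum_cong') (auto simp: R.l_distr)
    also have "\<dots> = x \<oplus> y" unfolding v(2) w(2) using f v w by (intro R.finsum_addf) auto
    finally show ?thesis using v w by (intro CollectI exI[of _ "\<lambda>j. v j \<oplus> w j"]) auto
  qed
  have mult: "a \<otimes> x \<in> ?C" if xy: "a \<in> carrier R" "x \<in> ?C" for a x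
  proof -
    obtain v where v: "\<forall>j. v j \<in> carrier R" "x = (\<Oplus>j\<in>{..d}. v j \<otimes> coeff P f j)" using xy by blast
    have "a \<otimes> x = (\<Oplus>j\<in>{..d}. a \<otimes> (v j \<otimes> coeff P f j))"
      unfolding v(2) using f v xy by (intro R.finsum_rdistr) auto
    also have "\<dots> = (\<Oplus>j\<in>{..d}. (a \<otimes> v j) \<otimes> coeff P f j)"
      using f v xy by (intro R.finsum_cong') (auto simp: R.m_assoc)
    finally show ?thesis using v xy by (intro CollectI exI[of _ "\<lambda>j. a \<otimes> v j"]) auto
  qed
  have sub: "?C \<subseteq> carrier R" using f by (auto intro!: R.finsum_closed)
  have id: "ideal ?C R" by (rule R.ideal_if_closed[OF sub zero add mult])
  have "coeff P f n \<in> ?C" for n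
  proof (cases "n \<le> d")
    case True
    have "coeff P f n = (\<Oplus>j\<in>{..d}. if n = j then coeff P f j else \<zero>)"
      using True f by (subst R.finsum_singleton) auto
    also have "\<dots> = (\<Oplus>j\<in>{..d}. (if n = j then \<one> else \<zero>) \<otimes> coeff P f j)"
      using f by (intro R.finsum_cong') auto
    finally show ?thesis by (intro CollectI exI[of _ "\<lambda>j. if n = j then \<one> else \<zero>"]) auto
  next
    case False
    hence "coeff P f n = \<zero>" using f by (intro deg_aboveD) auto
    thus ?thesis using zero by metis
  qed
  hence "content R f \<subseteq> ?C" by (intro content_least id)
  thus ?thesis using x by blast
qed

section \<open>Criteria for Gaussian polynomials\<close>

lemma content_mult_subset:
  assumes "f \<in> carrier P" "g \<in> carrier P"
  shows "content R (f \<otimes>\<^bsub>P\<^esub> g) \<subseteq> content R f \<cdot> content R g"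
proof (rule content_least)
  show id: "ideal (content R f \<cdot> content R g) R"
    by (intro R.ideal_prod_is_ideal content_ideal assms)
  show "coeff P (f \<otimes>\<^bsub>P\<^esub> g) n \<in> content R f \<cdot> content R g" for n
    using assms by (auto intro!: R.ideal_finsum_mem[OF id] ideal_prod.prod coeff_mem_content)
qed

text \<open>The inclusion of contents that can fail need only be tested on products of single
  coefficients: colon ideals extend it first to all of \<open>content R g\<close> and then to all of
  \<open>content R f\<close>.\<close>

lemma gaussianI:
  assumes f: "f \<in> carrier P"
    and "\<And>g i j. g \<in> carrier P \<Longrightarrow> coeff P f i \<otimes> coeff P g j \<in> content R (f \<otimes>\<^bsub>P\<^esub> g)"
  shows "gaussian R f"
  unfolding gaussian_iff
proof (intro conjI ballI f equalityI content_mult_subset)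
  fix g assume g: "g \<in> carrier P"
  have id: "ideal (content R (f \<otimes>\<^bsub>P\<^esub> g)) R" using f g by (intro content_ideal) simp
  have colon: "ideal {y \<in> carrier R. x \<otimes> y \<in> content R (f \<otimes>\<^bsub>P\<^esub> g)} R" if "x \<in> carrier R" for x
    using that id by (intro R.colon_ideal)
  have 1: "coeff P f i \<otimes> y \<in> content R (f \<otimes>\<^bsub>P\<^esub> g)" if "y \<in> content R g" for i y
    using content_least[OF colon, of "coeff P f i" g] that assms(2)[OF g] f g by auto
  have "x \<otimes> y \<in> content R (f \<otimes>\<^bsub>P\<^esub> g)" if x: "x \<in> content R f" and y: "y \<in> content R g" for x y
  proof -
    have c: "y \<in> carrier R" "x \<in> carrier R" using x y ideal.Icarr[OF content_ideal] f g by auto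
    have "content R f \<subseteq> {x \<in> carrier R. y \<otimes> x \<in> content R (f \<otimes>\<^bsub>P\<^esub> g)}"
      using c f 1[OF y] by (intro content_least colon) (auto simp: R.m_comm)
    thus ?thesis using x c by (auto simp: R.m_comm)
  qed
  thus "content R f \<cdot> content R g \<subseteq> content R (f \<otimes>\<^bsub>P\<^esub> g)" by (intro R.ideal_prod_least id)
qed (use f in auto)

subsection \<open>Graeffe's transformation\<close>

text \<open>This is \<open>g(X^2)\<close>. The substitution is multiplicative and preserves
  contents, so the content of a product \<open>F g\<close> can be computed after it.\<close>

definition subst_square :: "(nat \<Rightarrow> 'a) \<Rightarrow> nat \<Rightarrow> 'a"
  where "subst_square g n = (if even n then coeff P g (n div 2) else \<zero>)"

lemma subst_square:
  assumes "g \<in> carrier P"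
  shows subst_square_closed: "subst_square g \<in> carrier P"
    and coeff_subst_square: "coeff P (subst_square g) n = (if even n then coeff P g (n div 2) else \<zero>)"
proof -
  have "subst_square g m = \<zero>" if "2 * deg R g + 1 < m" for m
    using that assms by (auto simp: subst_square_def intro!: deg_aboveD elim!: evenE)
  note * = polynomial_from_coeffs[of "subst_square g", OF _ this]
  show "subst_square g \<in> carrier P" using assms by (intro *(1)) (auto simp: subst_square_def)
  show "coeff P (subst_square g) n = (if even n then coeff P g (n div 2) else \<zero>)"
    using assms by (subst *(2)) (auto simp: subst_square_def)
qed

lemma subst_square_minus:
  "g \<in> carrier P \<Longrightarrow> h \<in> carrier P \<Longrightarrow> subst_square (g \<ominus>\<^bsub>P\<^esub> h) = subst_square g \<ominus>\<^bsub>P\<^esub> subst_square h"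
  by (rule up_eqI) (simp_all add: subst_square coeff_minus R.minus_eq)

lemma subst_square_mult:
  assumes "g \<in> carrier P" "h \<in> carrier P"
  shows "subst_square (g \<otimes>\<^bsub>P\<^esub> h) = subst_square g \<otimes>\<^bsub>P\<^esub> subst_square h"
proof (rule up_eqI)
  fix n
  let ?t = "\<lambda>i. coeff P (subst_square g) i \<otimes> coeff P (subst_square h) (n - i)"
  have tc: "?t \<in> {..n} \<rightarrow> carrier R" using assms by (auto simp: subst_square)
  have rhs: "coeff P (subst_square g \<otimes>\<^bsub>P\<^esub> subst_square h) n = (\<Oplus>i\<in>{..n}. ?t i)"
    using assms by (simp add: subst_square_closed)
  show "coeff P (subst_square (g \<otimes>\<^bsub>P\<^esub> h)) n = coeff P (subst_square g \<otimes>\<^bsub>P\<^esub> subst_square h) n"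
  proof (cases "even n")
    case False
    have "(\<Oplus>i\<in>{..n}. ?t i) = (\<Oplus>i\<in>{..n}. \<zero>)"
      using False assms by (intro R.finsum_cong') (auto simp: subst_square)
    thus ?thesis using False assms by (simp add: rhs coeff_subst_square)
  next
    case True
    then obtain m where n: "n = 2 * m" by (elim evenE)
    have "(\<Oplus>i\<in>{..n}. ?t i) = (\<Oplus>i\<in>(\<lambda>j. 2 * j) ` {..m}. ?t i)"
    proof (rule R.add.finprod_mono_neutral_cong_right)
      fix i assume "i \<in> {..n} - (\<lambda>j. 2 * j) ` {..m}"
      hence "odd i" unfolding n by (auto elim!: evenE)
      thus "?t i = \<zero>" using assms by (simp add: subst_square)
    qed (use tc n in auto)
    also have "\<dots> = (\<Oplus>j\<in>{..m}. ?t (2 * j))"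
      using tc n by (intro R.finsum_reindex) (auto simp: inj_on_def Pi_iff)
    also have "\<dots> = (\<Oplus>j\<in>{..m}. coeff P g j \<otimes> coeff P h (m - j))"
    proof (rule R.finsum_cong')
      fix j assume "j \<in> {..m}"
      hence "n - 2 * j = 2 * (m - j)" unfolding n by (simp add: right_diff_distrib')
      thus "?t (2 * j) = coeff P g j \<otimes> coeff P h (m - j)" using assms by (simp add: subst_square)
    qed (use assms in auto)
    finally have "coeff P (subst_square g \<otimes>\<^bsub>P\<^esub> subst_square h) n
        = (\<Oplus>j\<in>{..m}. coeff P g j \<otimes> coeff P h (m - j))" using rhs by simp
    thus ?thesis using n assms by (simp add: coeff_subst_square)
  qed
qed (use assms in \<open>simp_all add: subst_square_closed\<close>)

lemma content_subst_square:
  assumes "g \<in> carrier P"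
  shows "content R (subst_square g) = content R g"
proof
  have id: "ideal (content R g) R" "ideal (content R (subst_square g)) R"
    using assms by (simp_all add: content_ideal subst_square_closed)
  show "content R (subst_square g) \<subseteq> content R g"
    using id(1) assms coeff_mem_content
    by (intro content_least) (auto simp: subst_square ideal_def additive_subgroup.zero_closed)
  have "coeff P g n \<in> content R (subst_square g)" for n
    using coeff_mem_content[OF subst_square_closed[OF assms], of "2 * n"] assms
    by (simp add: coeff_subst_square)
  thus "content R g \<subseteq> content R (subst_square g)" by (intro content_least id)
qed

text \<open>Write \<open>f = p(X\<^sup>2) + X q(X\<^sup>2)\<close> and \<open>f' = f(-X) = p(X\<^sup>2) - X q(X\<^sup>2)\<close>; then
  \<open>f f' = F(X\<^sup>2)\<close> for \<open>F = p\<^sup>2 - X q\<^sup>2\<close>. The point is that the degree does not grow.\<close>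

lemma gaussian_Graeffe:
  assumes gauss: "gaussian R f" and deg: "deg R f \<le> d"
  shows "\<exists>F. gaussian R F \<and> deg R F \<le> d \<and> content R F = content R f \<cdot> content R f"
proof -
  have f: "f \<in> carrier P" and cf: "\<And>g. g \<in> carrier P \<Longrightarrow> content R (f \<otimes>\<^bsub>P\<^esub> g) = content R f \<cdot> content R g"
    using gauss by (auto simp: gaussian_iff)
  have idf: "ideal (content R f) R" using f by (rule content_ideal)
  define p where "p = (\<lambda>n. coeff P f (2 * n))"
  define q where "q = (\<lambda>n. coeff P f (2 * n + 1))"
  let ?X = "monom P \<one> (Suc 0)"
  let ?E = subst_square
  have X: "?X \<in> carrier P" by simp
  have p: "p \<in> carrier P" "coeff P p n = coeff P f (2 * n)" for n
    using polynomial_from_coeffs[of p "deg R f"] f deg_aboveD[of f] by (auto simp: p_def)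
  have q: "q \<in> carrier P" "coeff P q n = coeff P f (2 * n + 1)" for n
    using polynomial_from_coeffs[of q "deg R f"] f deg_aboveD[of f] by (auto simp: q_def)
  have Xc: "coeff P (?X \<otimes>\<^bsub>P\<^esub> g) n = (if n = 0 then \<zero> else coeff P g (n - 1))" if "g \<in> carrier P" for g n
    unfolding coeff_monom_mult[OF R.one_closed that] using that by (cases n) auto
  have odd_part: "coeff P (?X \<otimes>\<^bsub>P\<^esub> ?E b) n = (if even n then \<zero> else coeff P b (n div 2))"
    if "b \<in> carrier P" for b n
    unfolding Xc[OF subst_square_closed[OF that]] using that by (cases n) (auto simp: coeff_subst_square)
  have feq: "f = ?E p \<oplus>\<^bsub>P\<^esub> ?X \<otimes>\<^bsub>P\<^esub> ?E q"
    by (rule up_eqI)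
       (use p q f in \<open>auto simp: odd_part coeff_subst_square subst_square_closed simp del: coeff_mult
          elim!: evenE oddE\<close>)
  define f' where "f' = ?E p \<ominus>\<^bsub>P\<^esub> ?X \<otimes>\<^bsub>P\<^esub> ?E q"
  have f': "f' \<in> carrier P" using p q by (simp add: f'_def subst_square_closed)
  define F where "F = p \<otimes>\<^bsub>P\<^esub> p \<ominus>\<^bsub>P\<^esub> ?X \<otimes>\<^bsub>P\<^esub> (q \<otimes>\<^bsub>P\<^esub> q)"
  have F: "F \<in> carrier P" using p q by (simp add: F_def)
  have EX: "?E ?X = ?X \<otimes>\<^bsub>P\<^esub> ?X"
    by (rule up_eqI) (auto simp: subst_square Xc simp del: coeff_mult elim!: evenE oddE)
  have EF: "?E F = f \<otimes>\<^bsub>P\<^esub> f'"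
  proof -
    have c: "?E p \<in> carrier P" "?E q \<in> carrier P" using p q by (simp_all add: subst_square_closed)
    have "?E F = ?E p \<otimes>\<^bsub>P\<^esub> ?E p \<ominus>\<^bsub>P\<^esub> (?X \<otimes>\<^bsub>P\<^esub> ?X) \<otimes>\<^bsub>P\<^esub> (?E q \<otimes>\<^bsub>P\<^esub> ?E q)"
      unfolding F_def EX[symmetric] using p q
      by (simp add: subst_square_minus subst_square_mult)
    also have "\<dots> = (?E p \<oplus>\<^bsub>P\<^esub> ?X \<otimes>\<^bsub>P\<^esub> ?E q) \<otimes>\<^bsub>P\<^esub> f'"
    proof -
      have "a \<otimes>\<^bsub>P\<^esub> a \<ominus>\<^bsub>P\<^esub> (x \<otimes>\<^bsub>P\<^esub> x) \<otimes>\<^bsub>P\<^esub> (b \<otimes>\<^bsub>P\<^esub> b) = (a \<oplus>\<^bsub>P\<^esub> x \<otimes>\<^bsub>P\<^esub> b) \<otimes>\<^bsub>P\<^esub> (a \<ominus>\<^bsub>P\<^esub> x \<otimes>\<^bsub>P\<^esub> b)"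
        if "a \<in> carrier P" "b \<in> carrier P" "x \<in> carrier P" for a b x
        using that by algebra
      thus ?thesis using c X unfolding f'_def by blast
    qed
    finally show ?thesis using feq by simp
  qed
  \<comment> \<open>\<open>?E a\<close> has even exponents only and \<open>?X\<close> times
    \<open>?E b\<close> has odd ones only, so the two polynomials have the same coefficients up to
    sign.\<close>
  have sign: "content R (?E a \<ominus>\<^bsub>P\<^esub> ?X \<otimes>\<^bsub>P\<^esub> ?E b) = content R (?E a \<oplus>\<^bsub>P\<^esub> ?X \<otimes>\<^bsub>P\<^esub> ?E b)"
    if "a \<in> carrier P" "b \<in> carrier P" for a b
    by (rule content_eq_up_to_sign)
       (use that in \<open>auto simp: odd_part coeff_minus coeff_subst_square subst_square_closed R.minus_eq simp del: coeff_mult\<close>)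
  \<comment> \<open>Substituting \<open>X^2\<close> preserves contents and turns \<open>F g\<close>
    into \<open>f f' g(X^2)\<close>. The Gaussian property of \<open>f\<close> applies to the factor
    \<open>f\<close>, and once more to \<open>f' g(X^2)\<close>, whose content is that of
    \<open>f g(X^2)\<close> by the change of signs.\<close>
  have cF: "content R (F \<otimes>\<^bsub>P\<^esub> g) = content R f \<cdot> content R f \<cdot> content R g" if g: "g \<in> carrier P" for g
  proof -
    have c: "?E p \<in> carrier P" "?E q \<in> carrier P" "?E g \<in> carrier P"
      using p q g by (simp_all add: subst_square_closed)
    have "content R (f' \<otimes>\<^bsub>P\<^esub> ?E g) = content R (?E (p \<otimes>\<^bsub>P\<^esub> g) \<ominus>\<^bsub>P\<^esub> ?X \<otimes>\<^bsub>P\<^esub> ?E (q \<otimes>\<^bsub>P\<^esub> g))"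
    proof -
      have "(a \<ominus>\<^bsub>P\<^esub> x \<otimes>\<^bsub>P\<^esub> b) \<otimes>\<^bsub>P\<^esub> c = a \<otimes>\<^bsub>P\<^esub> c \<ominus>\<^bsub>P\<^esub> x \<otimes>\<^bsub>P\<^esub> (b \<otimes>\<^bsub>P\<^esub> c)"
        if "a \<in> carrier P" "b \<in> carrier P" "x \<in> carrier P" "c \<in> carrier P" for a b c x
        using that by algebra
      thus ?thesis unfolding f'_def using c X p q g by (simp add: subst_square_mult)
    qed
    also have "\<dots> = content R (?E (p \<otimes>\<^bsub>P\<^esub> g) \<oplus>\<^bsub>P\<^esub> ?X \<otimes>\<^bsub>P\<^esub> ?E (q \<otimes>\<^bsub>P\<^esub> g))"
      using p q g by (intro sign) auto
    also have "?E (p \<otimes>\<^bsub>P\<^esub> g) \<oplus>\<^bsub>P\<^esub> ?X \<otimes>\<^bsub>P\<^esub> ?E (q \<otimes>\<^bsub>P\<^esub> g) = (?E p \<oplus>\<^bsub>P\<^esub> ?X \<otimes>\<^bsub>P\<^esub> ?E q) \<otimes>\<^bsub>P\<^esub> ?E g"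
      using c X p q g by (simp add: subst_square_mult P.l_distr P.m_assoc)
    also have "content R \<dots> = content R f \<cdot> content R g"
      using cf[OF c(3)] feq g by (simp add: content_subst_square)
    finally have 1: "content R (f' \<otimes>\<^bsub>P\<^esub> ?E g) = content R f \<cdot> content R g" .
    have "content R (F \<otimes>\<^bsub>P\<^esub> g) = content R (?E (F \<otimes>\<^bsub>P\<^esub> g))"
      using F g by (simp add: content_subst_square)
    also have "?E (F \<otimes>\<^bsub>P\<^esub> g) = f \<otimes>\<^bsub>P\<^esub> (f' \<otimes>\<^bsub>P\<^esub> ?E g)"
      using F g f f' c by (simp add: subst_square_mult EF P.m_assoc)
    also have "content R \<dots> = content R f \<cdot> (content R f \<cdot> content R g)"
      using cf[of "f' \<otimes>\<^bsub>P\<^esub> ?E g"] 1 f' c by simp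
    finally show ?thesis using g idf by (simp add: R.ideal_prod_assoc content_ideal)
  qed
  \<comment> \<open>The case \<open>g = 1\<close> of \<open>cF\<close> identifies the content of
    \<open>F\<close> itself.\<close>
  have "content R \<one>\<^bsub>P\<^esub> = carrier R"
  proof -
    have "\<one> \<in> content R \<one>\<^bsub>P\<^esub>" using coeff_mem_content[of "\<one>\<^bsub>P\<^esub>" 0] by simp
    thus ?thesis using ideal.one_imp_carrier[OF content_ideal] by blast
  qed
  hence cF1: "content R F = content R f \<cdot> content R f"
    using cF[of "\<one>\<^bsub>P\<^esub>"] F idf by (simp add: R.ideal_prod_one R.ideal_prod_is_ideal)
  have "deg R f' \<le> deg R f"
  proof (rule deg_aboveI[OF _ f'])
    fix m assume "deg R f < m"
    hence "coeff P f m = \<zero>" using f by (rule deg_aboveD)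
    thus "coeff P f' m = \<zero>"
      unfolding f'_def using p q
      by (auto simp: odd_part coeff_minus coeff_subst_square subst_square_closed R.minus_eq
          simp del: coeff_mult elim!: evenE oddE)
  qed
  \<comment> \<open>The product \<open>f f'\<close> has degree at most \<open>2 d\<close> and equals
    \<open>F(X^2)\<close>, so \<open>d\<close> bounds the degree of \<open>F\<close>.\<close>
  hence "deg R (?E F) \<le> 2 * d" using deg_mult_ring[OF f f'] deg EF by simp
  hence "coeff P (?E F) (2 * m) = \<zero>" if "d < m" for m
    using that F by (intro deg_aboveD) (auto simp: subst_square_closed)
  hence "deg R F \<le> d" using F by (intro deg_aboveI) (simp_all add: coeff_subst_square)
  moreover have "gaussian R F" unfolding gaussian_iff using cF cF1 F by simp
  ultimately show ?thesis using cF1 by blast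
qed

text \<open>Each Graeffe transformation squares the content and keeps the degree bound
  \<open>d\<close>, so all these powers of the content have \<open>d + 1\<close> generators.\<close>

lemma gaussian_content_two_power:
  assumes "gaussian R f" "deg R f \<le> d"
  shows "\<exists>F. gaussian R F \<and> deg R F \<le> d \<and> content R F = ideal_power R (content R f) (2 ^ n)"
proof (induction n)
  case 0
  have "f \<in> carrier P" using assms(1) by (simp add: gaussian_iff)
  thus ?case using assms by (auto simp: R.ideal_power_1 content_ideal)
next
  case (Suc n)
  then obtain F where F: "gaussian R F" "deg R F \<le> d" "content R F = ideal_power R (content R f) (2 ^ n)"
    by blast
  have "f \<in> carrier P" using assms(1) by (simp add: gaussian_iff)
  hence "content R F \<cdot> content R F = ideal_power R (content R f) (2 ^ Suc n)"
    unfolding F(3) by (simp add: R.ideal_power_add[symmetric] content_ideal mult_2)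
  thus ?case using gaussian_Graeffe[OF F(1,2)] by metis
qed

end

section \<open>Gaussian polynomials over domains\<close>

locale gaussian_at_prime = UP_domain R P for R (structure) and P (structure) +
  fixes f M
  assumes f_gaussian: "gaussian R f" and M_prime: "primeideal M R" and f_nonzero: "f \<noteq> \<zero>\<^bsub>P\<^esub>"
begin

abbreviation "I \<equiv> content R f"

abbreviation "L \<equiv> coeff_ideal R I"

abbreviation "Q \<equiv> coeff_ideal R M"

text \<open>The intersection of \<open>f K[X]\<close> with \<open>R[X]\<close>, for \<open>K\<close>
  the quotient field of \<open>R\<close>, written without fractions by clearing a denominator
  \<open>b\<close>.\<close>

definition saturation :: "(nat \<Rightarrow> 'a) set"
  where "saturation = {g \<in> carrier P. \<exists>b\<in>carrier R - {\<zero>}. \<exists>h\<in>carrier P. monom P b 0 \<otimes>\<^bsub>P\<^esub> g = f \<otimes>\<^bsub>P\<^esub> h}"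

section \<open>The saturation of \<open>f\<close> and its fiber cone\<close>

lemma f_closed: "f \<in> carrier P"
  using f_gaussian by (simp add: gaussian_iff)

lemma I_ideal: "ideal I R"
  by (rule content_ideal[OF f_closed])

lemma L_power: "ideal_power P L n = coeff_ideal R (ideal_power R I n)"
  by (simp add: coeff_ideal_power I_ideal)

lemma monom_0_mult: "a \<in> carrier R \<Longrightarrow> b \<in> carrier R \<Longrightarrow> monom P (a \<otimes> b) 0 = monom P a 0 \<otimes>\<^bsub>P\<^esub> monom P b 0"
  using monom_mult[of a b 0 0] by simp

lemma saturationI:
  "g \<in> carrier P \<Longrightarrow> b \<in> carrier R \<Longrightarrow> b \<noteq> \<zero> \<Longrightarrow> h \<in> carrier P \<Longrightarrow>
    monom P b 0 \<otimes>\<^bsub>P\<^esub> g = f \<otimes>\<^bsub>P\<^esub> h \<Longrightarrow> g \<in> saturation"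
  unfolding saturation_def by blast

lemma saturationE:
  assumes "g \<in> saturation"
  obtains b h where "g \<in> carrier P" "b \<in> carrier R" "b \<noteq> \<zero>" "h \<in> carrier P" "monom P b 0 \<otimes>\<^bsub>P\<^esub> g = f \<otimes>\<^bsub>P\<^esub> h"
  using assms unfolding saturation_def by blast

lemma f_mem_saturation: "f \<in> saturation"
  using f_closed R.one_not_zero by (intro saturationI[of f \<one> "\<one>\<^bsub>P\<^esub>"]) auto

lemma saturation_ideal: "ideal saturation P"
proof (rule P.ideal_if_closed)
  show "saturation \<subseteq> carrier P" by (auto simp: saturation_def)
  show "\<zero>\<^bsub>P\<^esub> \<in> saturation"
    using f_closed R.one_not_zero by (intro saturationI[of _ \<one> "\<zero>\<^bsub>P\<^esub>"]) auto
  show "g \<oplus>\<^bsub>P\<^esub> g' \<in> saturation" if gg: "g \<in> saturation" "g' \<in> saturation" for g g'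
  proof -
    obtain b h where g: "g \<in> carrier P" "b \<in> carrier R" "b \<noteq> \<zero>" "h \<in> carrier P" "monom P b 0 \<otimes>\<^bsub>P\<^esub> g = f \<otimes>\<^bsub>P\<^esub> h"
      using gg(1) by (rule saturationE)
    obtain b' h' where g': "g' \<in> carrier P" "b' \<in> carrier R" "b' \<noteq> \<zero>" "h' \<in> carrier P" "monom P b' 0 \<otimes>\<^bsub>P\<^esub> g' = f \<otimes>\<^bsub>P\<^esub> h'"
      using gg(2) by (rule saturationE)
    let ?b = "monom P b 0" and ?b' = "monom P b' 0"
    have bc: "?b \<in> carrier P" "?b' \<in> carrier P" using g g' by auto
    have "monom P (b \<otimes> b') 0 \<otimes>\<^bsub>P\<^esub> (g \<oplus>\<^bsub>P\<^esub> g') = ?b \<otimes>\<^bsub>P\<^esub> ?b' \<otimes>\<^bsub>P\<^esub> (g \<oplus>\<^bsub>P\<^esub> g')"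
      using monom_0_mult[OF g(2) g'(2)] by simp
    also have "\<dots> = ?b' \<otimes>\<^bsub>P\<^esub> (?b \<otimes>\<^bsub>P\<^esub> g) \<oplus>\<^bsub>P\<^esub> ?b \<otimes>\<^bsub>P\<^esub> (?b' \<otimes>\<^bsub>P\<^esub> g')"
      using g(1) g'(1) bc by algebra
    also have "\<dots> = f \<otimes>\<^bsub>P\<^esub> (?b' \<otimes>\<^bsub>P\<^esub> h \<oplus>\<^bsub>P\<^esub> ?b \<otimes>\<^bsub>P\<^esub> h')"
      unfolding g(5) g'(5) using g(4) g'(4) bc f_closed by algebra
    finally show ?thesis
      using g g' bc R.integral[of b b'] by (intro saturationI[of _ "b \<otimes> b'"]) auto
  qed
  show "x \<otimes>\<^bsub>P\<^esub> g \<in> saturation" if gx: "x \<in> carrier P" "g \<in> saturation" for x g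
  proof -
    obtain b h where g: "g \<in> carrier P" "b \<in> carrier R" "b \<noteq> \<zero>" "h \<in> carrier P" "monom P b 0 \<otimes>\<^bsub>P\<^esub> g = f \<otimes>\<^bsub>P\<^esub> h"
      using gx(2) by (rule saturationE)
    have "monom P b 0 \<otimes>\<^bsub>P\<^esub> (x \<otimes>\<^bsub>P\<^esub> g) = x \<otimes>\<^bsub>P\<^esub> (monom P b 0 \<otimes>\<^bsub>P\<^esub> g)"
      using g gx by (intro P.m_lcomm) auto
    also have "\<dots> = f \<otimes>\<^bsub>P\<^esub> (x \<otimes>\<^bsub>P\<^esub> h)"
      unfolding g(5) using g gx f_closed by (intro P.m_lcomm) auto
    finally show ?thesis using g gx by (intro saturationI[of _ b "x \<otimes>\<^bsub>P\<^esub> h"]) auto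
  qed
qed

text \<open>A nonzero constant is absorbed into the denominator \<open>b\<close>, and the product
  stays nonzero in a domain.\<close>

lemma saturation_cancel:
  assumes "c \<in> carrier R" "c \<noteq> \<zero>" "u \<in> carrier P" "u \<otimes>\<^bsub>P\<^esub> monom P c 0 \<in> saturation"
  shows "u \<in> saturation"
proof -
  obtain b h where b: "b \<in> carrier R" "b \<noteq> \<zero>" "h \<in> carrier P" "monom P b 0 \<otimes>\<^bsub>P\<^esub> (u \<otimes>\<^bsub>P\<^esub> monom P c 0) = f \<otimes>\<^bsub>P\<^esub> h"
    using assms(4) by (rule saturationE)
  have bc: "monom P b 0 \<in> carrier P" "monom P c 0 \<in> carrier P" using assms b by auto
  have "monom P b 0 \<otimes>\<^bsub>P\<^esub> monom P c 0 \<otimes>\<^bsub>P\<^esub> u = f \<otimes>\<^bsub>P\<^esub> h"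
    unfolding b(4)[symmetric] using assms(3) bc by algebra
  hence "monom P (b \<otimes> c) 0 \<otimes>\<^bsub>P\<^esub> u = f \<otimes>\<^bsub>P\<^esub> h"
    using monom_0_mult[OF b(1) assms(1)] by simp
  thus ?thesis using assms b R.integral[of b c] by (intro saturationI[of _ "b \<otimes> c" h]) auto
qed

text \<open>Gauss' lemma makes \<open>M[X]\<close> prime, so the theory of the fiber cone applies to
  the polynomial ring, with the saturation as \<open>F\<close>.\<close>

sublocale fiber_cone P Q saturation L
  by (intro fiber_cone.intro fiber_cone_axioms.intro P.cring_axioms coeff_ideal_prime M_prime
      saturation_ideal coeff_ideal_ideal I_ideal)

text \<open>In the fiber cone modulo the ideal \<open>C\<close>, which contains the coefficients of \<open>f\<close> above degree
  \<open>e\<close>, the relation \<open>f = 0\<close> rewrites \<open>f\<^sub>e X\<^sup>e\<close> to a polynomial of degree less than \<open>e\<close>.\<close>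

lemma leading_power_reduce:
  assumes C: "ideal C P" and high: "\<And>j. e < j \<Longrightarrow> monom P (coeff P f j) 0 \<in> C"
  defines "a \<equiv> monom P (coeff P f e) 0"
  shows "\<exists>w\<in>coeff_ideal R (ideal_power R I (Suc l)). (\<forall>i\<ge>e. coeff P w i = \<zero>) \<and>
    a [^]\<^bsub>P\<^esub> Suc l \<otimes>\<^bsub>P\<^esub> monom P \<one> (e + l) \<ominus>\<^bsub>P\<^esub> w \<in> C \<cdot>\<^bsub>P\<^esub> ideal_power P L l <+>\<^bsub>P\<^esub> saturation"
proof -
  define E where "E m = C \<cdot>\<^bsub>P\<^esub> ideal_power P L m <+>\<^bsub>P\<^esub> saturation" for m
  have Lid: "ideal (ideal_power P L m) P" for m by (rule L_power_ideal)
  have idp: "ideal (ideal_power R I m) R" for m using I_ideal by (rule R.ideal_power_ideal)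
  have E: "ideal (E m) P" for m
    unfolding E_def by (intro P.add_ideals P.ideal_prod_is_ideal C Lid saturation_ideal)
  have Emult: "x \<otimes>\<^bsub>P\<^esub> y \<in> E (m + n)" if "x \<in> E m" "y \<in> ideal_power P L n" for x y m n
    using that unfolding E_def by (intro P.ideal_prod_power_sum_mult C L_ideal saturation_ideal)
  have fc: "coeff P f i \<in> carrier R" for i using f_closed by simp
  have fI: "coeff P f i \<in> I" for i using f_closed by (rule coeff_mem_content)
  have ac: "a \<in> carrier P" unfolding a_def using fc by simp
  have aL: "a \<in> L" unfolding a_def using I_ideal fI by (rule monom_mem_coeff_ideal)
  \<comment> \<open>With \<open>t\<close> the part of \<open>f\<close> above degree
    \<open>e\<close>, one has \<open>f = t + a X^e - g\<close>; hence \<open>a X^e\<close> is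
    congruent to \<open>g\<close> modulo \<open>C\<close> and the saturation.\<close>
  define g where "g = (\<lambda>i. if i < e then \<ominus> coeff P f i else \<zero>)"
  have g: "g \<in> carrier P" "coeff P g i = (if i < e then \<ominus> coeff P f i else \<zero>)" for i
    using polynomial_from_coeffs[of g e] fc by (simp_all add: g_def)
  define t where "t = (\<lambda>i. if e < i then coeff P f i else \<zero>)"
  have t: "t \<in> carrier P" "coeff P t i = (if e < i then coeff P f i else \<zero>)" for i
    using polynomial_from_coeffs[of t "deg R f"] fc f_closed deg_aboveD[of f] by (simp_all add: t_def)
  have "\<zero>\<^bsub>P\<^esub> \<in> C" using C by (simp add: ideal_def additive_subgroup.zero_closed)
  hence tC: "t \<in> C"
    using high by (intro polynomial_mem_ideal[OF C t(1)]) (simp add: t(2))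
  have gI: "g \<in> L"
    unfolding mem_coeff_ideal_iff g(2) using I_ideal fI g(1)
    by (auto simp: ideal_def additive_subgroup.zero_closed additive_subgroup.a_inv_closed)
  let ?X = "\<lambda>n. monom P \<one> n"
  have lead: "a \<otimes>\<^bsub>P\<^esub> ?X e \<ominus>\<^bsub>P\<^esub> g = f \<ominus>\<^bsub>P\<^esub> t"
  proof (rule up_eqI)
    have "a \<otimes>\<^bsub>P\<^esub> ?X e = monom P (coeff P f e) e"
      unfolding a_def using monom_mult[of "coeff P f e" \<one> 0 e] fc by simp
    thus "coeff P (a \<otimes>\<^bsub>P\<^esub> ?X e \<ominus>\<^bsub>P\<^esub> g) n = coeff P (f \<ominus>\<^bsub>P\<^esub> t) n" for n
      using fc f_closed g(1) t(1) by (auto simp: coeff_minus g(2) t(2) R.minus_eq R.r_neg)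
  qed (use ac g t f_closed in auto)
  have E0: "a \<otimes>\<^bsub>P\<^esub> ?X e \<ominus>\<^bsub>P\<^esub> g \<in> E 0"
  proof -
    have "saturation \<subseteq> E 0" "C \<cdot>\<^bsub>P\<^esub> ideal_power P L 0 \<subseteq> E 0"
      unfolding E_def by (intro P.ideal_sum_upper P.ideal_prod_is_ideal C Lid saturation_ideal)+
    hence "f \<in> E 0" "t \<in> E 0" using f_mem_saturation tC C by (auto simp: P.ideal_power_0 P.ideal_prod_one)
    thus ?thesis unfolding lead by (rule P.ideal_minus_mem[OF E])
  qed
  have "\<exists>w\<in>coeff_ideal R (ideal_power R I (Suc l)). (\<forall>i\<ge>e. coeff P w i = \<zero>) \<and>
      a [^]\<^bsub>P\<^esub> Suc l \<otimes>\<^bsub>P\<^esub> ?X (e + l) \<ominus>\<^bsub>P\<^esub> w \<in> E l"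
  proof (induction l)
    case 0
    show ?case using E0 gI g ac I_ideal by (intro bexI[of _ g]) (auto simp: R.ideal_power_1)
  next
    case (Suc l)
    then obtain w where w: "w \<in> coeff_ideal R (ideal_power R I (Suc l))" "\<forall>i\<ge>e. coeff P w i = \<zero>"
      "a [^]\<^bsub>P\<^esub> Suc l \<otimes>\<^bsub>P\<^esub> ?X (e + l) \<ominus>\<^bsub>P\<^esub> w \<in> E l" by blast
    have wc: "w \<in> carrier P" using w by (simp add: mem_coeff_ideal_iff)
    \<comment> \<open>Multiplying \<open>w\<close> by \<open>X\<close> can create a term of degree
      \<open>e\<close>; its coefficient \<open>c\<close> is split off.\<close>
    define c where "c = coeff P (?X 1 \<otimes>\<^bsub>P\<^esub> w) e"
    have Xw: "?X 1 \<otimes>\<^bsub>P\<^esub> w \<in> coeff_ideal R (ideal_power R I (Suc l))"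
      using w(1) by (intro ideal.I_l_closed[OF coeff_ideal_ideal[OF idp]]) auto
    have cI: "c \<in> ideal_power R I (Suc l)" using Xw by (simp add: c_def mem_coeff_ideal_iff)
    have cc: "c \<in> carrier R" using ideal.Icarr[OF idp cI] .
    let ?c = "monom P c 0"
    have cL: "?c \<in> ideal_power P L (Suc l)" unfolding L_power using idp cI by (rule monom_mem_coeff_ideal)
    have ccP: "?c \<in> carrier P" using cc by simp
    define w' where "w' = ?X 1 \<otimes>\<^bsub>P\<^esub> w \<ominus>\<^bsub>P\<^esub> ?c \<otimes>\<^bsub>P\<^esub> ?X e"
    have w'c: "w' \<in> carrier P" using wc cc by (simp add: w'_def)
    have w'I: "w' \<in> coeff_ideal R (ideal_power R I (Suc l))"
      unfolding w'_def using cL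
      by (intro P.ideal_minus_mem coeff_ideal_ideal idp Xw ideal.I_r_closed[OF coeff_ideal_ideal[OF idp]])
         (auto simp: L_power)
    have w'0: "coeff P w' i = \<zero>" if "i \<ge> e" for i
    proof (cases "i = e")
      case True
      have "coeff P (?c \<otimes>\<^bsub>P\<^esub> ?X e) e = c" using cc by (simp add: coeff_monom_mult del: coeff_mult)
      thus ?thesis using True cc wc unfolding w'_def
        by (simp add: coeff_minus c_def[symmetric] R.minus_eq R.r_neg del: coeff_mult One_nat_def)
    next
      case False
      hence "i - 1 \<ge> e" "i \<noteq> 0" using that by auto
      thus ?thesis using cc wc w(2) False
        by (simp add: w'_def coeff_minus coeff_monom_mult R.minus_eq del: coeff_mult)
    qed
    \<comment> \<open>The new factor \<open>a\<close> is spent on the split-off term, where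
      \<open>a X^e\<close> is replaced by \<open>g\<close>; on the rest it only raises the power of
      \<open>I\<close>. Both summands have no terms from degree \<open>e\<close> on.\<close>
    let ?w = "a \<otimes>\<^bsub>P\<^esub> w' \<oplus>\<^bsub>P\<^esub> ?c \<otimes>\<^bsub>P\<^esub> g"
    have "a \<otimes>\<^bsub>P\<^esub> w' \<in> L \<cdot>\<^bsub>P\<^esub> ideal_power P L (Suc l)" using aL w'I by (simp add: L_power ideal_prod.prod)
    moreover have "L \<cdot>\<^bsub>P\<^esub> ideal_power P L (Suc l) = ideal_power P L (Suc (Suc l))"
      unfolding P.ideal_power_Suc[of L "Suc l"] by (rule P.ideal_prod_commute[OF L_ideal Lid])
    moreover have "?c \<otimes>\<^bsub>P\<^esub> g \<in> ideal_power P L (Suc (Suc l))"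
      unfolding P.ideal_power_Suc[of L "Suc l"] using cL gI by (rule ideal_prod.prod)
    ultimately have 1: "?w \<in> coeff_ideal R (ideal_power R I (Suc (Suc l)))"
      using P.ideal_add_mem[OF Lid] unfolding L_power by blast
    have 2: "\<forall>i\<ge>e. coeff P ?w i = \<zero>"
      using w'0 w'c g(1) cc fc ac
      by (auto simp: a_def coeff_monom_mult g(2) simp del: coeff_mult)
    let ?A = "a [^]\<^bsub>P\<^esub> Suc l"
    have Ac: "?A \<in> carrier P" using ac by simp
    \<comment> \<open>The new error is the old one times \<open>a X\<close> plus the error of the
      basic relation times \<open>c\<close>; both land in \<open>E (Suc l)\<close>.\<close>
    have "?A \<otimes>\<^bsub>P\<^esub> a \<otimes>\<^bsub>P\<^esub> (?X (e + l) \<otimes>\<^bsub>P\<^esub> ?X 1) \<ominus>\<^bsub>P\<^esub> ?w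
        = ((?A \<otimes>\<^bsub>P\<^esub> ?X (e + l) \<ominus>\<^bsub>P\<^esub> w) \<otimes>\<^bsub>P\<^esub> a) \<otimes>\<^bsub>P\<^esub> ?X 1 \<oplus>\<^bsub>P\<^esub> (a \<otimes>\<^bsub>P\<^esub> ?X e \<ominus>\<^bsub>P\<^esub> g) \<otimes>\<^bsub>P\<^esub> ?c"
    proof -
      have "A \<otimes>\<^bsub>P\<^esub> b \<otimes>\<^bsub>P\<^esub> (x \<otimes>\<^bsub>P\<^esub> y) \<ominus>\<^bsub>P\<^esub> (b \<otimes>\<^bsub>P\<^esub> (y \<otimes>\<^bsub>P\<^esub> v \<ominus>\<^bsub>P\<^esub> c \<otimes>\<^bsub>P\<^esub> z) \<oplus>\<^bsub>P\<^esub> c \<otimes>\<^bsub>P\<^esub> k)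
        = ((A \<otimes>\<^bsub>P\<^esub> x \<ominus>\<^bsub>P\<^esub> v) \<otimes>\<^bsub>P\<^esub> b) \<otimes>\<^bsub>P\<^esub> y \<oplus>\<^bsub>P\<^esub> (b \<otimes>\<^bsub>P\<^esub> z \<ominus>\<^bsub>P\<^esub> k) \<otimes>\<^bsub>P\<^esub> c"
        if "A \<in> carrier P" "b \<in> carrier P" "x \<in> carrier P" "y \<in> carrier P" "v \<in> carrier P"
          "c \<in> carrier P" "z \<in> carrier P" "k \<in> carrier P" for A b x y v c z k
        using that by algebra
      thus ?thesis unfolding w'_def using Ac ac wc ccP g(1) by simp
    qed
    also have "\<dots> \<in> E (Suc l)"
    proof (rule P.ideal_add_mem[OF E])
      have "a \<in> ideal_power P L (Suc 0)" using aL L_ideal by (simp add: P.ideal_power_1)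
      from Emult[OF w(3) this]
      show "((?A \<otimes>\<^bsub>P\<^esub> ?X (e + l) \<ominus>\<^bsub>P\<^esub> w) \<otimes>\<^bsub>P\<^esub> a) \<otimes>\<^bsub>P\<^esub> ?X 1 \<in> E (Suc l)"
        by (simp add: ideal.I_r_closed[OF E])
      show "(a \<otimes>\<^bsub>P\<^esub> ?X e \<ominus>\<^bsub>P\<^esub> g) \<otimes>\<^bsub>P\<^esub> ?c \<in> E (Suc l)" using Emult[OF E0 cL] by simp
    qed
    finally have "a [^]\<^bsub>P\<^esub> Suc (Suc l) \<otimes>\<^bsub>P\<^esub> ?X (e + Suc l) \<ominus>\<^bsub>P\<^esub> ?w \<in> E (Suc l)"
      using monom_one_mult[of "e + l" 1] by simp
    with 1 2 show ?case by blast
  qed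
  thus ?thesis unfolding E_def .
qed

text \<open>A dimension count over \<open>R / M\<close>: the reductions of
  \<open>a^T X^(e+l)\<close> for \<open>l < T\<close> have \<open>e\<close> coefficients in
  \<open>I^T\<close>, each a combination of \<open>d + 1\<close> generators, so they are vectors
  with \<open>e * Suc d\<close> coordinates, fewer than \<open>T\<close>. A relation modulo
  \<open>M\<close> combines the powers of \<open>X\<close> into a polynomial \<open>u\<close>
  outside \<open>M[X]\<close> such that \<open>a^T u\<close> is zero modulo \<open>M I^T\<close>,
  \<open>C L^t\<close> and the saturation.\<close>

lemma leading_coeff_nilpotent:
  assumes C: "ideal C P" "C \<subseteq> L" and nil: "ideal_power P C N \<subseteq> fiber_kernel N"
    and high: "\<And>j. e < j \<Longrightarrow> monom P (coeff P f j) 0 \<in> C"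
  shows "\<exists>n. ideal_power P (C <+>\<^bsub>P\<^esub> (PIdl\<^bsub>P\<^esub> (monom P (coeff P f e) 0))) n \<subseteq> fiber_kernel n"
proof -
  define d where "d = deg R f"
  define a where "a = monom P (coeff P f e) 0"
  \<comment> \<open>A power of two, so that \<open>I^T\<close> is the content of a Gaussian
    polynomial of degree at most \<open>d\<close>; it exceeds the number of coordinates because
    \<open>m < 2^m\<close>.\<close>
  define T :: nat where "T = 2 ^ (e * Suc d)"
  have Tbig: "e * Suc d < T" unfolding T_def by (rule less_exp)
  then obtain t where t: "T = Suc t" using not0_implies_Suc by (metis less_zeroE)
  interpret M: primeideal M R by (rule M_prime)
  have idp: "ideal (ideal_power R I m) R" for m using I_ideal by (rule R.ideal_power_ideal)
  have Lid: "ideal (ideal_power P L m) P" for m by (rule L_power_ideal)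
  have fI: "coeff P f i \<in> I" for i using f_closed by (rule coeff_mem_content)
  have aL: "a \<in> L" unfolding a_def using I_ideal fI by (rule monom_mem_coeff_ideal)
  have ac: "a \<in> carrier P" using aL by (simp add: mem_coeff_ideal_iff)
  define E where "E m = C \<cdot>\<^bsub>P\<^esub> ideal_power P L m <+>\<^bsub>P\<^esub> saturation" for m
  have E: "ideal (E m) P" for m
    unfolding E_def by (intro P.add_ideals P.ideal_prod_is_ideal C Lid saturation_ideal)
  obtain G where G: "gaussian R G" "deg R G \<le> d" "content R G = ideal_power R I T"
    using gaussian_content_two_power[OF f_gaussian, of d "e * Suc d"] unfolding d_def T_def by blast
  have Gc: "G \<in> carrier P" using G(1) by (simp add: gaussian_iff)
  have GI: "coeff P G j \<in> ideal_power R I T" for j using coeff_mem_content[OF Gc] G(3) by simp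
  \<comment> \<open>The relations from \<open>leading_power_reduce\<close> involve different powers
    \<open>Suc l\<close>; the factor \<open>a^(t - l)\<close> lifts them all to the common power
    \<open>T\<close>.\<close>
  have "\<exists>w\<in>coeff_ideal R (ideal_power R I T). (\<forall>i\<ge>e. coeff P w i = \<zero>) \<and>
      a [^]\<^bsub>P\<^esub> T \<otimes>\<^bsub>P\<^esub> monom P \<one> (e + l) \<ominus>\<^bsub>P\<^esub> w \<in> E t" if l: "l < T" for l
  proof -
    obtain w where w: "w \<in> coeff_ideal R (ideal_power R I (Suc l))" "\<forall>i\<ge>e. coeff P w i = \<zero>"
        "a [^]\<^bsub>P\<^esub> Suc l \<otimes>\<^bsub>P\<^esub> monom P \<one> (e + l) \<ominus>\<^bsub>P\<^esub> w \<in> E l"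
      using leading_power_reduce[OF C(1) high] unfolding a_def E_def by blast
    have wc: "w \<in> carrier P" using w by (simp add: mem_coeff_ideal_iff)
    let ?k = "t - l"
    have ak: "a [^]\<^bsub>P\<^esub> k = monom P (coeff P f e [^] k) 0" for k :: nat
    proof (induction k)
      case (Suc k)
      have fe: "coeff P f e \<in> carrier R" using f_closed by simp
      show ?case unfolding P.nat_pow_Suc R.nat_pow_Suc Suc.IH
        unfolding a_def by (rule monom_0_mult[symmetric]) (simp_all add: fe)
    qed simp
    have aL': "a [^]\<^bsub>P\<^esub> ?k \<in> ideal_power P L ?k" using aL ac by (rule P.power_mem_ideal_power)
    have kc: "a [^]\<^bsub>P\<^esub> ?k \<in> carrier P" "a [^]\<^bsub>P\<^esub> Suc l \<in> carrier P" using ac by auto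
    have sum: "l + ?k = t" "Suc l + ?k = T" using l t by auto
    have pow: "a [^]\<^bsub>P\<^esub> T = a [^]\<^bsub>P\<^esub> Suc l \<otimes>\<^bsub>P\<^esub> a [^]\<^bsub>P\<^esub> ?k"
      unfolding P.nat_pow_mult[OF ac] sum ..
    have "w \<otimes>\<^bsub>P\<^esub> a [^]\<^bsub>P\<^esub> ?k \<in> ideal_power P L (Suc l) \<cdot>\<^bsub>P\<^esub> ideal_power P L ?k"
      using w(1) aL' unfolding L_power[of "Suc l"] by (intro ideal_prod.prod)
    also have "\<dots> = ideal_power P L T"
      using P.ideal_power_add[OF L_ideal, of "Suc l" ?k, symmetric] unfolding sum(2) .
    finally have 1: "w \<otimes>\<^bsub>P\<^esub> a [^]\<^bsub>P\<^esub> ?k \<in> coeff_ideal R (ideal_power R I T)" unfolding L_power .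
    have "coeff P (a [^]\<^bsub>P\<^esub> ?k \<otimes>\<^bsub>P\<^esub> w) i = coeff P f e [^] ?k \<otimes> coeff P w i" for i
      unfolding ak using wc f_closed by (simp add: coeff_monom_mult del: coeff_mult)
    hence 2: "\<forall>i\<ge>e. coeff P (w \<otimes>\<^bsub>P\<^esub> a [^]\<^bsub>P\<^esub> ?k) i = \<zero>"
      using w(2) f_closed P.m_comm[OF wc kc(1)] by (simp del: coeff_mult)
    have "(a [^]\<^bsub>P\<^esub> Suc l \<otimes>\<^bsub>P\<^esub> monom P \<one> (e + l) \<ominus>\<^bsub>P\<^esub> w) \<otimes>\<^bsub>P\<^esub> a [^]\<^bsub>P\<^esub> ?k \<in> E (l + ?k)"
      using w(3) aL' unfolding E_def by (intro P.ideal_prod_power_sum_mult C L_ideal saturation_ideal)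
    moreover have "(a [^]\<^bsub>P\<^esub> Suc l \<otimes>\<^bsub>P\<^esub> monom P \<one> (e + l) \<ominus>\<^bsub>P\<^esub> w) \<otimes>\<^bsub>P\<^esub> a [^]\<^bsub>P\<^esub> ?k
        = a [^]\<^bsub>P\<^esub> T \<otimes>\<^bsub>P\<^esub> monom P \<one> (e + l) \<ominus>\<^bsub>P\<^esub> w \<otimes>\<^bsub>P\<^esub> a [^]\<^bsub>P\<^esub> ?k"
    proof -
      have identity: "(A \<otimes>\<^bsub>P\<^esub> x \<ominus>\<^bsub>P\<^esub> v) \<otimes>\<^bsub>P\<^esub> b = A \<otimes>\<^bsub>P\<^esub> b \<otimes>\<^bsub>P\<^esub> x \<ominus>\<^bsub>P\<^esub> v \<otimes>\<^bsub>P\<^esub> b"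
        if "A \<in> carrier P" "x \<in> carrier P" "v \<in> carrier P" "b \<in> carrier P" for A x v b
        using that by algebra
      show ?thesis unfolding pow by (rule identity) (use kc wc in auto)
    qed
    ultimately have "a [^]\<^bsub>P\<^esub> T \<otimes>\<^bsub>P\<^esub> monom P \<one> (e + l) \<ominus>\<^bsub>P\<^esub> w \<otimes>\<^bsub>P\<^esub> a [^]\<^bsub>P\<^esub> ?k \<in> E t"
      unfolding sum(1) by (simp only:)
    with 1 2 show ?thesis by blast
  qed
  hence "\<exists>w. \<forall>l<T. w l \<in> coeff_ideal R (ideal_power R I T) \<and> (\<forall>i\<ge>e. coeff P (w l) i = \<zero>) \<and>
      a [^]\<^bsub>P\<^esub> T \<otimes>\<^bsub>P\<^esub> monom P \<one> (e + l) \<ominus>\<^bsub>P\<^esub> w l \<in> E t" by metis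
  then obtain w where w: "\<And>l. l < T \<Longrightarrow> w l \<in> coeff_ideal R (ideal_power R I T)"
      "\<And>l i. l < T \<Longrightarrow> e \<le> i \<Longrightarrow> coeff P (w l) i = \<zero>"
      "\<And>l. l < T \<Longrightarrow> a [^]\<^bsub>P\<^esub> T \<otimes>\<^bsub>P\<^esub> monom P \<one> (e + l) \<ominus>\<^bsub>P\<^esub> w l \<in> E t" by blast
  have wc: "w l \<in> carrier P" "\<And>i. coeff P (w l) i \<in> content R G" if "l < T" for l
    using w(1)[OF that] G(3) by (auto simp: mem_coeff_ideal_iff)
  have "\<forall>l i. \<exists>v. l < T \<longrightarrow> (\<forall>j. v j \<in> carrier R) \<and> coeff P (w l) i = (\<Oplus>j\<in>{..d}. v j \<otimes> coeff P G j)"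
    using content_combination[OF Gc G(2)] wc(2) by meson
  then obtain v where v: "\<And>l i j. l < T \<Longrightarrow> v l i j \<in> carrier R"
      "\<And>l i. l < T \<Longrightarrow> coeff P (w l) i = (\<Oplus>j\<in>{..d}. v l i j \<otimes> coeff P G j)"
    by metis
  \<comment> \<open>A coordinate is a pair of an exponent \<open>i < e\<close> and the index
    \<open>j \<le> d\<close> of a generator.\<close>
  have "\<exists>c. (\<forall>l\<in>{..<T}. c l \<in> carrier R) \<and> (\<exists>l\<in>{..<T}. c l \<notin> M) \<and>
      (\<forall>k\<in>{..<e} \<times> {..d}. (\<Oplus>l\<in>{..<T}. c l \<otimes> v l (fst k) (snd k)) \<in> M)"
    using Tbig v(1) by (intro R.linear_dependence_mod_prime[OF M_prime]) auto
  then obtain c where c: "\<And>l. l < T \<Longrightarrow> c l \<in> carrier R" and c1: "\<exists>l<T. c l \<notin> M"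
      and c2: "\<And>i j. i < e \<Longrightarrow> j \<le> d \<Longrightarrow> (\<Oplus>l\<in>{..<T}. c l \<otimes> v l i j) \<in> M"
    by auto
  define u where "u = (\<Oplus>\<^bsub>P\<^esub> l\<in>{..<T}. monom P (c l) (e + l))"
  have uc: "u \<in> carrier P" unfolding u_def using c by (intro P.finsum_closed) auto
  \<comment> \<open>The exponents \<open>e + l\<close> are distinct, so the \<open>c l\<close>
    appear unchanged as coefficients of \<open>u\<close>, and one of them is outside
    \<open>M\<close>.\<close>
  have "u \<notin> Q"
  proof
    assume u: "u \<in> Q"
    obtain k where k: "k < T" "c k \<notin> M" using c1 by blast
    have "coeff P u (e + k) = (\<Oplus>l\<in>{..<T}. coeff P (monom P (c l) (e + l)) (e + k))"
      unfolding u_def using c by (intro coeff_finsum) auto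
    also have "\<dots> = (\<Oplus>l\<in>{..<T}. if k = l then c l else \<zero>)"
      using c by (intro R.finsum_cong') auto
    also have "\<dots> = c k" using c k by (intro R.finsum_singleton) auto
    finally show False using u k unfolding mem_coeff_ideal_iff by metis
  qed
  define W where "W = (\<Oplus>\<^bsub>P\<^esub> l\<in>{..<T}. monom P (c l) 0 \<otimes>\<^bsub>P\<^esub> w l)"
  have Wc: "W \<in> carrier P" unfolding W_def using c wc by (intro P.finsum_closed) auto
  have idMI: "ideal (M \<cdot> ideal_power R I T) R" by (intro R.ideal_prod_is_ideal M.is_ideal idp)
  \<comment> \<open>Exchanging the two sums collects, at each generator of \<open>I^T\<close>, the
    relation among the coordinates, which lies in \<open>M\<close>.\<close>
  have "coeff P W i \<in> M \<cdot> ideal_power R I T" for i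
  proof -
    have W: "coeff P W i = (\<Oplus>l\<in>{..<T}. c l \<otimes> coeff P (w l) i)"
    proof -
      have "coeff P W i = (\<Oplus>l\<in>{..<T}. coeff P (monom P (c l) 0 \<otimes>\<^bsub>P\<^esub> w l) i)"
        unfolding W_def using c wc by (intro coeff_finsum) auto
      also have "\<dots> = (\<Oplus>l\<in>{..<T}. c l \<otimes> coeff P (w l) i)"
        using c wc by (intro R.finsum_cong') (auto simp: coeff_monom_mult simp del: coeff_mult)
      finally show ?thesis .
    qed
    show ?thesis
    proof (cases "i < e")
      case False
      have "(\<Oplus>l\<in>{..<T}. c l \<otimes> coeff P (w l) i) = (\<Oplus>l\<in>{..<T}. \<zero>)"
        using c w(2) False by (intro R.finsum_cong') auto
      thus ?thesis using W idMI by (simp add: ideal_def additive_subgroup.zero_closed)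
    next
      case True
      have Gcc: "coeff P G j \<in> carrier R" for j using Gc by simp
      have "coeff P W i = (\<Oplus>l\<in>{..<T}. \<Oplus>j\<in>{..d}. c l \<otimes> (v l i j \<otimes> coeff P G j))"
        unfolding W using c v Gcc by (intro R.finsum_cong') (auto simp: R.finsum_rdistr Pi_iff)
      also have "\<dots> = (\<Oplus>j\<in>{..d}. \<Oplus>l\<in>{..<T}. c l \<otimes> (v l i j \<otimes> coeff P G j))"
        using c v Gcc by (intro R.finsum_swap) auto
      also have "\<dots> = (\<Oplus>j\<in>{..d}. (\<Oplus>l\<in>{..<T}. c l \<otimes> v l i j) \<otimes> coeff P G j)"
      proof (rule R.finsum_cong')
        fix j
        have "(\<Oplus>l\<in>{..<T}. c l \<otimes> (v l i j \<otimes> coeff P G j)) = (\<Oplus>l\<in>{..<T}. (c l \<otimes> v l i j) \<otimes> coeff P G j)"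
          using c v Gcc by (intro R.finsum_cong') (auto simp: R.m_assoc)
        also have "\<dots> = (\<Oplus>l\<in>{..<T}. c l \<otimes> v l i j) \<otimes> coeff P G j"
          using c v Gcc by (intro R.finsum_ldistr[symmetric]) auto
        finally show "(\<Oplus>l\<in>{..<T}. c l \<otimes> (v l i j \<otimes> coeff P G j)) = (\<Oplus>l\<in>{..<T}. c l \<otimes> v l i j) \<otimes> coeff P G j" .
      qed (use c v Gcc in \<open>auto intro!: R.finsum_closed R.m_closed\<close>)
      also have "\<dots> \<in> M \<cdot> ideal_power R I T"
        using c2[OF True] GI by (intro R.ideal_finsum_mem[OF idMI] ideal_prod.prod) auto
      finally show ?thesis .
    qed
  qed
  hence "W \<in> coeff_ideal R (M \<cdot> ideal_power R I T)" using Wc by (simp add: mem_coeff_ideal_iff)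
  hence WQ: "W \<in> null_part T"
    using Q_power_subset_null_part[of T] unfolding L_power coeff_ideal_prod[OF M.is_ideal idp] by blast
  have Tc: "a [^]\<^bsub>P\<^esub> T \<in> carrier P" using ac by simp
  have "a [^]\<^bsub>P\<^esub> T \<otimes>\<^bsub>P\<^esub> u \<ominus>\<^bsub>P\<^esub> W
      = (\<Oplus>\<^bsub>P\<^esub> l\<in>{..<T}. monom P (c l) 0 \<otimes>\<^bsub>P\<^esub> (a [^]\<^bsub>P\<^esub> T \<otimes>\<^bsub>P\<^esub> monom P \<one> (e + l) \<ominus>\<^bsub>P\<^esub> w l))"
  proof -
    let ?s = "\<lambda>l. monom P (c l) 0 \<otimes>\<^bsub>P\<^esub> (a [^]\<^bsub>P\<^esub> T \<otimes>\<^bsub>P\<^esub> monom P \<one> (e + l) \<ominus>\<^bsub>P\<^esub> w l)"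
    have sc: "?s \<in> {..<T} \<rightarrow> carrier P" using c wc Tc by auto
    have "a [^]\<^bsub>P\<^esub> T \<otimes>\<^bsub>P\<^esub> u = (\<Oplus>\<^bsub>P\<^esub> l\<in>{..<T}. a [^]\<^bsub>P\<^esub> T \<otimes>\<^bsub>P\<^esub> monom P (c l) (e + l))"
      unfolding u_def using c Tc by (intro P.finsum_rdistr) auto
    also have "\<dots> = (\<Oplus>\<^bsub>P\<^esub> l\<in>{..<T}. ?s l \<oplus>\<^bsub>P\<^esub> monom P (c l) 0 \<otimes>\<^bsub>P\<^esub> w l)"
    proof (rule P.finsum_cong')
      fix l assume "l \<in> {..<T}"
      hence l: "l < T" by simp
      have cm: "monom P (c l) (e + l) = monom P (c l) 0 \<otimes>\<^bsub>P\<^esub> monom P \<one> (e + l)"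
        using monom_mult[of "c l" \<one> 0 "e + l"] c[OF l] by simp
      have identity: "A \<otimes>\<^bsub>P\<^esub> (b \<otimes>\<^bsub>P\<^esub> x) = b \<otimes>\<^bsub>P\<^esub> (A \<otimes>\<^bsub>P\<^esub> x \<ominus>\<^bsub>P\<^esub> y) \<oplus>\<^bsub>P\<^esub> b \<otimes>\<^bsub>P\<^esub> y"
        if "A \<in> carrier P" "x \<in> carrier P" "y \<in> carrier P" "b \<in> carrier P" for A x y b
        using that by algebra
      show "a [^]\<^bsub>P\<^esub> T \<otimes>\<^bsub>P\<^esub> monom P (c l) (e + l) = ?s l \<oplus>\<^bsub>P\<^esub> monom P (c l) 0 \<otimes>\<^bsub>P\<^esub> w l"
        unfolding cm by (rule identity) (use Tc wc(1)[OF l] c[OF l] in auto)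
    qed (use sc c wc in auto)
    also have "\<dots> = (\<Oplus>\<^bsub>P\<^esub> l\<in>{..<T}. ?s l) \<oplus>\<^bsub>P\<^esub> W"
      unfolding W_def using sc c wc by (intro P.finsum_addf) auto
    finally have "a [^]\<^bsub>P\<^esub> T \<otimes>\<^bsub>P\<^esub> u = (\<Oplus>\<^bsub>P\<^esub> l\<in>{..<T}. ?s l) \<oplus>\<^bsub>P\<^esub> W" .
    thus ?thesis using Wc P.finsum_closed[OF sc] by (simp add: P.minus_eq P.a_assoc P.r_neg)
  qed
  also have "\<dots> \<in> E t"
    using w(3) c by (intro P.ideal_finsum_mem[OF E] ideal.I_l_closed[OF E]) auto
  finally obtain z y where zy: "a [^]\<^bsub>P\<^esub> T \<otimes>\<^bsub>P\<^esub> u \<ominus>\<^bsub>P\<^esub> W = z \<oplus>\<^bsub>P\<^esub> y"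
      "z \<in> C \<cdot>\<^bsub>P\<^esub> ideal_power P L t" "y \<in> saturation"
    unfolding E_def P.ideal_sum_iff by blast
  have zc: "z \<in> carrier P" "y \<in> carrier P"
    using zy P.ideal_prod_in_carrier[OF C(1) Lid] by (auto simp: saturation_def)
  have "a [^]\<^bsub>P\<^esub> T \<otimes>\<^bsub>P\<^esub> u = (a [^]\<^bsub>P\<^esub> T \<otimes>\<^bsub>P\<^esub> u \<ominus>\<^bsub>P\<^esub> W) \<oplus>\<^bsub>P\<^esub> W"
    using Tc uc Wc by (simp add: P.minus_eq P.a_assoc P.l_neg)
  also have "\<dots> = z \<oplus>\<^bsub>P\<^esub> (y \<oplus>\<^bsub>P\<^esub> W)" unfolding zy(1) using zc Wc by (simp add: P.a_assoc)
  finally have "a [^]\<^bsub>P\<^esub> Suc t \<otimes>\<^bsub>P\<^esub> u = z \<oplus>\<^bsub>P\<^esub> (y \<oplus>\<^bsub>P\<^esub> W)" unfolding t .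
  moreover have "y \<oplus>\<^bsub>P\<^esub> W \<in> null_part (Suc t)"
    using zy(3) F_subset_null_part WQ unfolding t[symmetric]
    by (intro P.ideal_add_mem[OF null_part_ideal]) auto
  ultimately show ?thesis
    using nilpotent_extend[OF C nil aL _ zy(2)] uc \<open>u \<notin> Q\<close> unfolding a_def by blast
qed

text \<open>Induction from the top coefficient downwards; \<open>deg R f < j + k\<close> is written
  additively to avoid truncated subtraction, and \<open>C\<close> collects the coefficients treated
  so far.\<close>

lemma content_nilpotent: "\<exists>n. ideal_power P L n \<subseteq> fiber_kernel n"
proof -
  have "\<exists>C. ideal C P \<and> C \<subseteq> L \<and> (\<forall>j. deg R f < j + k \<longrightarrow> monom P (coeff P f j) 0 \<in> C) \<and>
      (\<exists>n. ideal_power P C n \<subseteq> fiber_kernel n)" for k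
  proof (induction k)
    case 0
    have "\<zero>\<^bsub>P\<^esub> \<in> L" "\<zero>\<^bsub>P\<^esub> \<in> fiber_kernel (Suc 0)"
      using L_ideal fiber_kernel_ideal by (simp_all add: ideal_def additive_subgroup.zero_closed)
    moreover have "coeff P f j = \<zero>" if "deg R f < j" for j using deg_aboveD[OF that f_closed] .
    \<comment> \<open>The exponent is 1, since the zeroth power of the zero ideal is the whole
      ring.\<close>
    ultimately show ?case
      by (intro exI[of _ "{\<zero>\<^bsub>P\<^esub>}"]) (auto simp: P.zeroideal P.ideal_power_1 intro!: exI[of _ "Suc 0"])
  next
    case (Suc k)
    then obtain C n where C: "ideal C P" "C \<subseteq> L" "ideal_power P C n \<subseteq> fiber_kernel n"
        "\<And>j. deg R f < j + k \<Longrightarrow> monom P (coeff P f j) 0 \<in> C" by blast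
    show ?case
    proof (cases "deg R f < k")
      case True
      thus ?thesis using C by (intro exI[of _ C]) auto
    next
      case False
      define e where "e = deg R f - k"
      have e: "deg R f < j + k \<longleftrightarrow> e < j" "deg R f < j + Suc k \<longleftrightarrow> j = e \<or> e < j" for j
        using False by (auto simp: e_def)
      let ?a = "monom P (coeff P f e) 0"
      have ac: "?a \<in> carrier P" using f_closed by simp
      have aL: "?a \<in> L" by (rule monom_mem_coeff_ideal[OF I_ideal coeff_mem_content[OF f_closed]])
      have ida: "ideal (PIdl\<^bsub>P\<^esub> ?a) P" using ac by (rule P.cgenideal_ideal)
      let ?C = "C <+>\<^bsub>P\<^esub> (PIdl\<^bsub>P\<^esub> ?a)"
      have "ideal ?C P" by (intro P.add_ideals C ida)
      moreover have "?C \<subseteq> L"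
        using C(2) P.cgenideal_minimal[OF L_ideal aL] by (intro P.ideal_sum_least L_ideal)
      moreover have "\<exists>n. ideal_power P ?C n \<subseteq> fiber_kernel n"
        using C e by (intro leading_coeff_nilpotent) auto
      moreover have "monom P (coeff P f j) 0 \<in> ?C" if "deg R f < j + Suc k" for j
        using that C(4)[of j] e[of j] P.ideal_sum_upper[OF C(1) ida] P.cgenideal_self[OF ac] by auto
      ultimately show ?thesis by blast
    qed
  qed
  \<comment> \<open>With \<open>k\<close> one above the degree the condition on \<open>j\<close>
    always holds, so \<open>C\<close> contains every coefficient and hence \<open>L\<close>.\<close>
  from this[of "Suc (deg R f)"] obtain C n where
    C: "ideal C P" "ideal_power P C n \<subseteq> fiber_kernel n" "\<And>j. monom P (coeff P f j) 0 \<in> C" by auto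
  have "L \<subseteq> C" by (rule coeff_ideal_content_subset[OF f_closed C(1,3)])
  hence "ideal_power P L n \<subseteq> fiber_kernel n" using P.ideal_power_mono C(2) by blast
  thus ?thesis ..
qed

text \<open>A power \<open>L^T\<close> that vanishes in the fiber cone satisfies the hypothesis of
  Nakayama's lemma, being generated by the coefficients of a Gaussian \<open>G\<close>. The
  resulting \<open>u\<close> multiplies these coefficients into the saturation, and cancelling a
  nonzero one puts \<open>u\<close> itself there.\<close>

lemma primitive_multiple: "\<exists>u\<in>carrier P - Q. u \<in> saturation"
proof -
  obtain n where n: "ideal_power P L n \<subseteq> fiber_kernel n" using content_nilpotent by blast
  let ?T = "2 ^ n :: nat"
  have nT: "n \<le> ?T" by (simp add: less_imp_le)
  have ker: "ideal_power P L ?T \<subseteq> fiber_kernel ?T"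
    using nilpotent_mono[OF subset_refl L_ideal n nT] .
  obtain G where G: "gaussian R G" "content R G = ideal_power R I ?T"
    using gaussian_content_two_power[OF f_gaussian, of "deg R f" n] by blast
  have Gc: "G \<in> carrier P" using G(1) by (simp add: gaussian_iff)
  let ?H = "(\<lambda>j. monom P (coeff P G j) 0) ` {..deg R G}"
  have Hc: "?H \<subseteq> carrier P" using Gc by auto
  have idH: "ideal (Idl\<^bsub>P\<^esub> ?H) P" using Hc by (rule P.genideal_ideal)
  have "monom P (coeff P G j) 0 \<in> Idl\<^bsub>P\<^esub> ?H" for j
  proof (cases "j \<le> deg R G")
    case True
    thus ?thesis using P.genideal_self[OF Hc] by blast
  next
    case False
    hence "coeff P G j = \<zero>" using Gc by (intro deg_aboveD) auto
    thus ?thesis using idH by (simp add: ideal_def additive_subgroup.zero_closed)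
  qed
  hence "coeff_ideal R (content R G) \<subseteq> Idl\<^bsub>P\<^esub> ?H" by (intro coeff_ideal_content_subset Gc idH)
  hence LH: "ideal_power P L ?T \<subseteq> Idl\<^bsub>P\<^esub> ?H" unfolding L_power G(2) .
  have "null_part ?T \<subseteq> Q \<cdot>\<^bsub>P\<^esub> (Idl\<^bsub>P\<^esub> ?H) <+>\<^bsub>P\<^esub> saturation"
    unfolding null_part_def subset_iff P.ideal_sum_iff
    using P.ideal_prod_mono[OF subset_refl LH] by blast
  moreover have "?H \<subseteq> ideal_power P L ?T"
    unfolding L_power G(2)[symmetric] using content_ideal[OF Gc] coeff_mem_content[OF Gc]
    by (auto intro: monom_mem_coeff_ideal)
  ultimately have "\<exists>u\<in>carrier P - Q. u \<otimes>\<^bsub>P\<^esub> h \<in> Q \<cdot>\<^bsub>P\<^esub> (Idl\<^bsub>P\<^esub> ?H) <+>\<^bsub>P\<^esub> saturation" if "h \<in> ?H" for h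
    using that ker unfolding fiber_kernel_def by blast
  hence "\<exists>u\<in>carrier P - Q. \<forall>h\<in>?H. u \<otimes>\<^bsub>P\<^esub> h \<in> saturation"
    using Hc by (intro P.Nakayama Q_prime saturation_ideal) auto
  then obtain u where u: "u \<in> carrier P - Q" "\<And>j. j \<le> deg R G \<Longrightarrow> u \<otimes>\<^bsub>P\<^esub> monom P (coeff P G j) 0 \<in> saturation"
    by blast
  \<comment> \<open>Its content is a power of \<open>I\<close> and so contains a power of the
    nonzero leading coefficient of \<open>f\<close>.\<close>
  have "G \<noteq> \<zero>\<^bsub>P\<^esub>"
  proof
    assume G0: "G = \<zero>\<^bsub>P\<^esub>"
    have "content R G \<subseteq> {\<zero>}" using G0 by (intro content_least R.zeroideal) auto
    moreover have fc: "coeff P f (deg R f) \<in> carrier R" using f_closed by simp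
    hence "coeff P f (deg R f) [^] ?T \<in> content R G"
      unfolding G(2) using coeff_mem_content[OF f_closed] by (intro R.power_mem_ideal_power)
    ultimately have "coeff P f (deg R f) [^] ?T = \<zero>" by blast
    moreover have "coeff P f (deg R f) \<noteq> \<zero>" by (rule lcoeff_nonzero[OF f_nonzero f_closed])
    moreover have "x [^] k \<noteq> \<zero>" if "x \<in> carrier R" "x \<noteq> \<zero>" for x and k :: nat
      using that by (induction k) (auto simp: R.integral_iff)
    ultimately show False using fc by blast
  qed
  hence "coeff P G (deg R G) \<noteq> \<zero>" using Gc by (intro lcoeff_nonzero)
  hence "u \<in> saturation"
    using saturation_cancel[OF coeff_closed[OF Gc] _ _ u(2)[OF order_refl]] u(1) by blast
  thus ?thesis using u by blast
qed

text \<open>From \<open>b u = f h\<close> with \<open>u\<close> outside \<open>M[X]\<close>, the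
  Gaussian property gives \<open>I c(h) = b c(u)\<close> with \<open>c(u)\<close> not inside
  \<open>M\<close>. Hence \<open>i \<otimes> j = b \<otimes> t\<close> for some \<open>i\<close> in
  \<open>I\<close>, \<open>j\<close> in \<open>c(h)\<close> and \<open>t\<close> outside
  \<open>M\<close>, and \<open>i\<close> generates \<open>I\<close> locally.\<close>

lemma content_principal_at_prime_nonzero:
  "\<exists>a\<in>I. \<forall>y\<in>I. \<exists>t\<in>carrier R - M. \<exists>z\<in>carrier R. t \<otimes> y = a \<otimes> z"
proof -
  interpret M: primeideal M R by (rule M_prime)
  obtain u where u: "u \<in> carrier P" "u \<notin> Q" "u \<in> saturation" using primitive_multiple by blast
  obtain b h where b: "b \<in> carrier R" "b \<noteq> \<zero>" "h \<in> carrier P" "monom P b 0 \<otimes>\<^bsub>P\<^esub> u = f \<otimes>\<^bsub>P\<^esub> h"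
    using u(3) by (rule saturationE)
  obtain k where k: "coeff P u k \<notin> M" using u by (auto simp: mem_coeff_ideal_iff)
  have uk: "coeff P u k \<in> carrier R" using u by simp
  have bu: "coeff P (f \<otimes>\<^bsub>P\<^esub> h) n = b \<otimes> coeff P u n" for n
    unfolding b(4)[symmetric] using b(1) u(1) by (simp add: coeff_monom_mult del: coeff_mult)
  have fh: "f \<otimes>\<^bsub>P\<^esub> h \<in> carrier P" using f_closed b by simp
  have cont: "content R (f \<otimes>\<^bsub>P\<^esub> h) = I \<cdot> content R h"
    using f_gaussian b(3) by (simp add: gaussian_iff)
  have sub: "content R (f \<otimes>\<^bsub>P\<^esub> h) \<subseteq> PIdl b"
  proof (rule content_least[OF R.cgenideal_ideal[OF b(1)]])
    show "coeff P (f \<otimes>\<^bsub>P\<^esub> h) n \<in> PIdl b" for n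
      unfolding bu cgenideal_def using R.m_comm[OF b(1), of "coeff P u n"] u(1) by auto
  qed
  have div: "\<exists>z\<in>carrier R. x = b \<otimes> z" if "x \<in> I \<cdot> content R h" for x
  proof -
    have "x \<in> PIdl b" using that sub unfolding cont by blast
    then obtain z where "z \<in> carrier R" "x = z \<otimes> b" unfolding cgenideal_def by blast
    thus ?thesis using R.m_comm[OF b(1)] by auto
  qed
  have J: "ideal (content R h) R" using b by (intro content_ideal)
  have cancel: "x = y" if "b \<otimes> x = b \<otimes> y" "x \<in> carrier R" "y \<in> carrier R" for x y
    using that b R.m_lcancel by blast
  have "\<exists>i\<in>I. \<exists>j\<in>content R h. \<exists>t\<in>carrier R - M. i \<otimes> j = b \<otimes> t"
  proof (rule ccontr)
    assume neg: "\<not> ?thesis"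
    \<comment> \<open>If every such \<open>t\<close> were in \<open>M\<close>, all of
      \<open>I c(h)\<close> would lie in \<open>b M\<close>, against its element
      \<open>b \<otimes> coeff P u k\<close>.\<close>
    have id: "ideal {b \<otimes> m | m. m \<in> M} R"
    proof (rule R.ideal_if_closed)
      show "{b \<otimes> m | m. m \<in> M} \<subseteq> carrier R" using b M.Icarr by auto
      have "\<zero> = b \<otimes> \<zero>" using b by simp
      thus "\<zero> \<in> {b \<otimes> m | m. m \<in> M}" using M.zero_closed by blast
    next
      fix x y assume "x \<in> {b \<otimes> m | m. m \<in> M}" "y \<in> {b \<otimes> m | m. m \<in> M}"
      then obtain m m' where "x = b \<otimes> m" "m \<in> M" "y = b \<otimes> m'" "m' \<in> M" by blast
      thus "x \<oplus> y \<in> {b \<otimes> m | m. m \<in> M}"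
        using b M.Icarr by (intro CollectI exI[of _ "m \<oplus> m'"]) (simp add: R.r_distr)
    next
      fix r x assume r: "r \<in> carrier R" and "x \<in> {b \<otimes> m | m. m \<in> M}"
      then obtain m where m: "x = b \<otimes> m" "m \<in> M" by blast
      hence "r \<otimes> x = b \<otimes> (r \<otimes> m)" using M.Icarr r b by (simp add: R.m_lcomm)
      moreover have "r \<otimes> m \<in> M" using m r M.I_l_closed by blast
      ultimately show "r \<otimes> x \<in> {b \<otimes> m | m. m \<in> M}" by blast
    qed
    have "I \<cdot> content R h \<subseteq> {b \<otimes> m | m. m \<in> M}"
    proof (rule R.ideal_prod_least[OF id])
      fix i j assume ij: "i \<in> I" "j \<in> content R h"
      obtain z where z: "z \<in> carrier R" "i \<otimes> j = b \<otimes> z" using div[OF ideal_prod.prod[OF ij]] by blast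
      hence "z \<in> M" using neg ij by blast
      thus "i \<otimes> j \<in> {b \<otimes> m | m. m \<in> M}" using z by blast
    qed
    moreover have "b \<otimes> coeff P u k \<in> I \<cdot> content R h"
      using coeff_mem_content[OF fh, of k] unfolding cont bu .
    ultimately obtain m where m: "b \<otimes> coeff P u k = b \<otimes> m" "m \<in> M" by blast
    hence "coeff P u k = m" using cancel uk M.Icarr by metis
    thus False using m k by simp
  qed
  then obtain i j t where ij: "i \<in> I" "j \<in> content R h" "t \<in> carrier R - M" "i \<otimes> j = b \<otimes> t" by blast
  have c: "i \<in> carrier R" "j \<in> carrier R" using ij ideal.Icarr[OF I_ideal] ideal.Icarr[OF J] by auto
  have "\<exists>t\<in>carrier R - M. \<exists>z\<in>carrier R. t \<otimes> y = i \<otimes> z" if y: "y \<in> I" for y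
  proof -
    have yc: "y \<in> carrier R" using y ideal.Icarr[OF I_ideal] by blast
    obtain z where z: "z \<in> carrier R" "y \<otimes> j = b \<otimes> z" using div[OF ideal_prod.prod[OF y ij(2)]] by blast
    have tc: "t \<in> carrier R" using ij by blast
    \<comment> \<open>Regroup \<open>i \<otimes> j \<otimes> y\<close> by means of
      \<open>i \<otimes> j = b \<otimes> t\<close> and \<open>y \<otimes> j = b \<otimes> z\<close>;
      the common factor \<open>b\<close> cancels in the domain.\<close>
    have "b \<otimes> (t \<otimes> y) = (i \<otimes> j) \<otimes> y" unfolding ij(4) using tc yc b by (simp add: R.m_assoc)
    also have "\<dots> = i \<otimes> (y \<otimes> j)" using c yc by (simp add: R.m_ac)
    also have "\<dots> = b \<otimes> (i \<otimes> z)" unfolding z(2) using c b z by (simp add: R.m_ac)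
    finally have "t \<otimes> y = i \<otimes> z" by (rule cancel) (use tc yc c z in auto)
    thus ?thesis using ij z by blast
  qed
  thus ?thesis using ij(1) by blast
qed

end

text \<open>The theorem of Loper and Roitman in elementwise form, at an arbitrary prime so as to fit
  the contracted ideals of \<open>prime_fst_vimage\<close>. The zero polynomial, with generator
  \<open>\<zero>\<close>, is set apart because the saturation argument uses a nonzero leading
  coefficient.\<close>

theorem (in UP_domain) content_principal_at_prime:
  assumes "gaussian R f" "primeideal M R"
  shows "\<exists>a\<in>content R f. \<forall>y\<in>content R f. \<exists>t\<in>carrier R - M. \<exists>z\<in>carrier R. t \<otimes> y = a \<otimes> z"
proof (cases "f = \<zero>\<^bsub>P\<^esub>")
  case True
  interpret M: primeideal M R by fact
  have "content R f \<subseteq> {\<zero>}" using True by (intro content_least R.zeroideal) auto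
  moreover have "\<zero> \<in> content R f" using True coeff_mem_content[of f 0] by auto
  moreover have "\<one> \<notin> M" using M.I_notcarr M.one_imp_carrier by blast
  ultimately have "\<exists>t\<in>carrier R - M. \<exists>z\<in>carrier R. t \<otimes> y = \<zero> \<otimes> z" if "y \<in> content R f" for y
    using that by (intro bexI[of _ \<one>] bexI[of _ \<zero>]) auto
  thus ?thesis using \<open>\<zero> \<in> content R f\<close> by blast
next
  case False
  interpret gaussian_at_prime R P f M
    by (intro gaussian_at_prime.intro gaussian_at_prime_axioms.intro UP_domain_axioms assms
        False[unfolded P_def]) (fact P_def)
  show ?thesis by (rule content_principal_at_prime_nonzero)
qed

section \<open>Locally principal ideals\<close>

text \<open>Removes the fractions: a generator \<open>a / s\<close> may be replaced by
  \<open>a / 1\<close>, and \<open>y / 1\<close> being a multiple of it means, after clearing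
  denominators, that \<open>t \<otimes> y\<close> is a multiple of \<open>a\<close> for some
  \<open>t\<close> in \<open>S\<close>.\<close>

lemma (in mult_set) localized_principal_iff:
  assumes "ideal I R"
  shows "principalideal (localized_ideal R S I) (localization R S) \<longleftrightarrow>
    (\<exists>a\<in>I. \<forall>y\<in>I. \<exists>t\<in>S. \<exists>z\<in>carrier R. t \<otimes> y = a \<otimes> z)"
    (is "principalideal ?J ?L \<longleftrightarrow> ?rhs")
proof
  interpret I: ideal I R by fact
  interpret L: cring ?L by (rule localization_cring)
  interpret J: ideal ?J ?L by (rule localized_ideal_ideal[OF assms])
  {
    assume "principalideal ?J ?L"
    then obtain g where g: "g \<in> carrier ?L" "?J = Idl\<^bsub>?L\<^esub> {g}"
      unfolding principalideal_def principalideal_axioms_def by blast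
    hence J: "?J = PIdl\<^bsub>?L\<^esub> g" by (simp add: L.cgenideal_eq_genideal)
    hence "g \<in> ?J" using L.cgenideal_self[OF g(1)] by simp
    then obtain a s where a: "g = loc_frac R S a s" "a \<in> I" "s \<in> S" by (auto simp: localized_ideal_def)
    have ac: "a \<in> carrier R" using a I.Icarr by blast
    have "\<exists>t\<in>S. \<exists>z\<in>carrier R. t \<otimes> y = a \<otimes> z" if y: "y \<in> I" for y
    proof -
      have yc: "y \<in> carrier R" using y I.Icarr by blast
      have "loc_frac R S y \<one> \<in> PIdl\<^bsub>?L\<^esub> g"
        unfolding J[symmetric] localized_ideal_def using y S_one by blast
      then obtain x where x: "x \<in> carrier ?L" "loc_frac R S y \<one> = x \<otimes>\<^bsub>?L\<^esub> g"
        unfolding cgenideal_def by blast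
      then obtain z v where z: "x = loc_frac R S z v" "z \<in> carrier R" "v \<in> S"
        by (auto simp: localization_carrier)
      have "loc_frac R S y \<one> = loc_frac R S (z \<otimes> a) (v \<otimes> s)"
        using x z a ac by (simp add: localization_mult)
      then obtain t where t: "t \<in> S" "t \<otimes> ((v \<otimes> s) \<otimes> y) = t \<otimes> (\<one> \<otimes> (z \<otimes> a))"
        using frac_eq_iff[of y \<one> "z \<otimes> a" "v \<otimes> s"] yc z ac a S_one S_mult by auto
      have c: "t \<in> carrier R" "v \<in> carrier R" "s \<in> carrier R" using t z a by auto
      have "(t \<otimes> (v \<otimes> s)) \<otimes> y = t \<otimes> ((v \<otimes> s) \<otimes> y)" using c yc by (simp add: m_assoc)
      also have "\<dots> = a \<otimes> (t \<otimes> z)" unfolding t(2) using c z ac by (simp add: m_ac)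
      finally show ?thesis using c t z a S_mult by blast
    qed
    thus ?rhs using a by blast
  }
  assume ?rhs
  then obtain a where a: "a \<in> I" "\<And>y. y \<in> I \<Longrightarrow> \<exists>t\<in>S. \<exists>z\<in>carrier R. t \<otimes> y = a \<otimes> z" by blast
  have ac: "a \<in> carrier R" using a I.Icarr by blast
  let ?g = "loc_frac R S a \<one>"
  have g: "?g \<in> carrier ?L" using ac S_one by blast
  have "?J = PIdl\<^bsub>?L\<^esub> ?g"
  proof
    have "?g \<in> ?J" unfolding localized_ideal_def using a S_one by blast
    thus "PIdl\<^bsub>?L\<^esub> ?g \<subseteq> ?J" by (rule L.cgenideal_minimal[OF J.ideal_axioms])
    show "?J \<subseteq> PIdl\<^bsub>?L\<^esub> ?g"
    proof
      fix x assume "x \<in> ?J"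
      then obtain y s where x: "x = loc_frac R S y s" "y \<in> I" "s \<in> S" by (auto simp: localized_ideal_def)
      obtain t z where t: "t \<in> S" "z \<in> carrier R" "t \<otimes> y = a \<otimes> z" using a(2)[OF x(2)] by blast
      have c: "y \<in> carrier R" "t \<in> carrier R" "s \<in> carrier R" using x t I.Icarr by auto
      have "(t \<otimes> s) \<otimes> y = s \<otimes> (t \<otimes> y)" using c by (simp add: m_ac)
      also have "\<dots> = s \<otimes> (z \<otimes> a)" unfolding t(3) using c t ac by (simp add: m_comm)
      finally have "x = loc_frac R S (z \<otimes> a) (t \<otimes> s)"
        unfolding x(1) using c t x ac S_mult by (intro frac_eqI) auto
      also have "\<dots> = loc_frac R S z (t \<otimes> s) \<otimes>\<^bsub>?L\<^esub> ?g"
        using t x c ac S_one S_mult by (simp add: localization_mult)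
      finally show "x \<in> PIdl\<^bsub>?L\<^esub> ?g" unfolding cgenideal_def using t x S_mult by blast
    qed
  qed
  thus "principalideal ?J ?L"
    using g L.cgenideal_is_principalideal by simp
qed

lemma (in cring) locally_principal_iff:
  assumes "ideal I R"
  shows "locally_principal R I \<longleftrightarrow>
    (\<forall>M. maximalideal M R \<longrightarrow> (\<exists>a\<in>I. \<forall>y\<in>I. \<exists>t\<in>carrier R - M. \<exists>z\<in>carrier R. t \<otimes> y = a \<otimes> z))"
  unfolding locally_principal_def
  using mult_set.localized_principal_iff[OF maximalideal_mult_set assms] by blast

section \<open>Polynomials over trivial ring extensions\<close>

context module
begin

abbreviation "T \<equiv> triv_ext R M"

lemma carrier_triv_ext: "carrier T = carrier R \<times> carrier M"
  and mult_triv_ext: "(a, x) \<otimes>\<^bsub>T\<^esub> (b, y) = (a \<otimes> b, a \<odot>\<^bsub>M\<^esub> y \<oplus>\<^bsub>M\<^esub> b \<odot>\<^bsub>M\<^esub> x)"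
  and add_triv_ext: "(a, x) \<oplus>\<^bsub>T\<^esub> (b, y) = (a \<oplus> b, x \<oplus>\<^bsub>M\<^esub> y)"
  and zero_triv_ext: "\<zero>\<^bsub>T\<^esub> = (\<zero>, \<zero>\<^bsub>M\<^esub>)"
  and one_triv_ext: "\<one>\<^bsub>T\<^esub> = (\<one>, \<zero>\<^bsub>M\<^esub>)"
  by (simp_all add: triv_ext_def)

lemmas triv_ext_simps = carrier_triv_ext mult_triv_ext add_triv_ext zero_triv_ext one_triv_ext

interpretation T: cring T
  by (rule triv_ext_cring) (rule module_axioms)

interpretation PR: UP_cring R "UP R"
  by (rule UP_cring.intro) (rule R.cring_axioms)

interpretation PT: UP_cring T "UP T"
  by (rule UP_cring.intro) (rule T.cring_axioms)

lemma finsum_triv_ext: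
  assumes "finite S" "h \<in> S \<rightarrow> carrier T"
  shows "finsum T h S = ((\<Oplus>i\<in>S. fst (h i)), (\<Oplus>\<^bsub>M\<^esub>i\<in>S. snd (h i)))"
  using assms
proof (induction S rule: finite_induct)
  case (insert s S)
  have "h s \<in> carrier T" "h \<in> S \<rightarrow> carrier T" using insert.prems by auto
  moreover have "(\<lambda>i. fst (h i)) \<in> insert s S \<rightarrow> carrier R" "(\<lambda>i. snd (h i)) \<in> insert s S \<rightarrow> carrier M"
    using insert.prems by (force simp: carrier_triv_ext)+
  ultimately show ?case
    using insert by (cases "h s") (auto simp: add_triv_ext)
qed (simp add: zero_triv_ext)

lemma finsum_smult_rdistr:
  assumes "finite S" "c \<in> S \<rightarrow> carrier R" "x \<in> carrier M"
  shows "(\<Oplus>i\<in>S. c i) \<odot>\<^bsub>M\<^esub> x = (\<Oplus>\<^bsub>M\<^esub>i\<in>S. c i \<odot>\<^bsub>M\<^esub> x)"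
  using assms(1,2)
proof (induction S rule: finite_induct)
  case (insert s S)
  hence "c s \<in> carrier R" "c \<in> S \<rightarrow> carrier R" by auto
  moreover from this have "(\<lambda>i. c i \<odot>\<^bsub>M\<^esub> x) \<in> S \<rightarrow> carrier M" using assms(3) by auto
  ultimately show ?case using insert assms(3) by (simp add: smult_l_distr)
qed (simp add: assms(3))

section \<open>Ideals of the trivial extension\<close>

lemma ideal_fst_vimage:
  assumes "ideal N T"
  shows "ideal {a \<in> carrier R. (a, \<zero>\<^bsub>M\<^esub>) \<in> N} R"
proof (rule R.ideal_if_closed)
  interpret N: ideal N T by fact
  show "\<zero> \<in> {a \<in> carrier R. (a, \<zero>\<^bsub>M\<^esub>) \<in> N}" using N.zero_closed by (simp add: zero_triv_ext)
  fix a b assume "a \<in> {a \<in> carrier R. (a, \<zero>\<^bsub>M\<^esub>) \<in> N}" "b \<in> {a \<in> carrier R. (a, \<zero>\<^bsub>M\<^esub>) \<in> N}"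
  thus "a \<oplus> b \<in> {a \<in> carrier R. (a, \<zero>\<^bsub>M\<^esub>) \<in> N}"
    using N.a_closed[of "(a, \<zero>\<^bsub>M\<^esub>)" "(b, \<zero>\<^bsub>M\<^esub>)"] by (simp add: add_triv_ext)
next
  interpret N: ideal N T by fact
  fix r a assume "r \<in> carrier R" "a \<in> {a \<in> carrier R. (a, \<zero>\<^bsub>M\<^esub>) \<in> N}"
  thus "r \<otimes> a \<in> {a \<in> carrier R. (a, \<zero>\<^bsub>M\<^esub>) \<in> N}"
    using N.I_l_closed[of "(a, \<zero>\<^bsub>M\<^esub>)" "(r, \<zero>\<^bsub>M\<^esub>)"] by (simp add: triv_ext_simps)
qed auto

lemma ideal_Times_module:
  assumes "ideal I R"
  shows "ideal (I \<times> carrier M) T"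
proof (rule T.ideal_if_closed)
  interpret I: ideal I R by fact
  show "I \<times> carrier M \<subseteq> carrier T" "\<zero>\<^bsub>T\<^esub> \<in> I \<times> carrier M"
    by (auto simp: triv_ext_simps)
  fix x y assume "x \<in> I \<times> carrier M" "y \<in> I \<times> carrier M"
  thus "x \<oplus>\<^bsub>T\<^esub> y \<in> I \<times> carrier M" by (auto simp: triv_ext_simps)
next
  interpret I: ideal I R by fact
  fix r x assume "r \<in> carrier T" "x \<in> I \<times> carrier M"
  thus "r \<otimes>\<^bsub>T\<^esub> x \<in> I \<times> carrier M" by (auto simp: triv_ext_simps I.I_l_closed)
qed

lemma ideal_smult_vimage:
  assumes "ideal N T" "\<beta> \<in> carrier M"
  shows "ideal {a \<in> carrier R. (\<zero>, a \<odot>\<^bsub>M\<^esub> \<beta>) \<in> N} R"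
proof (rule R.ideal_if_closed)
  interpret N: ideal N T by fact
  show "\<zero> \<in> {a \<in> carrier R. (\<zero>, a \<odot>\<^bsub>M\<^esub> \<beta>) \<in> N}"
    using N.zero_closed assms(2) by (simp add: zero_triv_ext)
  fix a b assume "a \<in> {a \<in> carrier R. (\<zero>, a \<odot>\<^bsub>M\<^esub> \<beta>) \<in> N}" "b \<in> {a \<in> carrier R. (\<zero>, a \<odot>\<^bsub>M\<^esub> \<beta>) \<in> N}"
  thus "a \<oplus> b \<in> {a \<in> carrier R. (\<zero>, a \<odot>\<^bsub>M\<^esub> \<beta>) \<in> N}"
    using N.a_closed[of "(\<zero>, a \<odot>\<^bsub>M\<^esub> \<beta>)" "(\<zero>, b \<odot>\<^bsub>M\<^esub> \<beta>)"] assms(2)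
    by (simp add: add_triv_ext smult_l_distr)
next
  interpret N: ideal N T by fact
  fix r a assume "r \<in> carrier R" "a \<in> {a \<in> carrier R. (\<zero>, a \<odot>\<^bsub>M\<^esub> \<beta>) \<in> N}"
  thus "r \<otimes> a \<in> {a \<in> carrier R. (\<zero>, a \<odot>\<^bsub>M\<^esub> \<beta>) \<in> N}"
    using N.I_l_closed[of "(\<zero>, a \<odot>\<^bsub>M\<^esub> \<beta>)" "(r, \<zero>\<^bsub>M\<^esub>)"] assms(2)
    by (simp add: triv_ext_simps smult_assoc1)
qed auto

text \<open>Elements with first component zero multiply to zero, so a multiplier
  \<open>(c, e)\<close> acts on them through \<open>c\<close> alone.\<close>

lemma ideal_smult_image:
  assumes "ideal I R" "\<beta> \<in> carrier M"
  shows "ideal ((\<lambda>a. (\<zero>, a \<odot>\<^bsub>M\<^esub> \<beta>)) ` I) T"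
proof (rule T.ideal_if_closed)
  interpret I: ideal I R by fact
  show "(\<lambda>a. (\<zero>, a \<odot>\<^bsub>M\<^esub> \<beta>)) ` I \<subseteq> carrier T" using assms(2) by (auto simp: carrier_triv_ext)
  show "\<zero>\<^bsub>T\<^esub> \<in> (\<lambda>a. (\<zero>, a \<odot>\<^bsub>M\<^esub> \<beta>)) ` I"
    using assms(2) by (intro image_eqI[of _ _ \<zero>]) (simp_all add: zero_triv_ext)
  fix x y assume "x \<in> (\<lambda>a. (\<zero>, a \<odot>\<^bsub>M\<^esub> \<beta>)) ` I" "y \<in> (\<lambda>a. (\<zero>, a \<odot>\<^bsub>M\<^esub> \<beta>)) ` I"
  then obtain a b where ab: "x = (\<zero>, a \<odot>\<^bsub>M\<^esub> \<beta>)" "y = (\<zero>, b \<odot>\<^bsub>M\<^esub> \<beta>)" "a \<in> I" "b \<in> I" by blast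
  thus "x \<oplus>\<^bsub>T\<^esub> y \<in> (\<lambda>a. (\<zero>, a \<odot>\<^bsub>M\<^esub> \<beta>)) ` I"
    using assms(2) by (intro image_eqI[of _ _ "a \<oplus> b"]) (simp_all add: add_triv_ext smult_l_distr)
next
  interpret I: ideal I R by fact
  fix r x assume r: "r \<in> carrier T" and "x \<in> (\<lambda>a. (\<zero>, a \<odot>\<^bsub>M\<^esub> \<beta>)) ` I"
  then obtain a c e where a: "x = (\<zero>, a \<odot>\<^bsub>M\<^esub> \<beta>)" "a \<in> I" "r = (c, e)" "c \<in> carrier R" "e \<in> carrier M"
    by (auto simp: carrier_triv_ext)
  thus "r \<otimes>\<^bsub>T\<^esub> x \<in> (\<lambda>a. (\<zero>, a \<odot>\<^bsub>M\<^esub> \<beta>)) ` I"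
    using assms(2) by (intro image_eqI[of _ _ "c \<otimes> a"]) (simp_all add: mult_triv_ext smult_assoc1 I.I_l_closed)
qed

text \<open>Contraction along the ring homomorphism \<open>a \<mapsto> (a, 0)\<close>, by which the
  theorem over domains is applied at a maximal ideal of the extension.\<close>

lemma prime_fst_vimage:
  assumes "maximalideal N T"
  shows "primeideal {a \<in> carrier R. (a, \<zero>\<^bsub>M\<^esub>) \<in> N} R"
proof (rule primeidealI[OF ideal_fst_vimage R.cring_axioms])
  interpret N: primeideal N T by (rule T.maximalideal_prime[OF assms])
  show "ideal N T" by (rule N.is_ideal)
  have "\<one>\<^bsub>T\<^esub> \<notin> N" using N.I_notcarr N.one_imp_carrier by blast
  hence "\<one> \<notin> {a \<in> carrier R. (a, \<zero>\<^bsub>M\<^esub>) \<in> N}" by (simp add: one_triv_ext)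
  thus "carrier R \<noteq> {a \<in> carrier R. (a, \<zero>\<^bsub>M\<^esub>) \<in> N}" by blast
  fix a b assume ab: "a \<in> carrier R" "b \<in> carrier R" "a \<otimes> b \<in> {a \<in> carrier R. (a, \<zero>\<^bsub>M\<^esub>) \<in> N}"
  hence "(a, \<zero>\<^bsub>M\<^esub>) \<otimes>\<^bsub>T\<^esub> (b, \<zero>\<^bsub>M\<^esub>) \<in> N" by (simp add: mult_triv_ext)
  hence "(a, \<zero>\<^bsub>M\<^esub>) \<in> N \<or> (b, \<zero>\<^bsub>M\<^esub>) \<in> N" using ab by (intro N.I_prime) (auto simp: carrier_triv_ext)
  thus "a \<in> {a \<in> carrier R. (a, \<zero>\<^bsub>M\<^esub>) \<in> N} \<or> b \<in> {a \<in> carrier R. (a, \<zero>\<^bsub>M\<^esub>) \<in> N}"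
    using ab by blast
qed

text \<open>An ideal above \<open>I \<times> carrier M\<close> contains all \<open>(0, x)\<close>,
  so it is determined by its first components and corresponds to an ideal of the base above
  \<open>I\<close>.\<close>

lemma maximal_Times_module:
  assumes "maximalideal I R"
  shows "maximalideal (I \<times> carrier M) T"
proof (rule maximalidealI)
  interpret I: maximalideal I R by fact
  show "ideal (I \<times> carrier M) T" by (rule ideal_Times_module[OF I.is_ideal])
  have "\<one> \<notin> I" using I.I_notcarr I.one_imp_carrier by blast
  hence "\<one>\<^bsub>T\<^esub> \<notin> I \<times> carrier M" by (simp add: one_triv_ext)
  thus "carrier T \<noteq> I \<times> carrier M" by auto
  fix J assume J: "ideal J T" "I \<times> carrier M \<subseteq> J" "J \<subseteq> carrier T"
  interpret J: ideal J T by fact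
  let ?J = "{a \<in> carrier R. (a, \<zero>\<^bsub>M\<^esub>) \<in> J}"
  have zero: "(\<zero>, x) \<in> J" if "x \<in> carrier M" for x using that J(2) by auto
  have mem: "(a, x) \<in> J \<longleftrightarrow> a \<in> ?J" if ax: "a \<in> carrier R" "x \<in> carrier M" for a x
  proof
    assume "(a, x) \<in> J"
    hence "(a, x) \<oplus>\<^bsub>T\<^esub> (\<zero>, \<ominus>\<^bsub>M\<^esub> x) \<in> J" using zero ax by (intro J.a_closed) auto
    thus "a \<in> ?J" using ax by (simp add: add_triv_ext M.r_neg)
  next
    assume "a \<in> ?J"
    hence "(a, \<zero>\<^bsub>M\<^esub>) \<oplus>\<^bsub>T\<^esub> (\<zero>, x) \<in> J" using zero ax by (intro J.a_closed) auto
    thus "(a, x) \<in> J" using ax by (simp add: add_triv_ext)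
  qed
  have "I \<subseteq> ?J" using J(2) I.Icarr by auto
  hence "?J = I \<or> ?J = carrier R"
    by (intro I.I_maximal ideal_fst_vimage J) auto
  thus "J = I \<times> carrier M \<or> J = carrier T"
  proof
    assume e: "?J = I"
    have "(a, x) \<in> J \<longleftrightarrow> (a, x) \<in> I \<times> carrier M" for a x
    proof (cases "a \<in> carrier R \<and> x \<in> carrier M")
      case True
      thus ?thesis using mem[of a x] e by auto
    next
      case False
      thus ?thesis using J(3) I.Icarr by (auto simp: carrier_triv_ext)
    qed
    thus ?thesis by auto
  next
    assume e: "?J = carrier R"
    have "carrier T \<subseteq> J" using mem e by (auto simp: carrier_triv_ext)
    thus ?thesis using J(3) by blast
  qed
qed

section \<open>Polynomials over the trivial extension compared with those over the base\<close>

definition smult_poly :: "(nat \<Rightarrow> 'a) \<Rightarrow> 'c \<Rightarrow> nat \<Rightarrow> 'a \<times> 'c"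
  where "smult_poly f \<beta> n = (\<zero>, coeff (UP R) f n \<odot>\<^bsub>M\<^esub> \<beta>)"

definition base_poly :: "(nat \<Rightarrow> 'a) \<Rightarrow> nat \<Rightarrow> 'a \<times> 'c"
  where "base_poly g n = (coeff (UP R) g n, \<zero>\<^bsub>M\<^esub>)"

definition fst_poly :: "(nat \<Rightarrow> 'a \<times> 'c) \<Rightarrow> nat \<Rightarrow> 'a"
  where "fst_poly G n = fst (coeff (UP T) G n)"

lemma smult_poly:
  assumes "f \<in> carrier (UP R)" "\<beta> \<in> carrier M"
  shows smult_poly_closed: "smult_poly f \<beta> \<in> carrier (UP T)"
    and coeff_smult_poly: "coeff (UP T) (smult_poly f \<beta>) n = (\<zero>, coeff (UP R) f n \<odot>\<^bsub>M\<^esub> \<beta>)"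
proof -
  have 1: "smult_poly f \<beta> k \<in> carrier T" for k
    using assms PR.coeff_closed by (simp add: smult_poly_def carrier_triv_ext)
  have 2: "smult_poly f \<beta> k = \<zero>\<^bsub>T\<^esub>" if "deg R f < k" for k
    using PR.deg_aboveD[OF that assms(1)] assms(2) by (simp add: smult_poly_def zero_triv_ext)
  show "smult_poly f \<beta> \<in> carrier (UP T)"
    using PT.polynomial_from_coeffs(1)[of "smult_poly f \<beta>" "deg R f", OF 1 2] .
  show "coeff (UP T) (smult_poly f \<beta>) n = (\<zero>, coeff (UP R) f n \<odot>\<^bsub>M\<^esub> \<beta>)"
    using PT.polynomial_from_coeffs(2)[of "smult_poly f \<beta>" "deg R f" n, OF 1 2]
    unfolding smult_poly_def[of f \<beta> n] .
qed

lemma base_poly: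
  assumes "g \<in> carrier (UP R)"
  shows base_poly_closed: "base_poly g \<in> carrier (UP T)"
    and coeff_base_poly: "coeff (UP T) (base_poly g) n = (coeff (UP R) g n, \<zero>\<^bsub>M\<^esub>)"
proof -
  have 1: "base_poly g k \<in> carrier T" for k
    using assms PR.coeff_closed by (simp add: base_poly_def carrier_triv_ext)
  have 2: "base_poly g k = \<zero>\<^bsub>T\<^esub>" if "deg R g < k" for k
    using PR.deg_aboveD[OF that assms(1)] by (simp add: base_poly_def zero_triv_ext)
  show "base_poly g \<in> carrier (UP T)"
    using PT.polynomial_from_coeffs(1)[of "base_poly g" "deg R g", OF 1 2] .
  show "coeff (UP T) (base_poly g) n = (coeff (UP R) g n, \<zero>\<^bsub>M\<^esub>)"
    using PT.polynomial_from_coeffs(2)[of "base_poly g" "deg R g" n, OF 1 2]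
    unfolding base_poly_def[of g n] .
qed

lemma coeff_triv_ext_closed:
  assumes "G \<in> carrier (UP T)"
  shows "fst (coeff (UP T) G n) \<in> carrier R" "snd (coeff (UP T) G n) \<in> carrier M"
  using PT.coeff_closed[OF assms, of n] by (auto simp: carrier_triv_ext mem_Times_iff)

lemma fst_poly:
  assumes "G \<in> carrier (UP T)"
  shows fst_poly_closed: "fst_poly G \<in> carrier (UP R)"
    and coeff_fst_poly: "coeff (UP R) (fst_poly G) n = fst (coeff (UP T) G n)"
proof -
  have 1: "fst_poly G k \<in> carrier R" for k
    using coeff_triv_ext_closed(1)[OF assms] by (simp add: fst_poly_def)
  have 2: "fst_poly G k = \<zero>" if "deg T G < k" for k
    using PT.deg_aboveD[OF that assms(1)] by (simp add: fst_poly_def zero_triv_ext)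
  show "fst_poly G \<in> carrier (UP R)"
    using PR.polynomial_from_coeffs(1)[of "fst_poly G" "deg T G", OF 1 2] .
  show "coeff (UP R) (fst_poly G) n = fst (coeff (UP T) G n)"
    using PR.polynomial_from_coeffs(2)[of "fst_poly G" "deg T G" n, OF 1 2]
    unfolding fst_poly_def[of G n] .
qed

lemma fst_base_poly: "g \<in> carrier (UP R) \<Longrightarrow> fst_poly (base_poly g) = g"
  by (rule PR.up_eqI) (simp_all add: fst_poly base_poly)

lemma coeff_mult_triv_ext:
  assumes "F \<in> carrier (UP T)" "G \<in> carrier (UP T)"
  shows "coeff (UP T) (F \<otimes>\<^bsub>UP T\<^esub> G) n =
    ((\<Oplus>i\<in>{..n}. fst (coeff (UP T) F i) \<otimes> fst (coeff (UP T) G (n - i))),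
     (\<Oplus>\<^bsub>M\<^esub>i\<in>{..n}. fst (coeff (UP T) F i) \<odot>\<^bsub>M\<^esub> snd (coeff (UP T) G (n - i)) \<oplus>\<^bsub>M\<^esub>
        fst (coeff (UP T) G (n - i)) \<odot>\<^bsub>M\<^esub> snd (coeff (UP T) F i)))"
proof -
  have m: "x \<otimes>\<^bsub>T\<^esub> y = (fst x \<otimes> fst y, fst x \<odot>\<^bsub>M\<^esub> snd y \<oplus>\<^bsub>M\<^esub> fst y \<odot>\<^bsub>M\<^esub> snd x)" for x y
    by (cases x; cases y) (simp add: mult_triv_ext)
  have c: "(\<lambda>i. coeff (UP T) F i \<otimes>\<^bsub>T\<^esub> coeff (UP T) G (n - i)) \<in> {..n} \<rightarrow> carrier T"
    using PT.coeff_closed[OF assms(1)] PT.coeff_closed[OF assms(2)] by simp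
  show ?thesis
    unfolding PT.coeff_mult[OF assms] finsum_triv_ext[OF finite_atMost c] by (simp add: m)
qed

lemma fst_poly_mult:
  assumes "F \<in> carrier (UP T)" "G \<in> carrier (UP T)"
  shows "fst_poly (F \<otimes>\<^bsub>UP T\<^esub> G) = fst_poly F \<otimes>\<^bsub>UP R\<^esub> fst_poly G"
  by (rule PR.up_eqI)
     (use assms in \<open>simp_all add: fst_poly coeff_mult_triv_ext PT.UP_mult_closed PR.UP_mult_closed del: PT.coeff_mult\<close>)

text \<open>As second components multiply to zero, only the first component of \<open>G\<close>
  contributes.\<close>

lemma smult_poly_mult:
  assumes f: "f \<in> carrier (UP R)" and G: "G \<in> carrier (UP T)" and \<beta>: "\<beta> \<in> carrier M"
  shows "smult_poly f \<beta> \<otimes>\<^bsub>UP T\<^esub> G = smult_poly (f \<otimes>\<^bsub>UP R\<^esub> fst_poly G) \<beta>"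
proof (rule PT.up_eqI)
  fix n
  note c = coeff_triv_ext_closed[OF G] PR.coeff_closed[OF f]
  have g: "fst_poly G \<in> carrier (UP R)" using G by (rule fst_poly_closed)
  have fg: "f \<otimes>\<^bsub>UP R\<^esub> fst_poly G \<in> carrier (UP R)" using f g by (rule PR.UP_mult_closed)
  have "(\<Oplus>i\<in>{..n}. \<zero> \<otimes> fst (coeff (UP T) G (n - i))) = \<zero>"
    using c by (intro R.add.finprod_one_eqI) simp
  moreover have "(\<Oplus>\<^bsub>M\<^esub>i\<in>{..n}. \<zero> \<odot>\<^bsub>M\<^esub> snd (coeff (UP T) G (n - i)) \<oplus>\<^bsub>M\<^esub>
        fst (coeff (UP T) G (n - i)) \<odot>\<^bsub>M\<^esub> (coeff (UP R) f i \<odot>\<^bsub>M\<^esub> \<beta>))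
      = (\<Oplus>\<^bsub>M\<^esub>i\<in>{..n}. (coeff (UP R) f i \<otimes> fst (coeff (UP T) G (n - i))) \<odot>\<^bsub>M\<^esub> \<beta>)"
    using c \<beta> by (intro M.finsum_cong') (auto simp: smult_assoc1[symmetric] R.m_comm)
  moreover have "\<dots> = (\<Oplus>i\<in>{..n}. coeff (UP R) f i \<otimes> fst (coeff (UP T) G (n - i))) \<odot>\<^bsub>M\<^esub> \<beta>"
    using c \<beta> by (intro finsum_smult_rdistr[symmetric]) auto
  ultimately show "coeff (UP T) (smult_poly f \<beta> \<otimes>\<^bsub>UP T\<^esub> G) n = coeff (UP T) (smult_poly (f \<otimes>\<^bsub>UP R\<^esub> fst_poly G) \<beta>) n"
    unfolding coeff_mult_triv_ext[OF smult_poly_closed[OF f \<beta>] G] coeff_smult_poly[OF f \<beta>]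
      coeff_smult_poly[OF fg \<beta>] PR.coeff_mult[OF f g] coeff_fst_poly[OF G] by simp
qed (use assms in \<open>simp_all add: PT.UP_mult_closed PR.UP_mult_closed smult_poly_closed fst_poly_closed\<close>)

lemma content_smult_poly:
  assumes f: "f \<in> carrier (UP R)" and \<beta>: "\<beta> \<in> carrier M"
  shows "content T (smult_poly f \<beta>) = (\<lambda>a. (\<zero>, a \<odot>\<^bsub>M\<^esub> \<beta>)) ` content R f"
proof
  note F = smult_poly_closed[OF f \<beta>]
  show "content T (smult_poly f \<beta>) \<subseteq> (\<lambda>a. (\<zero>, a \<odot>\<^bsub>M\<^esub> \<beta>)) ` content R f"
    using PR.coeff_mem_content[OF f]
    by (intro PT.content_least ideal_smult_image PR.content_ideal f \<beta>) (simp add: coeff_smult_poly[OF f \<beta>])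
  have "content R f \<subseteq> {a \<in> carrier R. (\<zero>, a \<odot>\<^bsub>M\<^esub> \<beta>) \<in> content T (smult_poly f \<beta>)}"
    using PT.coeff_mem_content[OF F] PR.coeff_closed[OF f]
    by (intro PR.content_least ideal_smult_vimage PT.content_ideal F \<beta>) (simp add: coeff_smult_poly[OF f \<beta>])
  thus "(\<lambda>a. (\<zero>, a \<odot>\<^bsub>M\<^esub> \<beta>)) ` content R f \<subseteq> content T (smult_poly f \<beta>)" by blast
qed

text \<open>A multiple of \<open>smult_poly f \<beta>\<close> is again of this form, with
  \<open>f\<close> times a base polynomial, so \<open>a \<mapsto> (0, a \<beta>)\<close> carries
  over the Gaussian property of \<open>f\<close>.\<close>

lemma gaussian_smult_poly:
  assumes "gaussian R f" and \<beta>: "\<beta> \<in> carrier M"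
  shows "gaussian T (smult_poly f \<beta>)"
proof (rule PT.gaussianI)
  have f: "f \<in> carrier (UP R)" using assms(1) by (simp add: PR.gaussian_iff)
  show "smult_poly f \<beta> \<in> carrier (UP T)" using f \<beta> by (rule smult_poly_closed)
  fix G i j assume G: "G \<in> carrier (UP T)"
  note g = fst_poly_closed[OF G]
  note c = coeff_triv_ext_closed[OF G] PR.coeff_closed[OF f]
  have "coeff (UP R) f i \<otimes> coeff (UP R) (fst_poly G) j \<in> content R (f \<otimes>\<^bsub>UP R\<^esub> fst_poly G)"
    using assms(1) g PR.coeff_mem_content[OF f] PR.coeff_mem_content[OF g]
    by (auto simp: PR.gaussian_iff intro: ideal_prod.prod)
  hence "(\<zero>, (coeff (UP R) f i \<otimes> fst (coeff (UP T) G j)) \<odot>\<^bsub>M\<^esub> \<beta>) \<in> content T (smult_poly f \<beta> \<otimes>\<^bsub>UP T\<^esub> G)"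
    unfolding smult_poly_mult[OF f G \<beta>] content_smult_poly[OF PR.UP_mult_closed[OF f g] \<beta>]
      coeff_fst_poly[OF G] by blast
  moreover have "coeff (UP T) (smult_poly f \<beta>) i \<otimes>\<^bsub>T\<^esub> coeff (UP T) G j
      = (\<zero>, (coeff (UP R) f i \<otimes> fst (coeff (UP T) G j)) \<odot>\<^bsub>M\<^esub> \<beta>)"
    using c(1,2)[of j] c(3)[of i] \<beta> by (cases "coeff (UP T) G j")
      (simp add: coeff_smult_poly[OF f \<beta>] mult_triv_ext smult_assoc1[symmetric] R.m_comm)
  ultimately show "coeff (UP T) (smult_poly f \<beta>) i \<otimes>\<^bsub>T\<^esub> coeff (UP T) G j \<in> content T (smult_poly f \<beta> \<otimes>\<^bsub>UP T\<^esub> G)"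
    by simp
qed

text \<open>Test against polynomials \<open>(g, 0)\<close> from the base; injectivity of
  \<open>a \<mapsto> a \<beta>\<close> brings the membership back to \<open>R\<close>.\<close>

lemma gaussian_smult_polyD:
  assumes F: "gaussian T (smult_poly f \<beta>)" and f: "f \<in> carrier (UP R)" and \<beta>: "\<beta> \<in> carrier M"
    and inj: "\<And>a b. a \<in> carrier R \<Longrightarrow> b \<in> carrier R \<Longrightarrow> a \<odot>\<^bsub>M\<^esub> \<beta> = b \<odot>\<^bsub>M\<^esub> \<beta> \<Longrightarrow> a = b"
  shows "gaussian R f"
proof (rule PR.gaussianI[OF f])
  fix g i j assume g: "g \<in> carrier (UP R)"
  note G = base_poly_closed[OF g]
  note c = PR.coeff_closed[OF f, of i] PR.coeff_closed[OF g, of j]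
  have fg: "f \<otimes>\<^bsub>UP R\<^esub> g \<in> carrier (UP R)" using f g by (rule PR.UP_mult_closed)
  have "coeff (UP T) (smult_poly f \<beta>) i \<otimes>\<^bsub>T\<^esub> coeff (UP T) (base_poly g) j
      \<in> content T (smult_poly f \<beta> \<otimes>\<^bsub>UP T\<^esub> base_poly g)"
    using F G PT.coeff_mem_content[OF smult_poly_closed[OF f \<beta>]] PT.coeff_mem_content[OF G]
    by (auto simp: PT.gaussian_iff intro: ideal_prod.prod)
  also have "coeff (UP T) (smult_poly f \<beta>) i \<otimes>\<^bsub>T\<^esub> coeff (UP T) (base_poly g) j
      = (\<zero>, (coeff (UP R) f i \<otimes> coeff (UP R) g j) \<odot>\<^bsub>M\<^esub> \<beta>)"
    using c \<beta> by (simp add: coeff_smult_poly[OF f \<beta>] coeff_base_poly[OF g] mult_triv_ext smult_assoc1[symmetric] R.m_comm)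
  also have "content T (smult_poly f \<beta> \<otimes>\<^bsub>UP T\<^esub> base_poly g) = (\<lambda>a. (\<zero>, a \<odot>\<^bsub>M\<^esub> \<beta>)) ` content R (f \<otimes>\<^bsub>UP R\<^esub> g)"
    unfolding smult_poly_mult[OF f G \<beta>] fst_base_poly[OF g] by (rule content_smult_poly[OF fg \<beta>])
  finally obtain a where a: "a \<in> content R (f \<otimes>\<^bsub>UP R\<^esub> g)"
      "(coeff (UP R) f i \<otimes> coeff (UP R) g j) \<odot>\<^bsub>M\<^esub> \<beta> = a \<odot>\<^bsub>M\<^esub> \<beta>" by auto
  moreover have "a \<in> carrier R" using a ideal.Icarr[OF PR.content_ideal[OF fg]] by blast
  ultimately have "coeff (UP R) f i \<otimes> coeff (UP R) g j = a" using c by (intro inj) auto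
  thus "coeff (UP R) f i \<otimes> coeff (UP R) g j \<in> content R (f \<otimes>\<^bsub>UP R\<^esub> g)" using a by simp
qed

lemma content_subset_fst_poly:
  assumes "F \<in> carrier (UP T)"
  shows "content T F \<subseteq> content R (fst_poly F) \<times> carrier M"
proof (rule PT.content_least)
  note f = fst_poly_closed[OF assms]
  show "ideal (content R (fst_poly F) \<times> carrier M) T" by (intro ideal_Times_module PR.content_ideal f)
  show "coeff (UP T) F n \<in> content R (fst_poly F) \<times> carrier M" for n
    using PR.coeff_mem_content[OF f, of n] coeff_triv_ext_closed[OF assms, of n]
    by (simp add: coeff_fst_poly[OF assms] mem_Times_iff)
qed

lemma gaussian_fst_poly:
  assumes "gaussian T F"
  shows "gaussian R (fst_poly F)"
proof -
  have F: "F \<in> carrier (UP T)" using assms by (simp add: PT.gaussian_iff)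
  show ?thesis
  proof (rule PR.gaussianI[OF fst_poly_closed[OF F]])
    fix g i j assume g: "g \<in> carrier (UP R)"
    note G = base_poly_closed[OF g]
    have "coeff (UP T) F i \<otimes>\<^bsub>T\<^esub> coeff (UP T) (base_poly g) j \<in> content T (F \<otimes>\<^bsub>UP T\<^esub> base_poly g)"
      using assms G PT.coeff_mem_content[OF F] PT.coeff_mem_content[OF G]
      by (auto simp: PT.gaussian_iff intro: ideal_prod.prod)
    also have "\<dots> \<subseteq> content R (fst_poly F \<otimes>\<^bsub>UP R\<^esub> g) \<times> carrier M"
      using content_subset_fst_poly[OF PT.UP_mult_closed[OF F G]]
      unfolding fst_poly_mult[OF F G] fst_base_poly[OF g] .
    finally show "coeff (UP R) (fst_poly F) i \<otimes> coeff (UP R) g j \<in> content R (fst_poly F \<otimes>\<^bsub>UP R\<^esub> g)"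
      by (cases "coeff (UP T) F i") (simp add: coeff_fst_poly[OF F] coeff_base_poly[OF g] mult_triv_ext)
  qed
qed

text \<open>An element \<open>\<beta>\<close> with injective \<open>a \<mapsto> a \<beta>\<close>
  turns Gaussian polynomials over \<open>R\<close> into Gaussian ones over the extension. Local
  principality at \<open>N \<times> carrier M\<close> is then read off in the second
  component.\<close>

theorem pseudo_arithmetical_triv_extD:
  assumes T: "pseudo_arithmetical T" and \<beta>: "\<beta> \<in> carrier M"
    and inj: "\<And>a b. a \<in> carrier R \<Longrightarrow> b \<in> carrier R \<Longrightarrow> a \<odot>\<^bsub>M\<^esub> \<beta> = b \<odot>\<^bsub>M\<^esub> \<beta> \<Longrightarrow> a = b"
  shows "pseudo_arithmetical R"
  unfolding pseudo_arithmetical_def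
proof (intro conjI allI impI R.cring_axioms)
  fix f assume gf: "gaussian R f"
  hence f: "f \<in> carrier (UP R)" by (simp add: PR.gaussian_iff)
  let ?F = "smult_poly f \<beta>"
  have idf: "ideal (content R f) R" using f by (rule PR.content_ideal)
  have idF: "ideal (content T ?F) T" by (intro PT.content_ideal smult_poly_closed f \<beta>)
  have lp: "locally_principal T (content T ?F)"
    using T gaussian_smult_poly[OF gf \<beta>] unfolding pseudo_arithmetical_def by blast
  show "locally_principal R (content R f)"
    unfolding R.locally_principal_iff[OF idf]
  proof (intro allI impI)
    fix N assume N: "maximalideal N R"
    obtain x where x: "x \<in> content T ?F"
        "\<And>y. y \<in> content T ?F \<Longrightarrow> \<exists>t\<in>carrier T - N \<times> carrier M. \<exists>z\<in>carrier T. t \<otimes>\<^bsub>T\<^esub> y = x \<otimes>\<^bsub>T\<^esub> z"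
      using lp[unfolded T.locally_principal_iff[OF idF]] maximal_Times_module[OF N] by blast
    obtain a where a: "a \<in> content R f" "x = (\<zero>, a \<odot>\<^bsub>M\<^esub> \<beta>)"
      using x(1) unfolding content_smult_poly[OF f \<beta>] by blast
    have ac: "a \<in> carrier R" using a ideal.Icarr[OF idf] by blast
    have "\<exists>t\<in>carrier R - N. \<exists>z\<in>carrier R. t \<otimes> y = a \<otimes> z" if y: "y \<in> content R f" for y
    proof -
      have yc: "y \<in> carrier R" using y ideal.Icarr[OF idf] by blast
      have "(\<zero>, y \<odot>\<^bsub>M\<^esub> \<beta>) \<in> content T ?F" unfolding content_smult_poly[OF f \<beta>] using y by blast
      then obtain t z where tz: "t \<in> carrier T - N \<times> carrier M" "z \<in> carrier T"
          "t \<otimes>\<^bsub>T\<^esub> (\<zero>, y \<odot>\<^bsub>M\<^esub> \<beta>) = x \<otimes>\<^bsub>T\<^esub> z"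
        using x(2) by blast
      obtain t1 t2 z1 z2 where t: "t = (t1, t2)" "t1 \<in> carrier R" "t2 \<in> carrier M" "t1 \<notin> N"
          "z = (z1, z2)" "z1 \<in> carrier R" "z2 \<in> carrier M"
        using tz(1,2) by (auto simp: carrier_triv_ext)
      have "(t1 \<otimes> y) \<odot>\<^bsub>M\<^esub> \<beta> = (a \<otimes> z1) \<odot>\<^bsub>M\<^esub> \<beta>"
        using tz(3) t ac yc \<beta> unfolding a(2) by (simp add: mult_triv_ext smult_assoc1 R.m_comm[of a])
      hence "t1 \<otimes> y = a \<otimes> z1" using t ac yc by (intro inj) auto
      thus ?thesis using t by blast
    qed
    thus "\<exists>a\<in>content R f. \<forall>y\<in>content R f. \<exists>t\<in>carrier R - N. \<exists>z\<in>carrier R. t \<otimes> y = a \<otimes> z"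
      using a(1) by blast
  qed
qed

text \<open>The hypotheses on \<open>M\<close> are those satisfied by the quotient field:
  torsion-free, divisible, and every finite set inside one cyclic submodule. If the first component
  of \<open>F\<close> vanishes, \<open>F\<close> is \<open>smult_poly f \<beta>\<close> for a common
  generator \<open>\<beta>\<close>; otherwise divisibility forces all \<open>(0, x)\<close> into the
  content and only the first component matters.\<close>

theorem pseudo_arithmetical_triv_ext:
  assumes dom: "domain R"
    and torsion_free: "\<And>a x. a \<in> carrier R \<Longrightarrow> x \<in> carrier M \<Longrightarrow> a \<odot>\<^bsub>M\<^esub> x = \<zero>\<^bsub>M\<^esub> \<Longrightarrow> a = \<zero> \<or> x = \<zero>\<^bsub>M\<^esub>"
    and divisible: "\<And>a x. a \<in> carrier R \<Longrightarrow> a \<noteq> \<zero> \<Longrightarrow> x \<in> carrier M \<Longrightarrow> \<exists>y\<in>carrier M. a \<odot>\<^bsub>M\<^esub> y = x"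
    and common_generator: "\<And>X. finite X \<Longrightarrow> X \<subseteq> carrier M \<Longrightarrow>
      \<exists>\<beta>\<in>carrier M. \<beta> \<noteq> \<zero>\<^bsub>M\<^esub> \<and> (\<forall>x\<in>X. \<exists>a\<in>carrier R. x = a \<odot>\<^bsub>M\<^esub> \<beta>)"
  shows "pseudo_arithmetical T"
  unfolding pseudo_arithmetical_def
proof (intro conjI allI impI T.cring_axioms)
  interpret D: UP_domain R "UP R" by (rule UP_domain.intro[OF dom])
  fix F assume gF: "gaussian T F"
  hence F: "F \<in> carrier (UP T)" by (simp add: PT.gaussian_iff)
  have idF: "ideal (content T F) T" using F by (rule PT.content_ideal)
  note c = coeff_triv_ext_closed[OF F]
  show "locally_principal T (content T F)"
    unfolding T.locally_principal_iff[OF idF]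
  proof (intro allI impI)
    fix N assume N: "maximalideal N T"
    let ?p = "{a \<in> carrier R. (a, \<zero>\<^bsub>M\<^esub>) \<in> N}"
    have p: "primeideal ?p R" by (rule prime_fst_vimage[OF N])
    have tN: "(t, \<zero>\<^bsub>M\<^esub>) \<in> carrier T - N" if "t \<in> carrier R - ?p" for t
      using that by (auto simp: carrier_triv_ext)
    show "\<exists>x\<in>content T F. \<forall>y\<in>content T F. \<exists>t\<in>carrier T - N. \<exists>z\<in>carrier T. t \<otimes>\<^bsub>T\<^esub> y = x \<otimes>\<^bsub>T\<^esub> z"
    proof (cases "\<forall>n. fst (coeff (UP T) F n) = \<zero>")
      case True
      \<comment> \<open>A common generator of the finitely many second components; being nonzero, it
        makes \<open>a \<mapsto> a \<beta>\<close> injective.\<close>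
      obtain \<beta> where \<beta>: "\<beta> \<in> carrier M" "\<beta> \<noteq> \<zero>\<^bsub>M\<^esub>"
          "\<And>n. n \<le> deg T F \<Longrightarrow> \<exists>a\<in>carrier R. snd (coeff (UP T) F n) = a \<odot>\<^bsub>M\<^esub> \<beta>"
      proof -
        have "(\<lambda>n. snd (coeff (UP T) F n)) ` {..deg T F} \<subseteq> carrier M" using c by blast
        from common_generator[OF _ this] show ?thesis using that by auto
      qed
      have inj: "a = b" if ab: "a \<in> carrier R" "b \<in> carrier R" "a \<odot>\<^bsub>M\<^esub> \<beta> = b \<odot>\<^bsub>M\<^esub> \<beta>" for a b
      proof -
        have "(a \<ominus> b) \<odot>\<^bsub>M\<^esub> \<beta> = \<zero>\<^bsub>M\<^esub>"
          using ab \<beta> by (simp add: R.minus_eq smult_l_distr smult_l_minus M.r_neg)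
        hence "a \<ominus> b = \<zero>" using torsion_free[of "a \<ominus> b" \<beta>] ab \<beta> by auto
        thus ?thesis using ab by simp
      qed
      obtain h where h: "\<And>n. n \<le> deg T F \<Longrightarrow> h n \<in> carrier R \<and> snd (coeff (UP T) F n) = h n \<odot>\<^bsub>M\<^esub> \<beta>"
        using \<beta>(3) by metis
      \<comment> \<open>The coefficients are cut off above the degree of \<open>F\<close>, where
        nothing is known about \<open>h\<close>.\<close>
      define f where "f = (\<lambda>n. if n \<le> deg T F then h n else \<zero>)"
      have f1: "f k \<in> carrier R" for k using h by (simp add: f_def)
      have f2: "f k = \<zero>" if "deg T F < k" for k using that by (simp add: f_def)
      have f: "f \<in> carrier (UP R)" by (rule PR.polynomial_from_coeffs(1)[of f "deg T F", OF f1 f2])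
      have fn: "coeff (UP R) f n = f n" for n
        by (rule PR.polynomial_from_coeffs(2)[of f "deg T F", OF f1 f2])
      have Feq: "F = smult_poly f \<beta>"
      proof (rule PT.up_eqI[OF _ F smult_poly_closed[OF f \<beta>(1)]])
        fix n
        have "snd (coeff (UP T) F n) = f n \<odot>\<^bsub>M\<^esub> \<beta>"
        proof (cases "n \<le> deg T F")
          case False
          hence "coeff (UP T) F n = \<zero>\<^bsub>T\<^esub>" using F by (intro PT.deg_aboveD) auto
          thus ?thesis using False \<beta>(1) by (simp add: f_def zero_triv_ext)
        qed (use h in \<open>simp add: f_def\<close>)
        thus "coeff (UP T) F n = coeff (UP T) (smult_poly f \<beta>) n"
          using True by (simp add: coeff_smult_poly[OF f \<beta>(1)] fn prod_eq_iff)
      qed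
      have gf: "gaussian R f"
        using gF inj unfolding Feq by (rule gaussian_smult_polyD[OF _ f \<beta>(1)])
      obtain a where a: "a \<in> content R f"
          "\<And>y. y \<in> content R f \<Longrightarrow> \<exists>t\<in>carrier R - ?p. \<exists>z\<in>carrier R. t \<otimes> y = a \<otimes> z"
        using D.content_principal_at_prime[OF gf p] by blast
      have ac: "a \<in> carrier R" using a ideal.Icarr[OF PR.content_ideal[OF f]] by blast
      have "\<exists>t\<in>carrier T - N. \<exists>z\<in>carrier T. t \<otimes>\<^bsub>T\<^esub> y = (\<zero>, a \<odot>\<^bsub>M\<^esub> \<beta>) \<otimes>\<^bsub>T\<^esub> z"
        if y: "y \<in> content T F" for y
      proof -
        obtain y' where y': "y = (\<zero>, y' \<odot>\<^bsub>M\<^esub> \<beta>)" "y' \<in> content R f"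
          using y unfolding Feq content_smult_poly[OF f \<beta>(1)] by blast
        have yc: "y' \<in> carrier R" using y' ideal.Icarr[OF PR.content_ideal[OF f]] by blast
        obtain t z where t: "t \<in> carrier R - ?p" "z \<in> carrier R" "t \<otimes> y' = a \<otimes> z" using a(2)[OF y'(2)] by blast
        have tc: "t \<in> carrier R" using t by blast
        have "t \<odot>\<^bsub>M\<^esub> (y' \<odot>\<^bsub>M\<^esub> \<beta>) = z \<odot>\<^bsub>M\<^esub> (a \<odot>\<^bsub>M\<^esub> \<beta>)"
          using t tc yc ac \<beta>(1) by (simp add: smult_assoc1[symmetric] R.m_comm[of z])
        hence "(t, \<zero>\<^bsub>M\<^esub>) \<otimes>\<^bsub>T\<^esub> y = (\<zero>, a \<odot>\<^bsub>M\<^esub> \<beta>) \<otimes>\<^bsub>T\<^esub> (z, \<zero>\<^bsub>M\<^esub>)"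
          unfolding y'(1) using tc t(2) yc ac \<beta>(1) by (simp add: mult_triv_ext)
        moreover have "(z, \<zero>\<^bsub>M\<^esub>) \<in> carrier T" using t(2) by (simp add: carrier_triv_ext)
        ultimately show ?thesis using tN[OF t(1)] by blast
      qed
      moreover have "(\<zero>, a \<odot>\<^bsub>M\<^esub> \<beta>) \<in> content T F"
        unfolding Feq content_smult_poly[OF f \<beta>(1)] using a(1) by blast
      ultimately show ?thesis by blast
    next
      case False
      then obtain k where k: "fst (coeff (UP T) F k) \<noteq> \<zero>" by blast
      let ?f = "fst_poly F"
      note f = fst_poly_closed[OF F]
      have idf: "ideal (content R ?f) R" using f by (rule PR.content_ideal)
      obtain a where a: "a \<in> content R ?f"
          "\<And>y. y \<in> content R ?f \<Longrightarrow> \<exists>t\<in>carrier R - ?p. \<exists>z\<in>carrier R. t \<otimes> y = a \<otimes> z"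
        using D.content_principal_at_prime[OF gaussian_fst_poly[OF gF] p] by blast
      have ac: "a \<in> carrier R" using a ideal.Icarr[OF idf] by blast
      \<comment> \<open>Otherwise some \<open>t\<close> outside the prime, hence nonzero, would
        annihilate the nonzero first component of the \<open>k\<close>-th coefficient.\<close>
      have "a \<noteq> \<zero>"
      proof
        assume a0: "a = \<zero>"
        have "fst (coeff (UP T) F k) \<in> content R ?f"
          using PR.coeff_mem_content[OF f, of k] unfolding coeff_fst_poly[OF F] .
        then obtain t z where t: "t \<in> carrier R - ?p" "z \<in> carrier R" "t \<otimes> fst (coeff (UP T) F k) = a \<otimes> z"
          using a(2) by blast
        have "t \<otimes> fst (coeff (UP T) F k) = \<zero>" using t a0 by simp
        hence "t = \<zero>" using t k c(1)[of k] domain.integral[OF dom] by blast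
        moreover have "\<zero> \<in> ?p"
          using additive_subgroup.zero_closed[OF ideal.axioms(1)[OF primeideal.axioms(1)[OF p]]] .
        ultimately show False using t by blast
      qed
      \<comment> \<open>Divide \<open>x\<close> by the nonzero first component of the
        \<open>k\<close>-th coefficient and multiply that coefficient by
        \<open>(\<zero>, y)\<close>.\<close>
      have zero: "(\<zero>, x) \<in> content T F" if x: "x \<in> carrier M" for x
      proof -
        obtain y where y: "y \<in> carrier M" "fst (coeff (UP T) F k) \<odot>\<^bsub>M\<^esub> y = x"
          using divisible[OF c(1) k x] by blast
        have "coeff (UP T) F k \<otimes>\<^bsub>T\<^esub> (\<zero>, y) \<in> content T F"
          using y by (intro ideal.I_r_closed[OF idF] PT.coeff_mem_content F) (simp add: carrier_triv_ext)
        moreover have "coeff (UP T) F k \<otimes>\<^bsub>T\<^esub> (\<zero>, y) = (\<zero>, x)"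
          using y c[of k] x by (cases "coeff (UP T) F k") (simp add: mult_triv_ext)
        ultimately show ?thesis by simp
      qed
      \<comment> \<open>With all \<open>(\<zero>, x)\<close> in the content, the second components
        of the coefficients can be subtracted away.\<close>
      have "content R ?f \<subseteq> {x \<in> carrier R. (x, \<zero>\<^bsub>M\<^esub>) \<in> content T F}"
      proof (rule PR.content_least[OF ideal_fst_vimage[OF idF]])
        fix n
        have "coeff (UP T) F n \<oplus>\<^bsub>T\<^esub> (\<zero>, \<ominus>\<^bsub>M\<^esub> snd (coeff (UP T) F n)) \<in> content T F"
          using c by (intro T.ideal_add_mem[OF idF] PT.coeff_mem_content F zero) auto
        moreover have "coeff (UP T) F n \<oplus>\<^bsub>T\<^esub> (\<zero>, \<ominus>\<^bsub>M\<^esub> snd (coeff (UP T) F n)) = (fst (coeff (UP T) F n), \<zero>\<^bsub>M\<^esub>)"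
          using c[of n] by (cases "coeff (UP T) F n") (simp add: add_triv_ext M.r_neg)
        ultimately show "coeff (UP R) ?f n \<in> {x \<in> carrier R. (x, \<zero>\<^bsub>M\<^esub>) \<in> content T F}"
          using c by (simp add: coeff_fst_poly[OF F])
      qed
      hence aF: "(a, \<zero>\<^bsub>M\<^esub>) \<in> content T F" using a(1) by blast
      have "\<exists>t\<in>carrier T - N. \<exists>z\<in>carrier T. t \<otimes>\<^bsub>T\<^esub> y = (a, \<zero>\<^bsub>M\<^esub>) \<otimes>\<^bsub>T\<^esub> z" if y: "y \<in> content T F" for y
      proof -
        obtain y1 y2 where y12: "y = (y1, y2)" "y1 \<in> content R ?f" "y2 \<in> carrier M"
          using y content_subset_fst_poly[OF F] by blast
        have yc: "y1 \<in> carrier R" using y12 ideal.Icarr[OF idf] by blast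
        obtain t z where t: "t \<in> carrier R - ?p" "z \<in> carrier R" "t \<otimes> y1 = a \<otimes> z" using a(2)[OF y12(2)] by blast
        have tc: "t \<in> carrier R" using t by blast
        \<comment> \<open>Divisibility by the nonzero \<open>a\<close> takes care of the second
          component of \<open>y\<close>.\<close>
        obtain w where w: "w \<in> carrier M" "a \<odot>\<^bsub>M\<^esub> w = t \<odot>\<^bsub>M\<^esub> y2"
          using divisible[OF ac \<open>a \<noteq> \<zero>\<close>, of "t \<odot>\<^bsub>M\<^esub> y2"] tc y12 by auto
        have "(t, \<zero>\<^bsub>M\<^esub>) \<otimes>\<^bsub>T\<^esub> y = (a, \<zero>\<^bsub>M\<^esub>) \<otimes>\<^bsub>T\<^esub> (z, w)"
          unfolding y12(1) using tc t yc ac w y12 by (simp add: mult_triv_ext)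
        moreover have "(z, w) \<in> carrier T" using t w by (simp add: carrier_triv_ext)
        ultimately show ?thesis using tN[OF t(1)] by blast
      qed
      thus ?thesis using aF by blast
    qed
  qed
qed

end

section \<open>Quotient fields and ring extensions as modules\<close>

lemma (in field) common_denominator:
  assumes A: "subdomain A R" and frac: "\<And>x. x \<in> carrier R \<Longrightarrow> \<exists>a\<in>A. \<exists>b\<in>A - {\<zero>}. x = a \<otimes> inv b"
    and "finite X" "X \<subseteq> carrier R"
  shows "\<exists>b\<in>A - {\<zero>}. \<forall>x\<in>X. x \<otimes> b \<in> A"
  using assms(3,4)
proof (induction X rule: finite_induct)
  case empty
  show ?case using subdomainE(3,8)[OF A] by auto
next
  case (insert x X)
  note E = subdomainE[OF A]
  obtain b where b: "b \<in> A - {\<zero>}" "\<forall>x\<in>X. x \<otimes> b \<in> A" using insert by auto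
  obtain a d where d: "a \<in> A" "d \<in> A - {\<zero>}" "x = a \<otimes> inv d" using frac insert.prems by blast
  have c: "a \<in> carrier R" "b \<in> carrier R" "d \<in> carrier R" "d \<in> Units R"
    using b d E(1) field_Units by auto
  have "x \<otimes> (d \<otimes> b) = a \<otimes> (inv d \<otimes> d) \<otimes> b"
    unfolding d(3) using c Units_inv_closed[OF c(4)] by (simp add: m_assoc del: Units_l_inv)
  hence "x \<otimes> (d \<otimes> b) = a \<otimes> b" using c by simp
  hence "x \<otimes> (d \<otimes> b) \<in> A" using E(6) b d by auto
  moreover have "y \<otimes> (d \<otimes> b) \<in> A" if y: "y \<in> X" for y
  proof -
    have "y \<in> carrier R" using y insert.prems by blast
    hence "y \<otimes> (d \<otimes> b) = d \<otimes> (y \<otimes> b)" using c by (simp add: m_lcomm)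
    thus ?thesis using b d y E(6) by auto
  qed
  moreover have "d \<otimes> b \<in> A - {\<zero>}" using b d c E(6) integral_iff[of d b] by auto
  ultimately show ?case by auto
qed

lemma pseudo_arithmetical_quotient_field:
  assumes "is_quotient_field A K"
  shows "pseudo_arithmetical (triv_ext (K\<lparr>carrier := A\<rparr>) (self_module K))"
proof -
  interpret K: field K using assms by (simp add: is_quotient_field_def)
  have A: "subdomain A K" using assms by (simp add: is_quotient_field_def)
  have sub: "A \<subseteq> carrier K" using A by (rule subdomainE(1))
  have "subring A K" using A by (simp add: subdomain_def subcring_def)
  then interpret module "K\<lparr>carrier := A\<rparr>" "self_module K"
    by (rule self_module_module[OF K.cring_axioms])
  have frac: "\<exists>a\<in>A. \<exists>b\<in>A - {\<zero>\<^bsub>K\<^esub>}. x = a \<otimes>\<^bsub>K\<^esub> inv\<^bsub>K\<^esub> b" if "x \<in> carrier K" for x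
    using assms that by (auto simp: is_quotient_field_def)
  show ?thesis
  proof (rule pseudo_arithmetical_triv_ext)
    show "domain (K\<lparr>carrier := A\<rparr>)" using A K.subdomain_iff[OF sub] by blast
  next
    fix a x
    assume "a \<in> carrier (K\<lparr>carrier := A\<rparr>)" "x \<in> carrier (self_module K)"
      "a \<odot>\<^bsub>self_module K\<^esub> x = \<zero>\<^bsub>self_module K\<^esub>"
    thus "a = \<zero>\<^bsub>K\<lparr>carrier := A\<rparr>\<^esub> \<or> x = \<zero>\<^bsub>self_module K\<^esub>"
      using sub K.integral by (auto simp: self_module_def)
  next
    fix a x
    assume "a \<in> carrier (K\<lparr>carrier := A\<rparr>)" "a \<noteq> \<zero>\<^bsub>K\<lparr>carrier := A\<rparr>\<^esub>" "x \<in> carrier (self_module K)"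
    hence a: "a \<in> carrier K" "a \<in> Units K" "x \<in> carrier K"
      using sub K.field_Units by (auto simp: self_module_def)
    hence "a \<otimes>\<^bsub>K\<^esub> (inv\<^bsub>K\<^esub> a \<otimes>\<^bsub>K\<^esub> x) = x" by (simp add: K.m_assoc[symmetric])
    thus "\<exists>y\<in>carrier (self_module K). a \<odot>\<^bsub>self_module K\<^esub> y = x"
      using a by (intro bexI[of _ "inv\<^bsub>K\<^esub> a \<otimes>\<^bsub>K\<^esub> x"]) (auto simp: self_module_def)
  next
    fix X assume X: "finite X" "X \<subseteq> carrier (self_module K)"
    \<comment> \<open>With a common denominator \<open>b\<close> of the elements of
      \<open>X\<close>, its inverse generates a cyclic module containing all of them.\<close>
    obtain b where b: "b \<in> A - {\<zero>\<^bsub>K\<^esub>}" "\<forall>x\<in>X. x \<otimes>\<^bsub>K\<^esub> b \<in> A"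
      using K.common_denominator[OF A frac X(1)] X(2) by (auto simp: self_module_def)
    have u: "b \<in> Units K" "b \<in> carrier K" using b sub K.field_Units by auto
    have "x = (x \<otimes>\<^bsub>K\<^esub> b) \<otimes>\<^bsub>K\<^esub> inv\<^bsub>K\<^esub> b" if "x \<in> X" for x
      using that X u by (auto simp: self_module_def K.m_assoc)
    moreover have "inv\<^bsub>K\<^esub> b \<noteq> \<zero>\<^bsub>K\<^esub>" using K.Units_r_inv[OF u(1)] u(2) K.one_not_zero by auto
    ultimately show "\<exists>\<beta>\<in>carrier (self_module K). \<beta> \<noteq> \<zero>\<^bsub>self_module K\<^esub> \<and>
        (\<forall>x\<in>X. \<exists>a\<in>carrier (K\<lparr>carrier := A\<rparr>). x = a \<odot>\<^bsub>self_module K\<^esub> \<beta>)"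
      using u b(2) by (intro bexI[of _ "inv\<^bsub>K\<^esub> b"]) (auto simp: self_module_def)
  qed
qed

lemma pseudo_arithmetical_subring:
  assumes B: "cring B" and A: "subring A B"
    and T: "pseudo_arithmetical (triv_ext (B\<lparr>carrier := A\<rparr>) (self_module B))"
  shows "pseudo_arithmetical (B\<lparr>carrier := A\<rparr>)"
proof -
  interpret B: cring B by fact
  interpret module "B\<lparr>carrier := A\<rparr>" "self_module B"
    using B A by (rule self_module_module)
  have sub: "A \<subseteq> carrier B" using A by (rule subringE(1))
  show ?thesis
  proof (rule pseudo_arithmetical_triv_extD[OF T])
    \<comment> \<open>The unit of \<open>B\<close> serves as \<open>\<beta>\<close>: multiplying it
      by elements of \<open>A\<close> is the inclusion of \<open>A\<close> in
      \<open>B\<close>.\<close>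
    show "\<one>\<^bsub>B\<^esub> \<in> carrier (self_module B)" by (simp add: self_module_def)
    fix a b assume "a \<in> carrier (B\<lparr>carrier := A\<rparr>)" "b \<in> carrier (B\<lparr>carrier := A\<rparr>)"
      "a \<odot>\<^bsub>self_module B\<^esub> \<one>\<^bsub>B\<^esub> = b \<odot>\<^bsub>self_module B\<^esub> \<one>\<^bsub>B\<^esub>"
    thus "a = b" using sub by (auto simp: self_module_def subset_iff)
  qed
qed

theorem theorem4p2:
  shows "(\<forall>(K :: ('a, 'm) ring_scheme) A.
            is_quotient_field A K \<longrightarrow>
            pseudo_arithmetical (triv_ext (K\<lparr>carrier := A\<rparr>) (self_module K))) \<and>
         (\<forall>(B :: ('b, 'n) ring_scheme) A.
            cring B \<longrightarrow> subring A B \<longrightarrow>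
            pseudo_arithmetical (triv_ext (B\<lparr>carrier := A\<rparr>) (self_module B)) \<longrightarrow>
            pseudo_arithmetical (B\<lparr>carrier := A\<rparr>))"
  using pseudo_arithmetical_quotient_field pseudo_arithmetical_subring by blast

end
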